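(* Let $X$ be the compound Poisson process with two-sided exponential jumps $$X_t=x-\sum_{i=1}^{N^{(1)}_t}Y^{(1)}_i+\sum_{i=1}^{N^{(2)}_t}Y^{(2)}_i,\quad t\ge 0,$$ where $N^{(1)},N^{(2)}$ are Poisson processes with intensities $\lambda_1,\lambda_2>0$, and $Y^{(1)}=\{Y^{(1)}_i\}_{i\ge1}$, $Y^{(2)}=\{Y^{(2)}_i\}_{i\ge1}$ are sequences of independent exponentially distributed random variables with parameters $\alpha_1,\alpha_2>0$ respectively, the four processes $N^{(1)},N^{(2)},Y^{(1)},Y^{(2)}$ being independent. Let $g(x)=|x|$ and $r>0$. With the constants $r_1,r_2,E_1,E_2,F_1,F_2,G_1,G_2$ given in the context, let $u$ be the unique positive root of the equation $$u=\frac{E_1+E_2+(E_1G_2+E_2G_1)e^{-(r_1+r_2)u}+E_1F_2e^{-r_1u}+E_2F_1e^{-r_2u}}{1-G_1G_2e^{-(r_1+r_2)u}},$$ and denote $$x_1=\frac{E_1(1-e^{-(r_1+r_2)u})+F_1ue^{-r_2u}}{1+G_1e^{-(r_1+r_2)u}+F_1e^{-r_2u}},\qquad x_2=\frac{E_2(1-e^{-(r_1+r_2)u})+F_2ue^{-r_1u}}{1+G_2e^{-(r_1+r_2)u}+F_2e^{-r_1u}},$$ $$D_1=\frac{x_1-x_2e^{-r_2(x_1+x_2)}}{1-e^{-(r_1+r_2)(x_1+x_2)}},\qquad D_2=\frac{x_2-x_1e^{-r_1(x_1+x_2)}}{1-e^{-(r_1+r_2)(x_1+x_2)}}.$$ Then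 the value function $$V(x)=\begin{cases}-x, & x<-x_1,\\ D_1e^{-r_1(x+x_1)}+D_2e^{r_2(x-x_2)}, & -x_1\le x\le x_2,\\ x, & x_2<x,\end{cases}$$ and the stopping time $$\tau^*=\inf\{t\ge0\colon X_t\notin(-x_1,x_2)\}$$ are the solution of the optimal stopping problem with payoff $g(x)=|x|$ and discount rate $r$; that is, for all $x\in\mathbb{R}$, $$V(x)=\sup_{\tau\in\mathcal{M}}\mathbf{E}_x\big(e^{-r\tau}|X_\tau|\big)=\mathbf{E}_x\big(e^{-r\tau^*}|X_{\tau^*}|\big).$$
   Context: The process $X$ is defined on a stochastic basis $(\Omega,\mathcal{F},(\mathcal{F}_t)_{t\ge0},\mathbf{P}_x)$ (a filtered probability space satisfying the usual conditions, with $X$ a Lévy process relative to the filtration); $X_0=x$ under $\mathbf{P}_x$, and $\mathbf{E}_x$ is the corresponding expectation. The class $\mathcal{M}$ is the set of all stopping times $\tau\colon\Omega\to[0,\infty]$ of the filtration (the value $\infty$ is allowed), and the payoff on $\{\tau=\infty\}$ is zero, i.e. $e^{-r\tau}g(X_\tau)$ means $e^{-r\tau}g(X_\tau)\mathbf{1}_{\{\tau<\infty\}}$. The characteristic exponent of $X$ (with $\mathbf{E}_0e^{zX_t}=e^{t\psi(z)}$) is $$\psi(z)=-\lambda_1\frac{z}{\alpha_1+z}+\lambda_2\frac{z}{\alpha_2-z},$$ and $-r_1,r_2$ are the roots of $\psi(z)=r$, which satisfy $-\alpha_1<-r_1<0<r_2<\alpha_2$. Set $$E_1=\frac1{r_1}-\frac1{\alpha_1},\qquad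 E_2=\frac1{r_2}-\frac1{\alpha_2},$$ $$F_1=\frac{\alpha_1}{r_1}\,\frac{r_1+r_2}{\alpha_1+r_2},\qquad F_2=\frac{\alpha_2}{r_2}\,\frac{r_1+r_2}{r_1+\alpha_2},$$ $$G_1=F_1-1=\frac{r_2(\alpha_1-r_1)}{r_1(\alpha_1+r_2)},\qquad G_2=F_2-1=\frac{r_1(\alpha_2-r_2)}{r_2(r_1+\alpha_2)}.$$ *)

theory Defs
  imports "HOL-Probability.Probability"
begin

(* A filtered probability space with the usual conditions. Time runs through ennreal = [0, \<infinity>],
   so that the library's stopping_time F \<tau> with \<tau> :: 'a \<Rightarrow> ennreal describes stopping times which
   may take the value \<infinity>. For these F \<infinity> is irrelevant: the condition on {\<tau> \<le> \<infinity>} is void,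
   and right-continuity below is required at finite times only. *)
locale stochastic_basis =
  prob_space P + complete_measure P + filtration "space P" F
  for P :: "'a measure" and F :: "ennreal \<Rightarrow> 'a measure" +
  assumes F_subalgebra: "\<And>t. subalgebra P (F t)"
    and null_sets_F: "null_sets P \<subseteq> sets (F 0)"
    and F_right_continuous: "\<And>t. t < \<infinity> \<Longrightarrow> sets (F t) = (\<Inter>s\<in>{t<..}. sets (F s))"

definition cadlag :: "(real \<Rightarrow> real) \<Rightarrow> bool" where
  "cadlag f \<longleftrightarrow> (\<forall>t\<ge>0. continuous (at_right t) f) \<and> (\<forall>t>0. \<exists>l. (f \<longlongrightarrow> l) (at_left t))"

(* Processes have real time; only their values at times t \<ge> 0 are constrained or used.
   The initial value X 0 is left free, X 0 being adapted. *)
definition (in stochastic_basis) levy_process :: "(real \<Rightarrow> 'a \<Rightarrow> real) \<Rightarrow> bool" where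
  "levy_process X \<longleftrightarrow>
     (\<forall>t\<ge>0. X t \<in> borel_measurable (F (ennreal t))) \<and>
     (\<forall>s t. 0 \<le> s \<longrightarrow> s \<le> t \<longrightarrow>
        indep_set (sets (F (ennreal s)))
          (sets (vimage_algebra (space P) (\<lambda>\<omega>. X t \<omega> - X s \<omega>) borel))) \<and>
     (\<forall>s t. 0 \<le> s \<longrightarrow> s \<le> t \<longrightarrow>
        distr P borel (\<lambda>\<omega>. X t \<omega> - X s \<omega>) = distr P borel (\<lambda>\<omega>. X (t - s) \<omega> - X 0 \<omega>)) \<and>
     (AE \<omega> in P. cadlag (\<lambda>t. X t \<omega>))"

(* The truncated subtraction on nat is harmless: paths are almost surely nondecreasing. *)
definition (in prob_space) poisson_process :: "real \<Rightarrow> (real \<Rightarrow> 'a \<Rightarrow> nat) \<Rightarrow> bool" where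
  "poisson_process lam N \<longleftrightarrow>
     (\<forall>t\<ge>0. N t \<in> measurable M (count_space UNIV)) \<and>
     (AE \<omega> in M. N 0 \<omega> = 0 \<and> mono_on {0..} (\<lambda>t. N t \<omega>) \<and>
        (\<forall>t\<ge>0. continuous (at_right t) (\<lambda>s. N s \<omega>))) \<and>
     (\<forall>s t. 0 \<le> s \<longrightarrow> s < t \<longrightarrow>
        distr M (count_space UNIV) (\<lambda>\<omega>. N t \<omega> - N s \<omega>) = measure_pmf (poisson_pmf (lam * (t - s)))) \<and>
     (\<forall>T :: nat \<Rightarrow> real. 0 \<le> T 0 \<longrightarrow> incseq T \<longrightarrow>
        indep_vars (\<lambda>_. count_space UNIV) (\<lambda>i \<omega>. N (T (Suc i)) \<omega> - N (T i) \<omega>) UNIV)"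

definition (in prob_space) iid_exponential :: "real \<Rightarrow> (nat \<Rightarrow> 'a \<Rightarrow> real) \<Rightarrow> bool" where
  "iid_exponential \<alpha> Y \<longleftrightarrow>
     indep_vars (\<lambda>_. borel) Y {1..} \<and>
     (\<forall>i\<ge>1. distributed M lborel (Y i) (exponential_density \<alpha>))"

(* The sigma-algebra on the sample space generated by the variables Z t, t \<in> T. *)
definition (in prob_space) generated_events ::
    "'t set \<Rightarrow> 'b measure \<Rightarrow> ('t \<Rightarrow> 'a \<Rightarrow> 'b) \<Rightarrow> 'a set set" where
  "generated_events T B Z = sigma_sets (space M) {Z t -` A \<inter> space M |t A. t \<in> T \<and> A \<in> sets B}"

definition (in prob_space) indep_drivers ::
    "(real \<Rightarrow> 'a \<Rightarrow> nat) \<Rightarrow> (real \<Rightarrow> 'a \<Rightarrow> nat) \<Rightarrow> (nat \<Rightarrow> 'a \<Rightarrow> real) \<Rightarrow> (nat \<Rightarrow> 'a \<Rightarrow> real) \<Rightarrow> bool" where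
  "indep_drivers N1 N2 Y1 Y2 \<longleftrightarrow>
     indep_sets ((!) [generated_events {0..} (count_space UNIV) N1,
                      generated_events {0..} (count_space UNIV) N2,
                      generated_events {1..} borel Y1,
                      generated_events {1..} borel Y2]) {..<4}"

definition compound_process ::
    "real \<Rightarrow> (real \<Rightarrow> 'a \<Rightarrow> nat) \<Rightarrow> (real \<Rightarrow> 'a \<Rightarrow> nat) \<Rightarrow> (nat \<Rightarrow> 'a \<Rightarrow> real) \<Rightarrow> (nat \<Rightarrow> 'a \<Rightarrow> real) \<Rightarrow>
     real \<Rightarrow> 'a \<Rightarrow> real" where
  "compound_process x N1 N2 Y1 Y2 t \<omega> =
     x - (\<Sum>i = 1..N1 t \<omega>. Y1 i \<omega>) + (\<Sum>i = 1..N2 t \<omega>. Y2 i \<omega>)"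

definition discounted_payoff ::
    "real \<Rightarrow> (real \<Rightarrow> real) \<Rightarrow> (real \<Rightarrow> 'a \<Rightarrow> real) \<Rightarrow> ('a \<Rightarrow> ennreal) \<Rightarrow> 'a \<Rightarrow> real" where
  "discounted_payoff r g X \<tau> \<omega> =
     (if \<tau> \<omega> < \<infinity> then exp (- r * enn2real (\<tau> \<omega>)) * g (X (enn2real (\<tau> \<omega>)) \<omega>) else 0)"

(* Inf {} = \<infinity> in ennreal: the exit time is \<infinity> on paths that never leave A. *)
definition exit_time :: "(real \<Rightarrow> 'a \<Rightarrow> real) \<Rightarrow> real set \<Rightarrow> 'a \<Rightarrow> ennreal" where
  "exit_time X A \<omega> = (INF t\<in>{t. 0 \<le> t \<and> X t \<omega> \<notin> A}. ennreal t)"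

definition char_exponent :: "real \<Rightarrow> real \<Rightarrow> real \<Rightarrow> real \<Rightarrow> real \<Rightarrow> real" where
  "char_exponent lam1 lam2 \<alpha>1 \<alpha>2 z = - lam1 * (z / (\<alpha>1 + z)) + lam2 * (z / (\<alpha>2 - z))"

(* The roots exist, lie between the poles, and are the only solutions; the poles themselves do not
   become spurious solutions through division by zero. *)
lemma char_exponent_roots:
  assumes pos: "0 < lam1" "0 < lam2" "0 < \<alpha>1" "0 < \<alpha>2" "0 < r"
  shows "\<exists>r1 r2. - \<alpha>1 < - r1 \<and> - r1 < 0 \<and> 0 < r2 \<and> r2 < \<alpha>2 \<and>
           {z. char_exponent lam1 lam2 \<alpha>1 \<alpha>2 z = r} = {- r1, r2}"
proof -
  define a where "a = lam1 + lam2 + r"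
  define b where "b = lam2 * \<alpha>1 - lam1 * \<alpha>2 - r * (\<alpha>2 - \<alpha>1)"
  define p where "p = (\<lambda>z. a * z\<^sup>2 + b * z - r * \<alpha>1 * \<alpha>2)"
  have p: "p z = - lam1 * z * (\<alpha>2 - z) + lam2 * z * (\<alpha>1 + z) - r * (\<alpha>1 + z) * (\<alpha>2 - z)" for z
    unfolding p_def a_def b_def by (simp add: algebra_simps power2_eq_square)
  have p_iff: "char_exponent lam1 lam2 \<alpha>1 \<alpha>2 z = r \<longleftrightarrow> p z = 0" if "z \<noteq> - \<alpha>1" "z \<noteq> \<alpha>2" for z
  proof -
    have "\<alpha>1 + z \<noteq> 0" "\<alpha>2 - z \<noteq> 0" using that by auto
    have "- lam1 * z * d + lam2 * z * c - r * c * d = (- lam1 * (z / c) + lam2 * (z / d) - r) * (c * d)"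
      if "c \<noteq> 0" "d \<noteq> 0" for c d
      using that by (simp add: field_simps)
    from this[OF \<open>\<alpha>1 + z \<noteq> 0\<close> \<open>\<alpha>2 - z \<noteq> 0\<close>]
    have "p z = (char_exponent lam1 lam2 \<alpha>1 \<alpha>2 z - r) * ((\<alpha>1 + z) * (\<alpha>2 - z))"
      unfolding p char_exponent_def .
    with \<open>\<alpha>1 + z \<noteq> 0\<close> \<open>\<alpha>2 - z \<noteq> 0\<close> show ?thesis by simp
  qed
  have p_pos: "0 < p (- \<alpha>1)" "p 0 < 0" "0 < p \<alpha>2"
    using pos by (simp_all add: p mult_pos_pos add_pos_pos)
  have cont: "isCont p z" for z unfolding p_def by (intro continuous_intros)
  obtain z1 where z1: "- \<alpha>1 \<le> z1" "z1 \<le> 0" "p z1 = 0"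
    using IVT2[of p 0 0 "- \<alpha>1"] p_pos pos cont by (metis less_imp_le neg_le_0_iff_le)
  obtain z2 where z2: "0 \<le> z2" "z2 \<le> \<alpha>2" "p z2 = 0"
    using IVT[of p 0 0 \<alpha>2] p_pos pos cont by (metis less_imp_le)
  have strict: "- \<alpha>1 < z1" "z1 < 0" "0 < z2" "z2 < \<alpha>2"
    using z1 z2 p_pos by (metis less_irrefl order_le_less)+
  have "(z2 - z1) * (a * (z1 + z2) + b) = p z2 - p z1"
    unfolding p_def by (simp add: algebra_simps power2_eq_square)
  then have ab: "b = - a * (z1 + z2)" using z1 z2 strict by auto
  have "p z = a * (z - z1) * (z - z2)" for z
  proof -
    have "p z = p z - p z2" using z2 by simp
    also have "\<dots> = (z - z2) * (a * (z + z2) + b)"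
      unfolding p_def by (simp add: algebra_simps power2_eq_square)
    also have "\<dots> = a * (z - z1) * (z - z2)" unfolding ab by (simp add: algebra_simps)
    finally show ?thesis .
  qed
  moreover have "a \<noteq> 0" using pos by (simp add: a_def)
  ultimately have p0: "p z = 0 \<longleftrightarrow> z = z1 \<or> z = z2" for z by simp
  have "- (lam2 * \<alpha>1 / (\<alpha>2 + \<alpha>1)) < 0" "- (lam1 * \<alpha>2 / (\<alpha>1 + \<alpha>2)) < 0" using pos by simp_all
  note this[THEN less_trans, OF \<open>0 < r\<close>]
  then have "char_exponent lam1 lam2 \<alpha>1 \<alpha>2 (- \<alpha>1) < r" "char_exponent lam1 lam2 \<alpha>1 \<alpha>2 \<alpha>2 < r"
    using pos unfolding char_exponent_def by simp_all
  then have "{z. char_exponent lam1 lam2 \<alpha>1 \<alpha>2 z = r} = {z1, z2}"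
    using p_iff p0 strict by auto (metis less_irrefl)+
  then show ?thesis using strict by (intro exI[of _ "- z1"] exI[of _ z2]) simp
qed

end

theory Submission
  imports Defs "HOL-Real_Asymp.Real_Asymp"
begin

text \<open>
  Let \<open>L\<close> be the generator of \<open>X\<close>. On \<open>[- x1, x2]\<close> the function \<open>V\<close> is a combination of the
  \<open>r\<close>-harmonic exponentials \<open>exp (- r1 x)\<close> and \<open>exp (r2 x)\<close>, and by the equations for \<open>x1\<close>, \<open>x2\<close>, \<open>u\<close>
  the mean of the payoff over an exponential overshoot agrees on both sides with that of this
  combination, so that \<open>L V = r V\<close> there. Moreover \<open>V\<close> is convex with slopes in \<open>[- 1, 1]\<close>. Hence
  \<open>V x \<ge> \<bar>x\<bar>\<close>, and moving from \<open>x2\<close> to \<open>x2 + d\<close> raises every mean of \<open>V\<close> by at most \<open>d\<close> but \<open>V\<close> itself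
  by exactly \<open>d\<close> (symmetrically on the left), so that \<open>L V \<le> r V\<close> everywhere.

  The transition operators of \<open>X\<close> are power series in the jump operators, with nonnegative
  coefficients. For the discounted process \<open>exp (- r t) V (X t)\<close> this turns \<open>L V \<le> r V\<close> into the
  supermartingale property, and \<open>L V = r V\<close> into a submartingale property on the grid of mesh \<open>h\<close> up
  to factors \<open>1 - O(h\<^sup>2)\<close>, whose product over a bounded time interval tends to \<open>1\<close>. Optional stopping
  on grids and the limit \<open>h \<rightarrow> 0\<close>, by Fatou's lemma in the first case and by dominated convergence in
  the second, yield the upper bound for all stopping times and the lower bound for the exit time.
\<close>

section \<open>Jump operators of a compound Poisson process\<close>

text \<open>All means are integrals of nonnegative \<open>ennreal\<close> functions:
  \<open>V\<close> grows linearly, and in this form Tonelli, power series and comparisons carry no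
  integrability conditions. Integrability of the payoffs comes out at the end, from the upper bound
  itself.

  The two bounds are not symmetric. The inequality for the generator holds at every point, so it can
  be iterated through all powers of the jump operator and sums to an exact exponential bound. The
  equation holds only between the thresholds, and a single jump may lead outside. Only the terms
  with at most one jump are then usable, whence the factor
  \<open>exp (- c * h) * (1 + c * h)\<close> per step, with \<open>c = lam1 + lam2 + r\<close>.

  Exponential jumps have no memory, so the overshoot over a threshold is again exponential, and the
  branch of \<open>V\<close> beyond it is felt inside the interval only through one number, its mean
  over that overshoot. This gives one equation per threshold besides continuity. For a prescribed
  length \<open>u\<close> of the interval these equations are linear in \<open>x1\<close> and
  \<open>x2\<close>; the equation for \<open>u\<close> says that the solutions add up to
  \<open>u\<close>.\<close>

definition jump :: "real measure \<Rightarrow> (real \<Rightarrow> ennreal) \<Rightarrow> real \<Rightarrow> ennreal" where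
  "jump J f y = (\<integral>\<^sup>+z. f (y + z) \<partial>J)"

lemma jump_mono:
  assumes "\<And>y. f y \<le> g y"
  shows "jump J f y \<le> jump J g y"
  unfolding jump_def by (intro nn_integral_mono assms)

context
  fixes J :: "real measure"
  assumes J: "prob_space J" and sets_J[measurable_cong]: "sets J = sets borel"
begin

lemma borel_measurable_jump:
  assumes [measurable]: "f \<in> borel_measurable borel"
  shows "jump J f \<in> borel_measurable borel"
proof -
  interpret prob_space J by (rule J)
  show ?thesis unfolding jump_def[abs_def] by measurable
qed

lemma borel_measurable_jump_pow:
  assumes "f \<in> borel_measurable borel"
  shows "(jump J ^^ n) f \<in> borel_measurable borel"
  by (induction n) (auto intro: borel_measurable_jump assms)

lemma jump_sum:
  assumes [measurable]: "\<And>i. i \<in> I \<Longrightarrow> f i \<in> borel_measurable borel"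
  shows "jump J (\<lambda>y. \<Sum>i\<in>I. f i y) y = (\<Sum>i\<in>I. jump J (f i) y)"
  unfolding jump_def by (intro nn_integral_sum) measurable

lemma jump_cmult:
  assumes [measurable]: "f \<in> borel_measurable borel"
  shows "jump J (\<lambda>y. c * f y) y = c * jump J f y"
  unfolding jump_def by (intro nn_integral_cmult) measurable

end

text \<open>Jump sizes add, so the two orders differ only by the order of integration, which Tonelli
  exchanges. Mixed powers can then be collected as in the binomial theorem.\<close>

lemma jump_commute:
  assumes J: "prob_space J" "sets J = sets borel" and K: "prob_space K" "sets K = sets borel"
    and f[measurable]: "f \<in> borel_measurable borel"
  shows "jump J (jump K f) = jump K (jump J f)"
proof
  fix y
  note [measurable_cong] = J(2) K(2)
  interpret J: prob_space J by (rule J)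
  interpret K: prob_space K by (rule K)
  interpret pair_sigma_finite K J ..
  have "jump J (jump K f) y = (\<integral>\<^sup>+z. \<integral>\<^sup>+w. f (y + z + w) \<partial>K \<partial>J)"
    unfolding jump_def ..
  also have "\<dots> = (\<integral>\<^sup>+w. \<integral>\<^sup>+z. f (y + z + w) \<partial>J \<partial>K)"
    by (rule Fubini') measurable
  also have "\<dots> = jump K (jump J f) y"
    unfolding jump_def by (simp add: ac_simps)
  finally show "jump J (jump K f) y = jump K (jump J f) y" .
qed

lemma jump_pow_commute:
  assumes J: "prob_space J" "sets J = sets borel" and K: "prob_space K" "sets K = sets borel"
    and f: "f \<in> borel_measurable borel"
  shows "jump J ((jump K ^^ n) f) = (jump K ^^ n) (jump J f)"
proof (induction n)
  case (Suc n)
  show ?case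
    using jump_commute[OF J K borel_measurable_jump_pow[OF K f, of n]] Suc by simp
qed simp

text \<open>The \<open>n\<close>-th power of \<open>l1 \<cdot> jump J + l2 \<cdot> jump K\<close>, expanded by the binomial theorem and
  divided by \<open>n!\<close>. Multiplying the terms of degree \<open>n + 1\<close> by \<open>n + 1 = i + (n + 1 - i)\<close>
  splits them into the two parts of the operator applied to the terms of degree \<open>n\<close>.\<close>

lemma jump_binomial_le:
  assumes J: "prob_space J" "sets J = sets borel" and K: "prob_space K" "sets K = sets borel"
    and f: "f \<in> borel_measurable borel"
    and nonneg: "0 \<le> l1" "0 \<le> l2" "0 \<le> c"
    and le: "\<And>y. ennreal l1 * jump J f y + ennreal l2 * jump K f y \<le> ennreal c * f y"
  shows "(\<Sum>i\<le>n. ennreal (l1 ^ i / fact i * (l2 ^ (n - i) / fact (n - i))) *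
            (jump J ^^ i) ((jump K ^^ (n - i)) f) y) \<le> ennreal (c ^ n / fact n) * f y"
proof (induction n arbitrary: y)
  case (Suc n)
  define a where "a i j = (jump J ^^ i) ((jump K ^^ j) f)" for i j
  define b where "b i j = l1 ^ i / fact i * (l2 ^ j / fact j)" for i j :: nat
  have b: "0 \<le> b i j" for i j using nonneg by (simp add: b_def)
  have a_meas: "a i j \<in> borel_measurable borel" for i j
    unfolding a_def by (intro borel_measurable_jump_pow J K f)
  have meas: "(\<lambda>y. ennreal t * a i j y) \<in> borel_measurable borel" for t i j
    using a_meas by measurable
  define S where "S m y = (\<Sum>i\<le>m. ennreal (b i (m - i)) * a i (m - i) y)" for m y
  have IH: "S n y \<le> ennreal (c ^ n / fact n) * f y" for y
    using Suc.IH unfolding S_def a_def b_def .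
  have aJ: "jump J (a i j) = a (Suc i) j" for i j
    by (simp add: a_def)
  have aK: "jump K (a i j) = a i (Suc j)" for i j
    unfolding a_def using jump_pow_commute[OF K J borel_measurable_jump_pow[OF K f]] by simp
  have SJ: "jump J (S n) y = (\<Sum>i\<le>n. ennreal (b i (n - i)) * a (Suc i) (n - i) y)" for y
    unfolding S_def[abs_def] by (simp add: jump_sum[OF J] jump_cmult[OF J] a_meas meas aJ)
  have SK: "jump K (S n) y = (\<Sum>i\<le>n. ennreal (b i (n - i)) * a i (Suc n - i) y)" for y
    unfolding S_def[abs_def]
    by (simp add: jump_sum[OF K] jump_cmult[OF K] a_meas meas aK Suc_diff_le)
  have bJ: "ennreal l1 * ennreal (b i j) = of_nat (Suc i) * ennreal (b (Suc i) j)" for i j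
  proof -
    have "l1 * b i j = real (Suc i) * b (Suc i) j"
      by (simp add: b_def del: of_nat_Suc)
    then show ?thesis using b nonneg
      by (simp only: ennreal_mult[symmetric] ennreal_of_nat_eq_real_of_nat of_nat_0_le_iff)
  qed
  have bK: "ennreal l2 * ennreal (b i j) = of_nat (Suc j) * ennreal (b i (Suc j))" for i j
  proof -
    have "l2 * b i j = real (Suc j) * b i (Suc j)"
      by (simp add: b_def del: of_nat_Suc)
    then show ?thesis using b nonneg
      by (simp only: ennreal_mult[symmetric] ennreal_of_nat_eq_real_of_nat of_nat_0_le_iff)
  qed
  define t where "t i = ennreal (b i (Suc n - i)) * a i (Suc n - i) y" for i
  have "of_nat (Suc n) * S (Suc n) y = (\<Sum>i\<le>Suc n. (of_nat i + of_nat (Suc n - i)) * t i)"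
    unfolding S_def t_def sum_distrib_left
    by (intro sum.cong refl) (simp add: of_nat_add[symmetric] del: of_nat_add of_nat_Suc)
  also have "\<dots> = (\<Sum>i\<le>Suc n. of_nat i * t i) + (\<Sum>i\<le>Suc n. of_nat (Suc n - i) * t i)"
    by (simp only: distrib_right sum.distrib)
  also have "(\<Sum>i\<le>Suc n. of_nat i * t i) = (\<Sum>i\<le>n. of_nat (Suc i) * t (Suc i))"
    by (subst sum.atMost_Suc_shift) simp
  also have "\<dots> = ennreal l1 * jump J (S n) y"
    unfolding SJ t_def sum_distrib_left mult.assoc[symmetric] bJ by simp
  also have "(\<Sum>i\<le>Suc n. of_nat (Suc n - i) * t i) = (\<Sum>i\<le>n. of_nat (Suc (n - i)) * t i)"
    by (simp add: Suc_diff_le)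
  also have "\<dots> = ennreal l2 * jump K (S n) y"
    unfolding SK t_def sum_distrib_left mult.assoc[symmetric] bK
    by (intro sum.cong) (simp_all add: Suc_diff_le)
  also have "ennreal l1 * jump J (S n) y + ennreal l2 * jump K (S n) y \<le>
      ennreal l1 * jump J (\<lambda>y. ennreal (c ^ n / fact n) * f y) y +
      ennreal l2 * jump K (\<lambda>y. ennreal (c ^ n / fact n) * f y) y"
    by (intro add_mono mult_left_mono jump_mono IH) auto
  also have "\<dots> = ennreal (c ^ n / fact n) * (ennreal l1 * jump J f y + ennreal l2 * jump K f y)"
    unfolding jump_cmult[OF J f] jump_cmult[OF K f] distrib_left by (simp only: mult_ac)
  also have "\<dots> \<le> ennreal (c ^ n / fact n) * (ennreal c * f y)"
    by (intro mult_left_mono le) auto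
  also have "\<dots> = of_nat (Suc n) * (ennreal (c ^ Suc n / fact (Suc n)) * f y)"
  proof -
    have "c ^ n / fact n * c = real (Suc n) * (c ^ Suc n / fact (Suc n))"
      by (simp del: of_nat_Suc)
    then have "ennreal (c ^ n / fact n) * ennreal c =
        of_nat (Suc n) * ennreal (c ^ Suc n / fact (Suc n))"
      using nonneg
      by (simp only: ennreal_mult[symmetric] ennreal_of_nat_eq_real_of_nat of_nat_0_le_iff
        divide_nonneg_nonneg zero_le_power fact_ge_zero)
    then show ?thesis by (simp only: mult.assoc[symmetric])
  qed
  finally have "of_nat (Suc n) * S (Suc n) y \<le>
      of_nat (Suc n) * (ennreal (c ^ Suc n / fact (Suc n)) * f y)" .
  then have "S (Suc n) y \<le> ennreal (c ^ Suc n / fact (Suc n)) * f y"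
    by (subst (asm) ennreal_mult_le_mult_iff) (auto simp del: of_nat_Suc)
  then show ?case
    unfolding S_def a_def b_def .
qed simp

text \<open>A finite rectangle of indices lies in the triangle \<open>m + n < M + N\<close>, and all
  terms are nonnegative. This regroups the double Poisson series by the total number of
  jumps.\<close>

lemma suminf_suminf_le:
  fixes g :: "nat \<Rightarrow> nat \<Rightarrow> ennreal"
  assumes "\<And>n. (\<Sum>k<n. \<Sum>i\<le>k. g i (k - i)) \<le> B"
  shows "(\<Sum>m. \<Sum>n. g m n) \<le> B"
proof (rule suminf_le_const)
  fix M
  have "(\<Sum>m<M. \<Sum>n. g m n) = (\<Sum>n. \<Sum>m<M. g m n)"
    by (rule suminf_sum[symmetric]) simp
  also have "\<dots> \<le> B"
  proof (rule suminf_le_const)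
    fix N
    have "(\<Sum>n<N. \<Sum>m<M. g m n) = (\<Sum>m<M. \<Sum>n<N. g m n)"
      by (rule sum.swap)
    also have "\<dots> = (\<Sum>(m, n)\<in>{..<M} \<times> {..<N}. g m n)"
      by (rule sum.cartesian_product)
    also have "\<dots> \<le> (\<Sum>(m, n)\<in>{(m, n). m + n < M + N}. g m n)"
    proof (rule sum_mono2)
      have "{(m, n). m + n < M + N} \<subseteq> {..<M + N} \<times> {..<M + N}" by auto
      then show "finite {(m, n). m + n < M + N}"
        by (rule finite_subset) simp
    qed auto
    also have "\<dots> \<le> B"
      unfolding sum.triangle_reindex by (rule assms)
    finally show "(\<Sum>n<N. \<Sum>m<M. g m n) \<le> B" .
  qed simp
  finally show "(\<Sum>m<M. \<Sum>n. g m n) \<le> B" .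
qed simp

text \<open>The transition operator of a compound Poisson process with jumps of law \<open>J\<close> at rate \<open>l1\<close>
  and jumps of law \<open>K\<close> at rate \<open>l2\<close>.\<close>

definition jump_semigroup ::
    "real \<Rightarrow> real measure \<Rightarrow> real \<Rightarrow> real measure \<Rightarrow> real \<Rightarrow> (real \<Rightarrow> ennreal) \<Rightarrow> real \<Rightarrow> ennreal"
  where
  "jump_semigroup l1 J l2 K h f y =
     (\<Sum>m. \<Sum>n. ennreal ((l1 * h) ^ m / fact m * exp (- (l1 * h))) *
              ennreal ((l2 * h) ^ n / fact n * exp (- (l2 * h))) *
              (jump J ^^ m) ((jump K ^^ n) f) y)"

text \<open>Up to the common Poisson factor, the terms with \<open>k\<close> jumps in total are at
  most \<open>(c * h) ^ k / fact k\<close> times \<open>f y\<close>. They sum to an exponential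
  series, so the infinitesimal inequality passes to time \<open>h\<close> without loss.\<close>

lemma jump_semigroup_le:
  assumes J: "prob_space J" "sets J = sets borel" and K: "prob_space K" "sets K = sets borel"
    and f: "f \<in> borel_measurable borel"
    and nonneg: "0 \<le> l1" "0 \<le> l2" "0 \<le> c" "0 \<le> h"
    and le: "\<And>y. ennreal l1 * jump J f y + ennreal l2 * jump K f y \<le> ennreal c * f y"
  shows "jump_semigroup l1 J l2 K h f y \<le> ennreal (exp ((c - l1 - l2) * h)) * f y"
  unfolding jump_semigroup_def
proof (rule suminf_suminf_le)
  fix n
  define d where "d = exp (- (l1 * h)) * exp (- (l2 * h))"
  have d: "0 \<le> d" by (simp add: d_def)
  have coeff: "ennreal ((l1 * h) ^ i / fact i * exp (- (l1 * h))) *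
      ennreal ((l2 * h) ^ (k - i) / fact (k - i) * exp (- (l2 * h))) =
      ennreal (d * h ^ k) * ennreal (l1 ^ i / fact i * (l2 ^ (k - i) / fact (k - i)))"
    if "i \<le> k" for i k
  proof -
    have "h ^ k = h ^ i * h ^ (k - i)" using that by (simp add: power_add[symmetric])
    then show ?thesis using nonneg
      by (simp add: ennreal_mult[symmetric] d_def power_mult_distrib field_simps)
  qed
  have "(\<Sum>k<n. \<Sum>i\<le>k. ennreal ((l1 * h) ^ i / fact i * exp (- (l1 * h))) *
      ennreal ((l2 * h) ^ (k - i) / fact (k - i) * exp (- (l2 * h))) *
      (jump J ^^ i) ((jump K ^^ (k - i)) f) y) =
    (\<Sum>k<n. ennreal (d * h ^ k) *
      (\<Sum>i\<le>k. ennreal (l1 ^ i / fact i * (l2 ^ (k - i) / fact (k - i))) *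
        (jump J ^^ i) ((jump K ^^ (k - i)) f) y))"
    unfolding sum_distrib_left mult.assoc[symmetric]
    by (intro sum.cong refl) (simp only: coeff atMost_iff)
  also have "\<dots> \<le> (\<Sum>k<n. ennreal (d * h ^ k) * (ennreal (c ^ k / fact k) * f y))"
    by (intro sum_mono mult_left_mono jump_binomial_le J K f nonneg le) auto
  also have "\<dots> = (\<Sum>k<n. ennreal (d * ((c * h) ^ k / fact k)) * f y)"
  proof (intro sum.cong refl)
    fix k
    have "ennreal (d * h ^ k) * ennreal (c ^ k / fact k) = ennreal (d * ((c * h) ^ k / fact k))"
      using nonneg d by (simp add: ennreal_mult[symmetric] power_mult_distrib mult_ac)
    then show "ennreal (d * h ^ k) * (ennreal (c ^ k / fact k) * f y) =
        ennreal (d * ((c * h) ^ k / fact k)) * f y"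
      by (simp only: mult.assoc[symmetric])
  qed
  also have "\<dots> = ennreal (d * (\<Sum>k<n. (c * h) ^ k / fact k)) * f y"
    unfolding sum_distrib_right[symmetric] sum_distrib_left using nonneg d
    by (subst sum_ennreal) auto
  also have "\<dots> \<le> ennreal (d * exp (c * h)) * f y"
  proof -
    have "(\<lambda>k. (c * h) ^ k / fact k) sums exp (c * h)"
      using exp_converges[of "c * h"] by (simp add: field_simps)
    then have "(\<Sum>k<n. (c * h) ^ k / fact k) \<le> exp (c * h)"
      using nonneg by (intro sum_le_suminf[THEN order_trans]) (auto simp: sums_iff)
    then show ?thesis using d by (intro mult_right_mono ennreal_leI mult_left_mono) auto
  qed
  also have "d * exp (c * h) = exp ((c - l1 - l2) * h)"
    by (simp add: d_def exp_add[symmetric] algebra_simps)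
  finally show "(\<Sum>k<n. \<Sum>i\<le>k. ennreal ((l1 * h) ^ i / fact i * exp (- (l1 * h))) *
      ennreal ((l2 * h) ^ (k - i) / fact (k - i) * exp (- (l2 * h))) *
      (jump J ^^ i) ((jump K ^^ (k - i)) f) y) \<le> ennreal (exp ((c - l1 - l2) * h)) * f y" .
qed

text \<open>The equation is assumed at the single point \<open>y\<close>, so nothing is known after
  a jump away from it. The terms with at most one jump are evaluated exactly, the others dropped as
  nonnegative; compared with \<open>exp ((c - l1 - l2) * h)\<close> the relative loss is of order
  \<open>h ^ 2\<close>.\<close>

lemma jump_semigroup_ge:
  assumes nonneg: "0 \<le> l1" "0 \<le> l2" "0 \<le> c" "0 \<le> h"
    and eq: "ennreal l1 * jump J f y + ennreal l2 * jump K f y = ennreal c * f y"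
  shows "ennreal (exp (- (l1 + l2) * h) * (1 + c * h)) * f y \<le> jump_semigroup l1 J l2 K h f y"
proof -
  define p where "p m = ennreal ((l1 * h) ^ m / fact m * exp (- (l1 * h)))" for m :: nat
  define q where "q m = ennreal ((l2 * h) ^ m / fact m * exp (- (l2 * h)))" for m :: nat
  define a where "a m n = (jump J ^^ m) ((jump K ^^ n) f) y" for m n
  define d where "d = exp (- (l1 + l2) * h)"
  have d: "0 \<le> d" "d = exp (- (l1 * h)) * exp (- (l2 * h))"
    by (simp_all add: d_def exp_add[symmetric] algebra_simps)
  have "ennreal (d * (1 + c * h)) * f y = ennreal d * f y + ennreal (d * h) * (ennreal c * f y)"
  proof -
    have "ennreal (d * (1 + c * h)) = ennreal d + ennreal (d * h) * ennreal c"
      using nonneg d(1)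
      by (simp add: ennreal_plus[symmetric] ennreal_mult[symmetric] algebra_simps del: ennreal_plus)
    then show ?thesis by (simp add: distrib_right mult.assoc)
  qed
  also have "\<dots> = p 0 * q 0 * a 0 0 + p 1 * q 0 * a 1 0 + p 0 * q 1 * a 0 1"
    unfolding eq[symmetric] p_def q_def a_def d(2) using nonneg
    by (simp add: distrib_left ennreal_mult mult_ac)
  also have "\<dots> = (\<Sum>n<2. p 0 * q n * a 0 n) + (\<Sum>n<1. p 1 * q n * a 1 n)"
    by (simp add: numeral_2_eq_2 ac_simps)
  also have "\<dots> \<le> (\<Sum>n. p 0 * q n * a 0 n) + (\<Sum>n. p 1 * q n * a 1 n)"
    by (intro add_mono sum_le_suminf) auto
  also have "\<dots> = (\<Sum>m<2. \<Sum>n. p m * q n * a m n)"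
    by (simp add: numeral_2_eq_2)
  also have "\<dots> \<le> (\<Sum>m. \<Sum>n. p m * q n * a m n)"
    by (intro sum_le_suminf) auto
  finally show ?thesis
    unfolding jump_semigroup_def p_def q_def a_def d_def .
qed

section \<open>The law of the process at a fixed time\<close>

definition exp_jump :: "real \<Rightarrow> real \<Rightarrow> real measure" where
  "exp_jump \<alpha> \<sigma> = distr (density lborel (exponential_density \<alpha>)) borel (\<lambda>s. \<sigma> * s)"

lemma sets_exp_jump: "sets (exp_jump \<alpha> \<sigma>) = sets borel"
  by (simp add: exp_jump_def)

lemma prob_space_exp_jump: "0 < \<alpha> \<Longrightarrow> prob_space (exp_jump \<alpha> \<sigma>)"
  unfolding exp_jump_def
  by (intro prob_space.prob_space_distr prob_space_exponential_density) auto

lemma jump_exp_jump: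
  assumes [measurable]: "f \<in> borel_measurable borel"
  shows "jump (exp_jump \<alpha> \<sigma>) f y =
    (\<integral>\<^sup>+s. f (y + \<sigma> * s) \<partial>density lborel (exponential_density \<alpha>))"
  unfolding jump_def exp_jump_def by (subst nn_integral_distr) auto

context prob_space
begin

text \<open>The joint law is a product measure, so Tonelli applies. The value spaces are arbitrary
  because the Markov property uses identity maps into two sub-sigma-algebras.\<close>

lemma nn_integral_indep_var:
  assumes ind: "indep_var S X T Y" and [measurable]: "f \<in> borel_measurable (S \<Otimes>\<^sub>M T)"
  shows "(\<integral>\<^sup>+\<omega>. f (X \<omega>, Y \<omega>) \<partial>M) = (\<integral>\<^sup>+\<omega>. \<integral>\<^sup>+\<omega>'. f (X \<omega>, Y \<omega>') \<partial>M \<partial>M)"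
proof -
  have X[measurable]: "X \<in> M \<rightarrow>\<^sub>M S" and Y[measurable]: "Y \<in> M \<rightarrow>\<^sub>M T"
    using indep_var_rv1[OF ind] indep_var_rv2[OF ind] by auto
  interpret Y: prob_space "distr M T Y" by (rule prob_space_distr) fact
  have "(\<integral>\<^sup>+\<omega>. f (X \<omega>, Y \<omega>) \<partial>M) = (\<integral>\<^sup>+z. f z \<partial>distr M (S \<Otimes>\<^sub>M T) (\<lambda>\<omega>. (X \<omega>, Y \<omega>)))"
    by (subst nn_integral_distr) auto
  also have "distr M (S \<Otimes>\<^sub>M T) (\<lambda>\<omega>. (X \<omega>, Y \<omega>)) = distr M S X \<Otimes>\<^sub>M distr M T Y"
    using ind by (simp add: indep_var_distribution_eq)
  also have "(\<integral>\<^sup>+z. f z \<partial>(distr M S X \<Otimes>\<^sub>M distr M T Y)) =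
      (\<integral>\<^sup>+x. \<integral>\<^sup>+y. f (x, y) \<partial>distr M T Y \<partial>distr M S X)"
    by (intro Y.nn_integral_fst[symmetric]) simp
  also have "\<dots> = (\<integral>\<^sup>+\<omega>. \<integral>\<^sup>+y. f (X \<omega>, y) \<partial>distr M T Y \<partial>M)"
    by (subst nn_integral_distr) auto
  also have "\<dots> = (\<integral>\<^sup>+\<omega>. \<integral>\<^sup>+\<omega>'. f (X \<omega>, Y \<omega>') \<partial>M \<partial>M)"
  proof (rule nn_integral_cong)
    fix \<omega> assume "\<omega> \<in> space M"
    then have [measurable]: "X \<omega> \<in> space S" using X by (rule measurable_space[rotated])
    show "(\<integral>\<^sup>+y. f (X \<omega>, y) \<partial>distr M T Y) = (\<integral>\<^sup>+\<omega>'. f (X \<omega>, Y \<omega>') \<partial>M)"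
      by (subst nn_integral_distr) auto
  qed
  finally show ?thesis .
qed

lemma indep_var_commute:
  assumes "indep_var S X T Y"
  shows "indep_var T Y S X"
proof -
  have "prob (b \<inter> a) = prob b * prob a" if "prob (a \<inter> b) = prob a * prob b" for a b
    using that by (simp add: Int_commute)
  then show ?thesis
    using assms unfolding indep_var_eq indep_sets2_eq by blast
qed

lemma nn_integral_exponential:
  assumes Y: "distributed M lborel Y (exponential_density \<alpha>)"
    and [measurable]: "f \<in> borel_measurable borel"
  shows "(\<integral>\<^sup>+\<omega>. f (y + \<sigma> * Y \<omega>) \<partial>M) = jump (exp_jump \<alpha> \<sigma>) f y"
  using distributed_measurable[OF Y]
  by (simp add: jump_exp_jump distributed_distr_eq_density[OF Y, symmetric] nn_integral_distr)

text \<open>Integrating out the last jump, which is independent of the others, replaces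
  \<open>f\<close> by its jump transform; hence the induction ranges over all
  \<open>f\<close>.\<close>

lemma nn_integral_iid_sum:
  assumes \<alpha>: "0 < \<alpha>" and Y: "iid_exponential \<alpha> Y" and f: "f \<in> borel_measurable borel"
  shows "(\<integral>\<^sup>+\<omega>. f (y + \<sigma> * (\<Sum>i = 1..m. Y i \<omega>)) \<partial>M) = (jump (exp_jump \<alpha> \<sigma>) ^^ m) f y"
  using f
proof (induction m arbitrary: f)
  case 0
  then show ?case by (simp add: emeasure_space_1)
next
  case (Suc m)
  have dist: "distributed M lborel (Y (Suc m)) (exponential_density \<alpha>)"
    and indep: "indep_vars (\<lambda>_. borel) Y {1..}"
    using Y by (auto simp: iid_exponential_def)
  have "indep_var borel (Y (Suc m)) borel (\<lambda>\<omega>. \<Sum>i\<in>{1..m}. Y i \<omega>)"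
    by (intro indep_vars_sum indep_vars_subset[OF indep]) auto
  then have ind: "indep_var borel (\<lambda>\<omega>. \<Sum>i\<in>{1..m}. Y i \<omega>) borel (Y (Suc m))"
    by (rule indep_var_commute)
  note [measurable] = Suc.prems
  have "(\<integral>\<^sup>+\<omega>. f (y + \<sigma> * (\<Sum>i = 1..Suc m. Y i \<omega>)) \<partial>M) =
      (\<integral>\<^sup>+\<omega>. (\<lambda>(s, z). f (y + \<sigma> * s + \<sigma> * z)) (\<Sum>i\<in>{1..m}. Y i \<omega>, Y (Suc m) \<omega>) \<partial>M)"
    by (simp add: algebra_simps)
  also have "\<dots> = (\<integral>\<^sup>+\<omega>. jump (exp_jump \<alpha> \<sigma>) f (y + \<sigma> * (\<Sum>i\<in>{1..m}. Y i \<omega>)) \<partial>M)"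
    by (subst nn_integral_indep_var[OF ind]) (auto simp: nn_integral_exponential[OF dist])
  also have "\<dots> = (jump (exp_jump \<alpha> \<sigma>) ^^ m) (jump (exp_jump \<alpha> \<sigma>) f) y"
    by (intro Suc.IH borel_measurable_jump prob_space_exp_jump sets_exp_jump \<alpha> Suc.prems)
  finally show ?case by (simp add: funpow_swap1)
qed

lemma emeasure_poisson_process:
  assumes N: "poisson_process lam N" and lam: "0 < lam" and h: "0 < h"
  shows "emeasure M {\<omega> \<in> space M. N h \<omega> = m} =
    ennreal ((lam * h) ^ m / fact m * exp (- (lam * h)))"
proof -
  have [measurable]: "N t \<in> M \<rightarrow>\<^sub>M count_space UNIV" if "0 \<le> t" for t
    using N that by (auto simp: poisson_process_def)
  have AE0: "AE \<omega> in M. N 0 \<omega> = 0"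
    using N by (auto simp: poisson_process_def)
  have law: "distr M (count_space UNIV) (\<lambda>\<omega>. N h \<omega> - N 0 \<omega>) = measure_pmf (poisson_pmf (lam * (h - 0)))"
    using N h unfolding poisson_process_def by blast
  have [measurable]: "N h \<in> M \<rightarrow>\<^sub>M count_space UNIV" "N 0 \<in> M \<rightarrow>\<^sub>M count_space UNIV"
    using h by auto
  have "emeasure M {\<omega> \<in> space M. N h \<omega> = m} = emeasure M {\<omega> \<in> space M. N h \<omega> - N 0 \<omega> = m}"
    using AE0 by (intro emeasure_eq_AE) auto
  also have "\<dots> = emeasure (distr M (count_space UNIV) (\<lambda>\<omega>. N h \<omega> - N 0 \<omega>)) {m}"
    by (subst emeasure_distr) (auto intro!: arg_cong[where f="emeasure M"])
  also have "\<dots> = ennreal ((lam * h) ^ m / fact m * exp (- (lam * h)))"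
    unfolding law using lam h by (simp add: emeasure_pmf_single)
  finally show ?thesis .
qed

lemma borel_measurable_random_sum:
  fixes Y :: "nat \<Rightarrow> 'a \<Rightarrow> real"
  assumes [measurable]: "N \<in> M \<rightarrow>\<^sub>M count_space UNIV"
    and Y: "\<And>i. 1 \<le> i \<Longrightarrow> Y i \<in> borel_measurable M"
  shows "(\<lambda>\<omega>. \<Sum>i = 1..N \<omega>. Y i \<omega>) \<in> borel_measurable M"
proof (rule measurable_compose_countable'[where I=UNIV and g=N and f="\<lambda>n \<omega>. \<Sum>i = 1..n. Y i \<omega>"])
  show "(\<lambda>\<omega>. \<Sum>i = 1..n. Y i \<omega>) \<in> borel_measurable M" for n
    by (intro borel_measurable_sum Y) auto
qed auto

text \<open>The signs \<open>\<sigma>1\<close>, \<open>\<sigma>2\<close> cover both the process itself and the majorant of its paths in which all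
  jumps are counted positively.\<close>

lemma nn_integral_compound:
  assumes pos: "0 < lam1" "0 < lam2" "0 < \<alpha>1" "0 < \<alpha>2" "0 < h"
    and N1: "poisson_process lam1 N1" and N2: "poisson_process lam2 N2"
    and Y1: "iid_exponential \<alpha>1 Y1" and Y2: "iid_exponential \<alpha>2 Y2"
    and indep: "indep_drivers N1 N2 Y1 Y2"
    and f[measurable]: "f \<in> borel_measurable borel"
  shows "(\<integral>\<^sup>+\<omega>. f (y + \<sigma>1 * (\<Sum>i = 1..N1 h \<omega>. Y1 i \<omega>) + \<sigma>2 * (\<Sum>i = 1..N2 h \<omega>. Y2 i \<omega>)) \<partial>M) =
    jump_semigroup lam1 (exp_jump \<alpha>1 \<sigma>1) lam2 (exp_jump \<alpha>2 \<sigma>2) h f y"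
proof -
  have N[measurable]: "N1 h \<in> M \<rightarrow>\<^sub>M count_space UNIV" "N2 h \<in> M \<rightarrow>\<^sub>M count_space UNIV"
    using N1 N2 pos by (auto simp: poisson_process_def)
  have Y: "Y1 i \<in> borel_measurable M" "Y2 i \<in> borel_measurable M" if "1 \<le> i" for i
    using Y1 Y2 that by (auto simp: iid_exponential_def indep_vars_def)
  define S1 where "S1 n \<omega> = (\<Sum>i = 1..n. Y1 i \<omega>)" for n \<omega>
  define S2 where "S2 n \<omega> = (\<Sum>i = 1..n. Y2 i \<omega>)" for n \<omega>
  have S[measurable]: "S1 n \<in> borel_measurable M" "S2 n \<in> borel_measurable M" for n
    unfolding S1_def[abs_def] S2_def[abs_def] by (auto intro!: borel_measurable_sum Y)
  define p where "p m \<omega> = (indicator {m} (N1 h \<omega>) :: ennreal)" for m \<omega>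
  define q where "q m \<omega> = (indicator {m} (N2 h \<omega>) :: ennreal)" for m \<omega>
  have [measurable]: "p m \<in> borel_measurable M" "q m \<in> borel_measurable M" for m
    unfolding p_def[abs_def] q_def[abs_def]
    by (auto intro: measurable_compose[OF N(1)] measurable_compose[OF N(2)])
  define g where "g m n \<omega> = f (y + \<sigma>1 * S1 m \<omega> + \<sigma>2 * S2 n \<omega>)" for m n \<omega>
  have [measurable]: "g m n \<in> borel_measurable M" for m n
    unfolding g_def[abs_def] by measurable
  \<comment> \<open>Exactly one pair of indicators is nonzero at \<open>\<omega>\<close>, so random
    numbers of summands are traded for a series over deterministic ones.\<close>
  have split: "f (y + \<sigma>1 * S1 (N1 h \<omega>) \<omega> + \<sigma>2 * S2 (N2 h \<omega>) \<omega>) =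
      (\<Sum>m. \<Sum>n. p m \<omega> * q n \<omega> * g m n \<omega>)" for \<omega>
  proof -
    have "(\<Sum>n. p m \<omega> * q n \<omega> * g m n \<omega>) = p m \<omega> * g m (N2 h \<omega>) \<omega>" for m
      by (subst suminf_finite[of "{N2 h \<omega>}"]) (auto simp: q_def)
    then have "(\<Sum>m. \<Sum>n. p m \<omega> * q n \<omega> * g m n \<omega>) = g (N1 h \<omega>) (N2 h \<omega>) \<omega>"
      by (simp only:) (subst suminf_finite[of "{N1 h \<omega>}"], auto simp: p_def)
    then show ?thesis by (simp add: g_def)
  qed
  have factor: "(\<integral>\<^sup>+\<omega>. p m \<omega> * q n \<omega> * g m n \<omega> \<partial>M) =
      emeasure M {\<omega> \<in> space M. N1 h \<omega> = m} * emeasure M {\<omega> \<in> space M. N2 h \<omega> = n} *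
      (jump (exp_jump \<alpha>1 \<sigma>1) ^^ m) ((jump (exp_jump \<alpha>2 \<sigma>2) ^^ n) f) y" for m n
  proof -
    \<comment> \<open>Independence of four sigma-algebras is passed to four random variables. The
      counts are read as reals so that all four have one type and form a single family.\<close>
    define W where "W i = [\<lambda>\<omega>. real (N1 h \<omega>), \<lambda>\<omega>. real (N2 h \<omega>),
        S1 m, S2 n] ! i" for i
    have W_meas: "W i \<in> borel_measurable M" if "i < 4" for i
      using that by (auto simp: W_def less_Suc_eq numeral_eq_Suc)
    have genN: "(\<lambda>\<omega>. real (N h \<omega>)) -` A \<inter> space M \<in> generated_events {0..} (count_space UNIV) N"
      for N :: "real \<Rightarrow> 'a \<Rightarrow> nat" and A
      unfolding generated_events_def using pos
      by (intro sigma_sets.Basic CollectI exI[of _ h] exI[of _ "real -` A"]) auto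
    have genY: "(\<lambda>\<omega>. \<Sum>i = 1..k. Z i \<omega>) -` A \<inter> space M \<in> generated_events {1..} borel Z"
      if A: "A \<in> sets borel" for Z :: "nat \<Rightarrow> 'a \<Rightarrow> real" and A k
    proof -
      define G where "G = sigma (space M) {Z t -` A \<inter> space M |t A. t \<in> {1..} \<and> A \<in> sets borel}"
      have G: "space G = space M" "sets G = generated_events {1..} borel Z"
        unfolding G_def generated_events_def
        by (simp add: space_measure_of_conv) (rule sets_measure_of, auto)
      have "Z i \<in> borel_measurable G" if "1 \<le> i" for i
      proof (rule measurableI)
        fix A :: "real set" assume "A \<in> sets borel"
        then show "Z i -` A \<inter> space G \<in> sets G"
          unfolding G generated_events_def using that by (intro sigma_sets.Basic) auto
      qed simp
      then have "(\<lambda>\<omega>. \<Sum>i = 1..k. Z i \<omega>) \<in> borel_measurable G"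
        by (intro borel_measurable_sum) auto
      from measurable_sets[OF this A] show ?thesis by (simp add: G)
    qed
    have genS: "S1 k -` A \<inter> space M \<in> generated_events {1..} borel Y1"
      "S2 k -` A \<inter> space M \<in> generated_events {1..} borel Y2" if "A \<in> sets borel" for A k
      using genY[OF that, of Y1 k] genY[OF that, of Y2 k]
      unfolding S1_def[abs_def] S2_def[abs_def] .
    have W: "indep_vars (\<lambda>_. borel) W {..<4::nat}"
      unfolding indep_vars_def2
    proof (intro conjI ballI)
      show "indep_sets (\<lambda>i. {W i -` A \<inter> space M |A. A \<in> sets borel}) {..<4}"
      proof (rule indep_sets_mono_sets[OF indep[unfolded indep_drivers_def]])
        fix i :: nat assume "i \<in> {..<4}"
        then have "i = 0 \<or> i = 1 \<or> i = 2 \<or> i = 3" by auto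
        then show "{W i -` A \<inter> space M |A. A \<in> sets borel} \<subseteq>
            [generated_events {0..} (count_space UNIV) N1, generated_events {0..} (count_space UNIV) N2,
             generated_events {1..} borel Y1, generated_events {1..} borel Y2] ! i"
          using genN genS
          by (elim disjE) (auto simp: W_def numeral_3_eq_3 numeral_2_eq_2)
      qed
    qed (use W_meas in auto)
    have g4: "W 0 = (\<lambda>\<omega>. real (N1 h \<omega>))" "W (Suc 0) = (\<lambda>\<omega>. real (N2 h \<omega>))"
      "W 2 = S1 m" "W 3 = S2 n"
      by (simp_all add: W_def numeral_3_eq_3 numeral_2_eq_2)
    have W2: "indep_var borel (W i) borel (W j)" if "i \<noteq> j" "i < 4" "j < 4" for i j
    proof -
      have "indep_var borel ((\<lambda>x. x i) \<circ> (\<lambda>\<omega>. \<lambda>k\<in>{i}. W k \<omega>))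
          borel ((\<lambda>x. x j) \<circ> (\<lambda>\<omega>. \<lambda>k\<in>{j}. W k \<omega>))"
        using that by (intro indep_var_compose[OF indep_var_restrict[OF W]]) auto
      then show ?thesis by (simp add: comp_def)
    qed
    have W01: "indep_var borel (W 0) borel (W 1)" and W23: "indep_var borel (W 2) borel (W 3)"
      by (rule W2; simp)+
    \<comment> \<open>The integral factors first into counts against jump sums, then each factor
      splits once more.\<close>
    have "indep_var (PiM {0, 1} (\<lambda>_. borel)) (\<lambda>\<omega>. \<lambda>i\<in>{0, 1}. W i \<omega>)
        (PiM {2, 3} (\<lambda>_. borel)) (\<lambda>\<omega>. \<lambda>i\<in>{2, 3}. W i \<omega>)"
      by (rule indep_var_restrict[OF W]) auto
    then have "indep_var (borel \<Otimes>\<^sub>M borel) ((\<lambda>x. (x 0, x 1)) \<circ> (\<lambda>\<omega>. \<lambda>i\<in>{0, 1}. W i \<omega>))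
        (borel \<Otimes>\<^sub>M borel) ((\<lambda>x. (x 2, x 3)) \<circ> (\<lambda>\<omega>. \<lambda>i\<in>{2, 3}. W i \<omega>))"
      by (rule indep_var_compose) auto
    then have pairs: "indep_var (borel \<Otimes>\<^sub>M borel) (\<lambda>\<omega>. (W 0 \<omega>, W 1 \<omega>)) (borel \<Otimes>\<^sub>M borel) (\<lambda>\<omega>. (W 2 \<omega>, W 3 \<omega>))"
      by (simp add: comp_def)
    have "(\<integral>\<^sup>+\<omega>. p m \<omega> * q n \<omega> * g m n \<omega> \<partial>M) =
        (\<integral>\<^sup>+\<omega>. (\<lambda>z. indicator {real m} (fst (fst z)) * indicator {real n} (snd (fst z)) *
            f (y + \<sigma>1 * fst (snd z) + \<sigma>2 * snd (snd z)))
          ((W 0 \<omega>, W 1 \<omega>), (W 2 \<omega>, W 3 \<omega>)) \<partial>M)"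
      by (intro nn_integral_cong) (auto simp: p_def q_def g_def g4 indicator_def)
    also have "\<dots> = (\<integral>\<^sup>+\<omega>. \<integral>\<^sup>+\<omega>'. p m \<omega> * q n \<omega> * g m n \<omega>' \<partial>M \<partial>M)"
      by (rule nn_integral_indep_var[OF pairs, THEN trans], measurable)
         (auto simp: p_def q_def g_def g4 indicator_def intro!: nn_integral_cong)
    also have "\<dots> = (\<integral>\<^sup>+\<omega>. p m \<omega> * q n \<omega> \<partial>M) * (\<integral>\<^sup>+\<omega>. g m n \<omega> \<partial>M)"
      by (simp add: nn_integral_cmult nn_integral_multc)
    also have "(\<integral>\<^sup>+\<omega>. p m \<omega> * q n \<omega> \<partial>M) =
        (\<integral>\<^sup>+\<omega>. (\<lambda>z. indicator {real m} (fst z) * indicator {real n} (snd z)) (W 0 \<omega>, W 1 \<omega>) \<partial>M)"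
      by (intro nn_integral_cong) (auto simp: p_def q_def g4 indicator_def)
    also have "\<dots> = (\<integral>\<^sup>+\<omega>. \<integral>\<^sup>+\<omega>'. p m \<omega> * q n \<omega>' \<partial>M \<partial>M)"
      by (rule nn_integral_indep_var[OF W01, THEN trans], measurable)
         (auto simp: p_def q_def g4 indicator_def intro!: nn_integral_cong)
    also have "\<dots> = (\<integral>\<^sup>+\<omega>. p m \<omega> \<partial>M) * (\<integral>\<^sup>+\<omega>. q n \<omega> \<partial>M)"
      by (simp add: nn_integral_cmult nn_integral_multc)
    also have "(\<integral>\<^sup>+\<omega>. p m \<omega> \<partial>M) = (\<integral>\<^sup>+\<omega>. indicator {\<omega> \<in> space M. N1 h \<omega> = m} \<omega> \<partial>M)"
      by (intro nn_integral_cong) (auto simp: p_def indicator_def)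
    also have "\<dots> = emeasure M {\<omega> \<in> space M. N1 h \<omega> = m}"
      by (intro nn_integral_indicator) measurable
    also have "(\<integral>\<^sup>+\<omega>. q n \<omega> \<partial>M) = (\<integral>\<^sup>+\<omega>. indicator {\<omega> \<in> space M. N2 h \<omega> = n} \<omega> \<partial>M)"
      by (intro nn_integral_cong) (auto simp: q_def indicator_def)
    also have "\<dots> = emeasure M {\<omega> \<in> space M. N2 h \<omega> = n}"
      by (intro nn_integral_indicator) measurable
    also have "(\<integral>\<^sup>+\<omega>. g m n \<omega> \<partial>M) =
        (\<integral>\<^sup>+\<omega>. (\<lambda>(s, t). f (y + \<sigma>1 * s + \<sigma>2 * t)) (W 2 \<omega>, W 3 \<omega>) \<partial>M)"
      by (simp add: g_def g4)
    also have "\<dots> = (\<integral>\<^sup>+\<omega>. \<integral>\<^sup>+\<omega>'. f (y + \<sigma>1 * S1 m \<omega> + \<sigma>2 * S2 n \<omega>') \<partial>M \<partial>M)"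
      by (subst nn_integral_indep_var[OF W23]) (auto simp: g4)
    also have "\<dots> = (jump (exp_jump \<alpha>1 \<sigma>1) ^^ m) ((jump (exp_jump \<alpha>2 \<sigma>2) ^^ n) f) y"
      unfolding S1_def S2_def using pos f
      by (simp only: nn_integral_iid_sum[OF _ Y1] nn_integral_iid_sum[OF _ Y2] borel_measurable_jump_pow
        prob_space_exp_jump sets_exp_jump)
    finally show ?thesis .
  qed
  show ?thesis
    unfolding S1_def[symmetric] S2_def[symmetric] split jump_semigroup_def
    using emeasure_poisson_process[OF N1] emeasure_poisson_process[OF N2] pos
    by (simp add: nn_integral_suminf factor)
qed

end

section \<open>Optional stopping on a grid\<close>

text \<open>Preimages change only by null sets, which completeness makes measurable. It serves the
  stopped payoff, since paths are cadlag only almost surely.\<close>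

lemma (in complete_measure) borel_measurable_AE_eq:
  assumes g: "g \<in> M \<rightarrow>\<^sub>M N" and eq: "AE \<omega> in M. f \<omega> = g \<omega>" and f: "f \<in> space M \<rightarrow> space N"
  shows "f \<in> M \<rightarrow>\<^sub>M N"
proof (rule measurableI)
  fix A assume A: "A \<in> sets N"
  have "AE \<omega> in M. \<omega> \<in> g -` A \<inter> space M \<longleftrightarrow> \<omega> \<in> f -` A \<inter> space M"
    using eq by eventually_elim auto
  then show "f -` A \<inter> space M \<in> sets M"
    by (rule in_sets_AE) (use g A in auto)
qed (use f in auto)

lemma suminf_disjointed:
  fixes g :: "nat \<Rightarrow> ennreal"
  assumes "\<omega> \<in> disjointed B k"
  shows "(\<Sum>j. g j * indicator (disjointed B j) \<omega>) = g k"
proof -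
  have "g j * indicator (disjointed B j) \<omega> = 0" if "j \<noteq> k" for j
    using that assms disjoint_family_disjointed[of B]
    by (auto simp: disjoint_family_on_def indicator_def)
  then show ?thesis using assms
    by (subst suminf_finite[of "{k}"]) auto
qed

context stochastic_basis
begin

lemma F_measurable: "f \<in> F t \<rightarrow>\<^sub>M N \<Longrightarrow> f \<in> P \<rightarrow>\<^sub>M N"
  using F_subalgebra by (rule measurable_from_subalg)

lemma F_sets: "A \<in> sets (F t) \<Longrightarrow> A \<in> sets P"
  using F_subalgebra[of t] by (auto simp: subalgebra_def)

lemma levy_adapted: "levy_process X \<Longrightarrow> 0 \<le> t \<Longrightarrow> X t \<in> borel_measurable (F (ennreal t))"
  by (simp add: levy_process_def)

lemma levy_measurable: "levy_process X \<Longrightarrow> 0 \<le> t \<Longrightarrow> X t \<in> borel_measurable P"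
  by (rule F_measurable[OF levy_adapted])

text \<open>The increment after \<open>s\<close> is independent of the past and distributed as
  \<open>X h - X 0\<close>, so it is integrated out with \<open>X s\<close> and \<open>A\<close>
  held fixed. Testing against all past events \<open>A\<close> takes the place of conditional
  expectations.\<close>

lemma levy_markov:
  assumes X: "levy_process X" and s: "0 \<le> s" and h: "0 \<le> h" and A: "A \<in> sets (F (ennreal s))"
    and f[measurable]: "f \<in> borel_measurable borel"
  shows "(\<integral>\<^sup>+\<omega>. f (X (s + h) \<omega>) * indicator A \<omega> \<partial>P) =
    (\<integral>\<^sup>+\<omega>. (\<integral>\<^sup>+\<omega>'. f (X s \<omega> + (X h \<omega>' - X 0 \<omega>')) \<partial>P) * indicator A \<omega> \<partial>P)"
proof -
  have Xm[measurable]: "X s \<in> borel_measurable P" "X (s + h) \<in> borel_measurable P"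
    "X h \<in> borel_measurable P" "X 0 \<in> borel_measurable P"
    using X s h by (auto intro!: levy_measurable)
  have XF: "X s \<in> borel_measurable (F (ennreal s))" by (rule levy_adapted[OF X s])
  have AP[measurable]: "A \<in> sets P" by (rule F_sets[OF A])
  define D where "D \<omega> = X (s + h) \<omega> - X s \<omega>" for \<omega>
  have D[measurable]: "D \<in> borel_measurable P" unfolding D_def[abs_def] by measurable
  define G where "G = vimage_algebra (space P) D borel"
  have G: "sets G \<subseteq> sets P" "space G = space P" and DG: "D \<in> borel_measurable G"
    unfolding G_def using measurable_sets[OF D]
    by (auto simp: sets_vimage_algebra2 intro!: measurable_vimage_algebra1)
  have measurable_G: "(\<lambda>\<omega>. \<omega>) \<in> P \<rightarrow>\<^sub>M G"
    using G by (intro measurableI) (auto simp: subset_eq dest: sets.sets_into_space)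
  have sets_id: "sigma_sets (space P) {(\<lambda>\<omega>. \<omega>) -` A \<inter> space P |A. A \<in> sets H} = sets H"
    if "space H = space P" for H :: "'a measure"
  proof -
    have "{(\<lambda>\<omega>. \<omega>) -` A \<inter> space P |A. A \<in> sets H} = (\<lambda>A. (\<lambda>\<omega>. \<omega>) -` A \<inter> space P) ` sets H"
      by auto
    also have "\<dots> = (\<lambda>A. A) ` sets H"
      using sets.sets_into_space[of _ H] that by (intro image_cong) auto
    finally have "{(\<lambda>\<omega>. \<omega>) -` A \<inter> space P |A. A \<in> sets H} = sets H" by simp
    then show ?thesis using sets.sigma_sets_eq[of H] that by simp
  qed
  have "indep_set (sets (F (ennreal s))) (sets G)"
  proof -
    have "s \<le> s + h" using h by simp
    with X s show ?thesis unfolding levy_process_def G_def D_def[abs_def] by blast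
  qed
  \<comment> \<open>Independence of sigma-algebras is recast as independence of the identity maps
    into them, so that \<open>X s\<close> and \<open>A\<close> together are functions of the first
    coordinate.\<close>
  then have ind: "indep_var (F (ennreal s)) (\<lambda>\<omega>. \<omega>) G (\<lambda>\<omega>. \<omega>)"
    unfolding indep_var_eq sets_id[OF space_F] sets_id[OF G(2)]
    by (intro conjI F_measurable[OF measurable_ident_sets[OF refl]] measurable_G)
  have law: "distr P borel D = distr P borel (\<lambda>\<omega>. X h \<omega> - X 0 \<omega>)"
  proof -
    have "s \<le> s + h" using h by simp
    with X s have "distr P borel (\<lambda>\<omega>. X (s + h) \<omega> - X s \<omega>) =
        distr P borel (\<lambda>\<omega>. X (s + h - s) \<omega> - X 0 \<omega>)"
      unfolding levy_process_def by blast
    then show ?thesis by (simp add: D_def[abs_def])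
  qed
  have meas: "(\<lambda>z. f (X s (fst z) + D (snd z)) * indicator A (fst z)) \<in>
      borel_measurable (F (ennreal s) \<Otimes>\<^sub>M G)"
    by (intro borel_measurable_times_ennreal measurable_compose[OF _ f] borel_measurable_add
      measurable_compose[OF measurable_fst XF] measurable_compose[OF measurable_snd DG]
      measurable_compose[OF measurable_fst borel_measurable_indicator[OF A]])
  have "(\<integral>\<^sup>+\<omega>. f (X (s + h) \<omega>) * indicator A \<omega> \<partial>P) =
      (\<integral>\<^sup>+\<omega>. (\<lambda>z. f (X s (fst z) + D (snd z)) * indicator A (fst z)) (\<omega>, \<omega>) \<partial>P)"
    by (simp add: D_def)
  also have "\<dots> = (\<integral>\<^sup>+\<omega>. \<integral>\<^sup>+\<omega>'. f (X s \<omega> + D \<omega>') * indicator A \<omega> \<partial>P \<partial>P)"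
    using nn_integral_indep_var[OF ind meas] by simp
  also have "\<dots> = (\<integral>\<^sup>+\<omega>. (\<integral>\<^sup>+\<omega>'. f (X s \<omega> + D \<omega>') \<partial>P) * indicator A \<omega> \<partial>P)"
    by (intro nn_integral_cong nn_integral_multc) measurable
  also have "(\<lambda>\<omega>. \<integral>\<^sup>+\<omega>'. f (X s \<omega> + D \<omega>') \<partial>P) =
      (\<lambda>\<omega>. \<integral>\<^sup>+\<omega>'. f (X s \<omega> + (X h \<omega>' - X 0 \<omega>')) \<partial>P)"
  proof
    fix \<omega>
    have "(\<integral>\<^sup>+\<omega>'. f (X s \<omega> + D \<omega>') \<partial>P) = (\<integral>\<^sup>+z. f (X s \<omega> + z) \<partial>distr P borel D)"
      by (subst nn_integral_distr) auto
    also have "\<dots> = (\<integral>\<^sup>+\<omega>'. f (X s \<omega> + (X h \<omega>' - X 0 \<omega>')) \<partial>P)"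
      unfolding law by (subst nn_integral_distr) auto
    finally show "(\<integral>\<^sup>+\<omega>'. f (X s \<omega> + D \<omega>') \<partial>P) =
        (\<integral>\<^sup>+\<omega>'. f (X s \<omega> + (X h \<omega>' - X 0 \<omega>')) \<partial>P)" .
  qed
  finally show ?thesis .
qed

text \<open>On the grid of mesh \<open>h\<close>, stopping takes place at the first index \<open>k\<close> with \<open>\<omega> \<in> B k\<close>.\<close>

definition grid_value ::
    "(real \<Rightarrow> 'a \<Rightarrow> real) \<Rightarrow> (real \<Rightarrow> ennreal) \<Rightarrow> real \<Rightarrow> real \<Rightarrow> nat \<Rightarrow> 'a \<Rightarrow> ennreal" where
  "grid_value X f r h k \<omega> = ennreal (exp (- r * (real k * h))) * f (X (real k * h) \<omega>)"

definition running :: "(nat \<Rightarrow> 'a set) \<Rightarrow> nat \<Rightarrow> 'a set" where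
  "running B k = space P - (\<Union>j<k. B j)"

context
  fixes X :: "real \<Rightarrow> 'a \<Rightarrow> real" and f :: "real \<Rightarrow> ennreal" and r h :: real
    and B :: "nat \<Rightarrow> 'a set"
  assumes X: "levy_process X" and f[measurable]: "f \<in> borel_measurable borel"
    and r: "0 \<le> r" and h: "0 \<le> h" and B: "\<And>k. B k \<in> sets (F (ennreal (real k * h)))"
begin

lemma borel_measurable_grid_value[measurable]: "grid_value X f r h k \<in> borel_measurable P"
proof -
  have [measurable]: "X (real k * h) \<in> borel_measurable P"
    using h by (intro levy_measurable X) auto
  show ?thesis unfolding grid_value_def[abs_def] by measurable
qed

lemma B_sets_F: "j \<le> k \<Longrightarrow> B j \<in> sets (F (ennreal (real k * h)))"
  using B[of j] sets_F_mono[of "ennreal (real j * h)" "ennreal (real k * h)"] h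
  by (auto simp: ennreal_leI mult_right_mono)

lemma disjointed_sets[measurable]: "disjointed B k \<in> sets P"
  unfolding disjointed_def using B F_sets by (intro sets.Diff sets.finite_UN) auto

text \<open>Whether any index up to \<open>k\<close> has stopped is decided at time
  \<open>k * h\<close>, not one step later; this shift permits the Markov property from
  \<open>k\<close> to \<open>Suc k\<close>.\<close>

lemma running_Suc_F: "running B (Suc k) \<in> sets (F (ennreal (real k * h)))"
  unfolding running_def using B_sets_F sets.top[of "F (ennreal (real k * h))"]
  by (intro sets.Diff sets.finite_UN) (auto simp: space_F)

lemma running_sets[measurable]: "running B k \<in> sets P"
  unfolding running_def using B F_sets by (intro sets.Diff sets.finite_UN) auto

lemma grid_value_running:
  "(\<integral>\<^sup>+\<omega>. grid_value X f r h k \<omega> * indicator (running B k) \<omega> \<partial>P) =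
   (\<integral>\<^sup>+\<omega>. grid_value X f r h k \<omega> * indicator (disjointed B k) \<omega> \<partial>P) +
   (\<integral>\<^sup>+\<omega>. grid_value X f r h k \<omega> * indicator (running B (Suc k)) \<omega> \<partial>P)"
proof -
  have "running B k = disjointed B k \<union> running B (Suc k)" "disjointed B k \<inter> running B (Suc k) = {}"
    using sets.sets_into_space[OF F_sets[OF B]]
    by (auto simp: running_def disjointed_def less_Suc_eq subset_eq)
  then show ?thesis
    by (subst nn_integral_add[symmetric])
       (auto intro!: nn_integral_cong simp: indicator_def)
qed

lemma grid_value_Suc:
  "(\<integral>\<^sup>+\<omega>. grid_value X f r h (Suc k) \<omega> * indicator (running B (Suc k)) \<omega> \<partial>P) =
   (\<integral>\<^sup>+\<omega>. ennreal (exp (- r * (real k * h))) * (ennreal (exp (- r * h)) *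
      (\<integral>\<^sup>+\<omega>'. f (X (real k * h) \<omega> + (X h \<omega>' - X 0 \<omega>')) \<partial>P)) * indicator (running B (Suc k)) \<omega> \<partial>P)"
proof -
  have kh: "0 \<le> real k * h" "real (Suc k) * h = real k * h + h" using h by (auto simp: algebra_simps)
  have [measurable]: "X (real (Suc k) * h) \<in> borel_measurable P" "X (real k * h) \<in> borel_measurable P"
    "X h \<in> borel_measurable P" "X 0 \<in> borel_measurable P"
    using h by (auto intro!: levy_measurable X)
  have "exp (- r * (real (Suc k) * h)) = exp (- r * (real k * h)) * exp (- r * h)"
    by (simp add: exp_add[symmetric] algebra_simps)
  then have "(\<integral>\<^sup>+\<omega>. grid_value X f r h (Suc k) \<omega> * indicator (running B (Suc k)) \<omega> \<partial>P) =
      (\<integral>\<^sup>+\<omega>. ennreal (exp (- r * (real k * h)) * exp (- r * h)) *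
        (f (X (real (Suc k) * h) \<omega>) * indicator (running B (Suc k)) \<omega>) \<partial>P)"
    unfolding grid_value_def by (simp only: mult.assoc)
  also have "\<dots> = ennreal (exp (- r * (real k * h)) * exp (- r * h)) *
      (\<integral>\<^sup>+\<omega>. f (X (real (Suc k) * h) \<omega>) * indicator (running B (Suc k)) \<omega> \<partial>P)"
    by (intro nn_integral_cmult) measurable
  also have "(\<integral>\<^sup>+\<omega>. f (X (real (Suc k) * h) \<omega>) * indicator (running B (Suc k)) \<omega> \<partial>P) =
      (\<integral>\<^sup>+\<omega>. (\<integral>\<^sup>+\<omega>'. f (X (real k * h) \<omega> + (X h \<omega>' - X 0 \<omega>')) \<partial>P) * indicator (running B (Suc k)) \<omega> \<partial>P)"
    unfolding kh(2) by (rule levy_markov[OF X kh(1) h running_Suc_F f])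
  also have "ennreal (exp (- r * (real k * h)) * exp (- r * h)) * \<dots> =
      (\<integral>\<^sup>+\<omega>. ennreal (exp (- r * (real k * h)) * exp (- r * h)) *
      ((\<integral>\<^sup>+\<omega>'. f (X (real k * h) \<omega> + (X h \<omega>' - X 0 \<omega>')) \<partial>P) * indicator (running B (Suc k)) \<omega>) \<partial>P)"
    by (intro nn_integral_cmult[symmetric]) measurable
  finally show ?thesis by (simp add: ennreal_mult mult.assoc)
qed

text \<open>The left side is the mean value at the smaller of the stopping index and
  \<open>k\<close>, split by index. Passing to \<open>Suc k\<close> changes only the part still
  running, which \<open>step\<close> makes no larger.\<close>

lemma grid_supermartingale:
  assumes step: "\<And>y. ennreal (exp (- r * h)) * (\<integral>\<^sup>+\<omega>'. f (y + (X h \<omega>' - X 0 \<omega>')) \<partial>P) \<le> f y"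
  shows "(\<Sum>j\<le>k. \<integral>\<^sup>+\<omega>. grid_value X f r h j \<omega> * indicator (disjointed B j) \<omega> \<partial>P) +
    (\<integral>\<^sup>+\<omega>. grid_value X f r h k \<omega> * indicator (running B (Suc k)) \<omega> \<partial>P) \<le> (\<integral>\<^sup>+\<omega>. f (X 0 \<omega>) \<partial>P)"
proof (induction k)
  case 0
  show ?case
    using grid_value_running[of 0, symmetric] by (simp add: grid_value_def running_def)
next
  case (Suc k)
  have "(\<integral>\<^sup>+\<omega>. grid_value X f r h (Suc k) \<omega> * indicator (running B (Suc k)) \<omega> \<partial>P) \<le>
      (\<integral>\<^sup>+\<omega>. grid_value X f r h k \<omega> * indicator (running B (Suc k)) \<omega> \<partial>P)"
    unfolding grid_value_Suc unfolding grid_value_def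
    by (intro nn_integral_mono mult_right_mono mult_left_mono step) auto
  then show ?case
    using Suc.IH unfolding grid_value_running[of "Suc k"]
    by (simp add: add.assoc) (meson add_left_mono order_trans)
qed

text \<open>Optional stopping with a loss \<open>q\<close> per step. The one-step bound is asked
  only off \<open>B k\<close>, that is, where stopping does not occur at \<open>k\<close>.\<close>

lemma grid_submartingale:
  assumes q: "0 \<le> q" "q \<le> 1"
    and step: "\<And>k \<omega>. \<omega> \<in> space P - B k \<Longrightarrow> ennreal q * f (X (real k * h) \<omega>) \<le>
      ennreal (exp (- r * h)) * (\<integral>\<^sup>+\<omega>'. f (X (real k * h) \<omega> + (X h \<omega>' - X 0 \<omega>')) \<partial>P)"
  shows "ennreal (q ^ k) * (\<integral>\<^sup>+\<omega>. f (X 0 \<omega>) \<partial>P) \<le>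
    (\<Sum>j\<le>k. \<integral>\<^sup>+\<omega>. grid_value X f r h j \<omega> * indicator (disjointed B j) \<omega> \<partial>P) +
    (\<integral>\<^sup>+\<omega>. grid_value X f r h k \<omega> * indicator (running B (Suc k)) \<omega> \<partial>P)"
proof (induction k)
  case 0
  show ?case
    using grid_value_running[of 0] by (simp add: grid_value_def running_def)
next
  case (Suc k)
  let ?T = "\<Sum>j\<le>k. \<integral>\<^sup>+\<omega>. grid_value X f r h j \<omega> * indicator (disjointed B j) \<omega> \<partial>P"
  let ?S = "\<integral>\<^sup>+\<omega>. grid_value X f r h k \<omega> * indicator (running B (Suc k)) \<omega> \<partial>P"
  have "ennreal q * ?S = (\<integral>\<^sup>+\<omega>. ennreal q * (grid_value X f r h k \<omega> * indicator (running B (Suc k)) \<omega>) \<partial>P)"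
    by (intro nn_integral_cmult[symmetric]) measurable
  also have "\<dots> = (\<integral>\<^sup>+\<omega>. ennreal (exp (- r * (real k * h))) * (ennreal q * f (X (real k * h) \<omega>)) *
      indicator (running B (Suc k)) \<omega> \<partial>P)"
    unfolding grid_value_def by (simp only: mult_ac)
  also have "\<dots> \<le> (\<integral>\<^sup>+\<omega>. grid_value X f r h (Suc k) \<omega> * indicator (running B (Suc k)) \<omega> \<partial>P)"
    unfolding grid_value_Suc
  proof (rule nn_integral_mono)
    fix \<omega>
    show "ennreal (exp (- r * (real k * h))) * (ennreal q * f (X (real k * h) \<omega>)) *
        indicator (running B (Suc k)) \<omega> \<le> ennreal (exp (- r * (real k * h))) * (ennreal (exp (- r * h)) *
      (\<integral>\<^sup>+\<omega>'. f (X (real k * h) \<omega> + (X h \<omega>' - X 0 \<omega>')) \<partial>P)) * indicator (running B (Suc k)) \<omega>"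
    proof (cases "\<omega> \<in> running B (Suc k)")
      case True
      then have "\<omega> \<in> space P - B k" by (auto simp: running_def)
      from step[OF this] show ?thesis
        by (intro mult_right_mono mult_left_mono) auto
    qed simp
  qed
  finally have S: "ennreal q * ?S \<le> (\<integral>\<^sup>+\<omega>. grid_value X f r h (Suc k) \<omega> * indicator (running B (Suc k)) \<omega> \<partial>P)" .
  have "ennreal (q ^ Suc k) * (\<integral>\<^sup>+\<omega>. f (X 0 \<omega>) \<partial>P) =
      ennreal q * (ennreal (q ^ k) * (\<integral>\<^sup>+\<omega>. f (X 0 \<omega>) \<partial>P))"
    using q by (simp add: ennreal_mult mult.assoc)
  also have "\<dots> \<le> ennreal q * (?T + ?S)"
    by (intro mult_left_mono Suc.IH) simp
  \<comment> \<open>The part already stopped suffers no further loss: its factor is dropped because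
    \<open>q \<le> 1\<close>.\<close>
  also have "\<dots> \<le> ?T + ennreal q * ?S"
    unfolding distrib_left using q mult_right_mono[of "ennreal q" 1 ?T]
    by (intro add_right_mono) simp
  also have "\<dots> \<le> ?T + (\<integral>\<^sup>+\<omega>. grid_value X f r h (Suc k) \<omega> * indicator (running B (Suc k)) \<omega> \<partial>P)"
    by (intro add_left_mono S)
  also have "\<dots> = (\<Sum>j\<le>Suc k. \<integral>\<^sup>+\<omega>. grid_value X f r h j \<omega> * indicator (disjointed B j) \<omega> \<partial>P) +
    (\<integral>\<^sup>+\<omega>. grid_value X f r h (Suc k) \<omega> * indicator (running B (Suc (Suc k))) \<omega> \<partial>P)"
    unfolding grid_value_running[of "Suc k"] by (simp add: add.assoc)
  finally show ?case .
qed

lemma grid_supermartingale_suminf: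
  assumes step: "\<And>y. ennreal (exp (- r * h)) * (\<integral>\<^sup>+\<omega>'. f (y + (X h \<omega>' - X 0 \<omega>')) \<partial>P) \<le> f y"
  shows "(\<integral>\<^sup>+\<omega>. (\<Sum>j. grid_value X f r h j \<omega> * indicator (disjointed B j) \<omega>) \<partial>P) \<le> (\<integral>\<^sup>+\<omega>. f (X 0 \<omega>) \<partial>P)"
proof (subst nn_integral_suminf)
  show "(\<Sum>j. \<integral>\<^sup>+\<omega>. grid_value X f r h j \<omega> * indicator (disjointed B j) \<omega> \<partial>P) \<le> (\<integral>\<^sup>+\<omega>. f (X 0 \<omega>) \<partial>P)"
  proof (rule suminf_le_const)
    fix n
    have "(\<Sum>j<n. \<integral>\<^sup>+\<omega>. grid_value X f r h j \<omega> * indicator (disjointed B j) \<omega> \<partial>P) \<le>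
        (\<Sum>j\<le>n. \<integral>\<^sup>+\<omega>. grid_value X f r h j \<omega> * indicator (disjointed B j) \<omega> \<partial>P)"
      by (intro sum_mono2) auto
    also have "\<dots> \<le> (\<integral>\<^sup>+\<omega>. f (X 0 \<omega>) \<partial>P)"
      using grid_supermartingale[OF step, of n] by (rule order_trans[rotated]) simp
    finally show "(\<Sum>j<n. \<integral>\<^sup>+\<omega>. grid_value X f r h j \<omega> * indicator (disjointed B j) \<omega> \<partial>P) \<le>
      (\<integral>\<^sup>+\<omega>. f (X 0 \<omega>) \<partial>P)" .
  qed simp
qed measurable

end

end

section \<open>Stopping times in continuous time\<close>

lemma first_grid_index:
  fixes t h :: real
  assumes "0 \<le> t" "0 < h"
  shows "\<exists>k. t \<le> real k * h \<and> real k * h \<le> t + h \<and> (\<forall>j<k. real j * h < t)"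
proof (intro exI conjI allI impI)
  let ?k = "nat \<lceil>t / h\<rceil>"
  have k: "t / h \<le> real ?k" "real ?k \<le> t / h + 1" using assms by (auto simp: of_nat_ceiling)
  show "t \<le> real ?k * h" "real ?k * h \<le> t + h"
    using mult_right_mono[OF k(1), of h] mult_right_mono[OF k(2), of h] assms
    by (simp_all add: distrib_right)
  fix j assume "j < ?k"
  then have "real j < t / h" by (simp add: zless_nat_eq_int_zless less_ceiling_iff)
  then show "real j * h < t" using assms by (simp add: field_simps)
qed

lemma sum_disjointed:
  fixes g :: "nat \<Rightarrow> ennreal"
  assumes "\<omega> \<in> disjointed B k" "k \<le> N"
  shows "(\<Sum>j\<le>N. g j * indicator (disjointed B j) \<omega>) = g k"
proof -
  have "g j * indicator (disjointed B j) \<omega> = 0" if "j \<noteq> k" for j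
    using that assms disjoint_family_disjointed[of B]
    by (auto simp: disjoint_family_on_def indicator_def)
  then have "(\<Sum>j\<le>N. g j * indicator (disjointed B j) \<omega>) =
      (\<Sum>j\<in>{k}. g j * indicator (disjointed B j) \<omega>)"
    using assms by (intro sum.mono_neutral_right) auto
  then show ?thesis using assms by simp
qed

lemma exit_time_eq_top: "(\<And>s. 0 \<le> s \<Longrightarrow> X s \<omega> \<in> A) \<Longrightarrow> exit_time X A \<omega> = \<infinity>"
  by (auto simp: exit_time_def intro!: INF_eqI)

text \<open>A path which is constant to the right of every time stays at its exit position for a while,
  so that the infimum is attained.\<close>

lemma exit_time_attained:
  assumes const: "\<forall>t\<ge>0. \<exists>e>0. \<forall>s\<in>{t..<t + e}. X s \<omega> = X t \<omega>"
    and s: "0 \<le> s" "X s \<omega> \<notin> A"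
  obtains t where "0 \<le> t" "X t \<omega> \<notin> A" "\<And>s. 0 \<le> s \<Longrightarrow> s < t \<Longrightarrow> X s \<omega> \<in> A"
    "exit_time X A \<omega> = ennreal t"
proof -
  define J where "J = {t. 0 \<le> t \<and> X t \<omega> \<notin> A}"
  have J: "J \<noteq> {}" "bdd_below J" using s by (auto simp: J_def)
  define t where "t = Inf J"
  have t0: "0 \<le> t" unfolding t_def using J by (intro cInf_greatest) (auto simp: J_def)
  have le: "t \<le> s" if "s \<in> J" for s unfolding t_def using that J by (intro cInf_lower)
  obtain e where e: "0 < e" "\<forall>s\<in>{t..<t + e}. X s \<omega> = X t \<omega>"
    using const t0 by blast
  have "Inf J < t + e" using e by (simp add: t_def)
  from cInf_lessD[OF J(1) this] obtain s' where s': "s' \<in> J" "s' < t + e" by blast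
  then have "s' \<in> {t..<t + e}" using le[OF s'(1)] by simp
  then have "X s' \<omega> = X t \<omega>" by (rule bspec[OF e(2)])
  then have tJ: "t \<in> J" using s'(1) t0 by (simp add: J_def)
  have "exit_time X A \<omega> = ennreal t"
    unfolding exit_time_def J_def[symmetric]
  proof (rule antisym)
    show "(INF t\<in>J. ennreal t) \<le> ennreal t" by (rule INF_lower[OF tJ])
    show "ennreal t \<le> (INF t\<in>J. ennreal t)" by (intro INF_greatest ennreal_leI le)
  qed
  moreover have "X v \<omega> \<in> A" if v: "0 \<le> v" "v < t" for v
  proof (rule ccontr)
    assume "X v \<omega> \<notin> A"
    then have "v \<in> J" using v by (simp add: J_def)
    from le[OF this] v show False by simp
  qed
  moreover have "X t \<omega> \<notin> A" using tJ by (simp add: J_def)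
  ultimately show ?thesis by (intro that[OF t0])
qed

context stochastic_basis
begin

text \<open>\<open>F 0\<close> contains all null sets of \<open>P\<close>, so an event may be
  altered on a null set without leaving \<open>F t\<close>.\<close>

lemma F_sets_AE:
  assumes E: "E \<in> sets (F t)" and E': "E' \<subseteq> space P" and eq: "AE \<omega> in P. \<omega> \<in> E \<longleftrightarrow> \<omega> \<in> E'"
  shows "E' \<in> sets (F t)"
proof -
  have "(AE \<omega> in P. \<omega> \<notin> E' - E)" "(AE \<omega> in P. \<omega> \<notin> E - E')"
    using eq by (eventually_elim, auto)+
  moreover have "E \<subseteq> space P" using sets.sets_into_space[OF E] by (simp add: space_F)
  ultimately have "E' - E \<in> null_sets P" "E - E' \<in> null_sets P"
    using E' by (auto simp: null_sets_iff_AE)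
  then have "E' - E \<in> sets (F t)" "E - E' \<in> sets (F t)"
    using null_sets_F sets_F_mono[of 0 t] by auto
  then have "E \<union> (E' - E) - (E - E') \<in> sets (F t)" using E by blast
  also have "E \<union> (E' - E) - (E - E') = E'" by auto
  finally show ?thesis .
qed

text \<open>A path rests for a while at every position it reaches, so an exit before time
  \<open>a\<close> from any Borel set is seen at a rational time before \<open>a\<close>. This
  settles exits strictly before \<open>a\<close>; right continuity of the filtration then admits
  equality.\<close>

lemma stopping_time_exit_time:
  assumes X: "levy_process X" and A[measurable]: "A \<in> sets borel"
    and const: "AE \<omega> in P. \<forall>t\<ge>0. \<exists>e>0. \<forall>s\<in>{t..<t + e}. X s \<omega> = X t \<omega>"
  shows "stopping_time F (exit_time X A)"
proof
  fix t :: ennreal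
  have less: "{\<omega> \<in> space P. exit_time X A \<omega> < ennreal a} \<in> sets (F (ennreal a))" if "0 < a" for a
  proof (rule F_sets_AE)
    let ?E = "\<Union>q\<in>\<rat> \<inter> {0..<a}. X q -` (- A) \<inter> space P"
    show "?E \<in> sets (F (ennreal a))"
    proof (rule sets.countable_UN')
      show "countable (\<rat> \<inter> {0..<a})" by (intro countable_Int1 countable_rat)
      show "(\<lambda>q. X q -` (- A) \<inter> space P) ` (\<rat> \<inter> {0..<a}) \<subseteq> sets (F (ennreal a))"
      proof (rule image_subsetI)
        fix q assume q: "q \<in> \<rat> \<inter> {0..<a}"
        then have "X q -` (- A) \<inter> space (F (ennreal q)) \<in> sets (F (ennreal q))"
          by (intro measurable_sets[OF levy_adapted[OF X]]) auto
        then show "X q -` (- A) \<inter> space P \<in> sets (F (ennreal a))"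
          using q sets_F_mono[of "ennreal q" "ennreal a"] by (auto simp: space_F ennreal_leI)
      qed
    qed
    show "AE \<omega> in P. \<omega> \<in> ?E \<longleftrightarrow> \<omega> \<in> {\<omega> \<in> space P. exit_time X A \<omega> < ennreal a}"
      using const
    proof eventually_elim
      case (elim \<omega>)
      have "exit_time X A \<omega> < ennreal a \<longleftrightarrow> (\<exists>s\<ge>0. s < a \<and> X s \<omega> \<notin> A)"
        unfolding exit_time_def INF_less_iff by (auto simp: ennreal_less_iff)
      also have "\<dots> \<longleftrightarrow> (\<exists>q\<in>\<rat> \<inter> {0..<a}. X q \<omega> \<notin> A)"
      proof
        assume "\<exists>s\<ge>0. s < a \<and> X s \<omega> \<notin> A"
        then obtain s where s: "0 \<le> s" "s < a" "X s \<omega> \<notin> A" by blast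
        obtain e where e: "0 < e" "\<forall>u\<in>{s..<s + e}. X u \<omega> = X s \<omega>" using elim s by blast
        have "s < min a (s + e)" using s(2) e(1) by simp
        from Rats_dense_in_real[OF this] obtain q where q: "q \<in> \<rat>" "s < q" "q < min a (s + e)"
          by blast
        then have "q \<in> {s..<s + e}" by simp
        then have "X q \<omega> = X s \<omega>" by (rule bspec[OF e(2)])
        then show "\<exists>q\<in>\<rat> \<inter> {0..<a}. X q \<omega> \<notin> A"
          using s q by (intro bexI[of _ q]) auto
      qed auto
      finally show ?case by auto
    qed
  qed auto
  show "Measurable.pred (F t) (\<lambda>\<omega>. exit_time X A \<omega> \<le> t)"
  proof (cases t)
    case (real a)
    have "{\<omega> \<in> space P. exit_time X A \<omega> \<le> t} \<in> sets (F s)" if ts: "t < s" for s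
    proof -
      obtain b where b: "a < b" "ennreal b \<le> s"
      proof (cases s)
        case (real b)
        then show ?thesis using ts \<open>t = ennreal a\<close> \<open>0 \<le> a\<close> that[of b] by (simp add: ennreal_less_iff)
      next
        case top
        then show ?thesis using that[of "a + 1"] by simp
      qed
      define c where "c n = a + (b - a) / real (Suc n)" for n
      have c: "a < c n" "c n \<le> b" "c \<longlonglongrightarrow> a" for n
      proof -
        show "a < c n" using b by (simp add: c_def)
        have "(b - a) / real (Suc n) \<le> (b - a) / 1" using b by (intro divide_left_mono) auto
        then show "c n \<le> b" by (simp add: c_def)
        have "(\<lambda>n. a + (b - a) / real (Suc n)) \<longlonglongrightarrow> a + 0"
          by (intro tendsto_intros LIMSEQ_Suc lim_const_over_n)
        then show "c \<longlonglongrightarrow> a" by (simp add: c_def[abs_def])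
      qed
      have "{\<omega> \<in> space P. exit_time X A \<omega> \<le> t} = (\<Inter>n. {\<omega> \<in> space P. exit_time X A \<omega> < ennreal (c n)})"
      proof (intro set_eqI iffI)
        fix \<omega> assume "\<omega> \<in> {\<omega> \<in> space P. exit_time X A \<omega> \<le> t}"
        moreover have "t < ennreal (c n)" for n using real c(1)[of n] by (simp add: ennreal_less_iff)
        ultimately show "\<omega> \<in> (\<Inter>n. {\<omega> \<in> space P. exit_time X A \<omega> < ennreal (c n)})"
          by (auto intro: le_less_trans)
      next
        fix \<omega> assume *: "\<omega> \<in> (\<Inter>n. {\<omega> \<in> space P. exit_time X A \<omega> < ennreal (c n)})"
        have "exit_time X A \<omega> \<le> ennreal a"
          using * by (intro LIMSEQ_le_const[OF tendsto_ennrealI[OF c(3)]]) (auto intro: less_imp_le)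
        then show "\<omega> \<in> {\<omega> \<in> space P. exit_time X A \<omega> \<le> t}" using * real by auto
      qed
      also have "\<dots> \<in> sets (F s)"
      proof (intro sets.countable_INT image_subsetI)
        fix n :: nat
        have "sets (F (ennreal (c n))) \<subseteq> sets (F s)"
          using c(2)[of n] b by (intro sets_F_mono) (meson ennreal_leI order_trans)
        moreover have "0 < c n" using real c(1)[of n] by simp
        ultimately show "{\<omega> \<in> space P. exit_time X A \<omega> < ennreal (c n)} \<in> sets (F s)"
          using less by blast
      qed simp
      finally show ?thesis .
    qed
    then have "{\<omega> \<in> space P. exit_time X A \<omega> \<le> t} \<in> sets (F t)"
      using F_right_continuous[of t] real by auto
    then show ?thesis by (simp add: Measurable.pred_def space_F)
  qed simp
qed

context
  fixes X :: "real \<Rightarrow> 'a \<Rightarrow> real" and \<tau> :: "'a \<Rightarrow> ennreal" and g :: "real \<Rightarrow> real" and r :: real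
  assumes X: "levy_process X" and g: "continuous_on UNIV g" "\<And>y. 0 \<le> g y"
    and r: "0 \<le> r" and \<tau>: "stopping_time F \<tau>"
begin

definition stopped_by :: "nat \<Rightarrow> nat \<Rightarrow> 'a set" where
  "stopped_by n k = {\<omega> \<in> space P. \<tau> \<omega> \<le> ennreal (real k * (1 / Suc n))}"

text \<open>The payoff with \<open>\<tau>\<close> rounded up to the grid. Where
  \<open>\<tau> = \<infinity>\<close> no index is reached and the series is zero, as the payoff
  convention demands.\<close>

definition grid_payoff :: "nat \<Rightarrow> 'a \<Rightarrow> ennreal" where
  "grid_payoff n \<omega> = (\<Sum>k. grid_value X (\<lambda>y. ennreal (g y)) r (1 / Suc n) k \<omega> *
     indicator (disjointed (stopped_by n) k) \<omega>)"

lemma borel_measurable_g[measurable]: "g \<in> borel_measurable borel"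
  by (rule borel_measurable_continuous_onI[OF g(1)])

lemma stopped_by_F: "stopped_by n k \<in> sets (F (ennreal (real k * (1 / Suc n))))"
  using stopping_timeD[OF \<tau>] by (simp add: stopped_by_def Measurable.pred_def space_F)

lemma borel_measurable_grid_payoff[measurable]: "grid_payoff n \<in> borel_measurable P"
proof -
  note [measurable] = borel_measurable_grid_value[OF X _ r _ stopped_by_F, of "\<lambda>y. ennreal (g y)"]
    disjointed_sets[OF X _ r _ stopped_by_F, of "\<lambda>y. ennreal (g y)"]
  show ?thesis unfolding grid_payoff_def[abs_def] by measurable
qed

text \<open>Rounding up lets the grid times approach \<open>\<tau>\<close> from the right, the side
  on which the paths are continuous.\<close>

lemma grid_payoff_tendsto:
  "AE \<omega> in P. (\<lambda>n. grid_payoff n \<omega>) \<longlonglongrightarrow> ennreal (discounted_payoff r g X \<tau> \<omega>)"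
proof -
  have "AE \<omega> in P. cadlag (\<lambda>t. X t \<omega>)" using X by (simp add: levy_process_def)
  with AE_space show ?thesis
  proof eventually_elim
    case (elim \<omega>)
    show ?case
    proof (cases "\<tau> \<omega>")
      case top
      then have "\<omega> \<notin> stopped_by n k" for n k
        by (auto simp: stopped_by_def top_unique)
      then have "\<omega> \<notin> disjointed (stopped_by n) k" for n k
        using disjointed_subset[of "stopped_by n" k] by blast
      then have "grid_payoff n \<omega> = 0" for n by (simp add: grid_payoff_def)
      then show ?thesis using top by (simp add: discounted_payoff_def)
    next
      case (real t)
      have "\<exists>k. t \<le> real k * (1 / Suc n) \<and> real k * (1 / Suc n) \<le> t + 1 / Suc n \<and>
          (\<forall>j<k. real j * (1 / Suc n) < t)" for n
        using real by (intro first_grid_index) auto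
      then obtain k where k: "\<And>n. t \<le> real (k n) * (1 / Suc n)"
        "\<And>n. real (k n) * (1 / Suc n) \<le> t + 1 / Suc n"
        "\<And>n j. j < k n \<Longrightarrow> real j * (1 / Suc n) < t"
        by metis
      define s where "s n = real (k n) * (1 / Suc n)" for n
      have "(\<lambda>n. t + 1 / real (Suc n)) \<longlonglongrightarrow> t + 0"
        by (intro tendsto_intros LIMSEQ_Suc lim_const_over_n)
      then have s: "s \<longlonglongrightarrow> t"
        unfolding s_def[abs_def]
        by (intro tendsto_sandwich[OF always_eventually[OF allI[OF k(1)]] always_eventually[OF allI[OF k(2)]]])
           simp_all
      have "\<omega> \<in> disjointed (stopped_by n) (k n)" for n
      proof -
        have "\<omega> \<in> stopped_by n (k n)"
          unfolding stopped_by_def using elim(1) real ennreal_leI[OF k(1)[of n]]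
          by (intro CollectI conjI) (simp_all only:)
        moreover have "\<omega> \<notin> stopped_by n j" if "j < k n" for j
        proof
          assume "\<omega> \<in> stopped_by n j"
          then have "ennreal t \<le> ennreal (real j * (1 / Suc n))"
            unfolding stopped_by_def mem_Collect_eq real(2) by (rule conjunct2)
          then have "t \<le> real j * (1 / Suc n)"
            by (subst (asm) ennreal_le_iff) auto
          from leD[OF this] k(3)[OF that] show False by contradiction
        qed
        ultimately show ?thesis by (auto simp: disjointed_def)
      qed
      then have "grid_payoff n \<omega> = ennreal (exp (- r * s n) * g (X (s n) \<omega>))" for n
        unfolding grid_payoff_def by (subst suminf_disjointed[of _ _ "k n"])
          (auto simp: grid_value_def s_def ennreal_mult g simp del: of_nat_Suc)
      moreover have "(\<lambda>n. exp (- r * s n) * g (X (s n) \<omega>)) \<longlonglongrightarrow> exp (- r * t) * g (X t \<omega>)"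
      proof -
        have "continuous (at_right t) (\<lambda>t. X t \<omega>)" using elim real by (simp add: cadlag_def)
        then have "continuous (at t within {t..}) (\<lambda>t. X t \<omega>)"
          unfolding continuous_within at_within_Ici_at_right .
        moreover have "s n \<in> {t..}" for n using k(1)[of n] by (simp only: s_def atLeast_iff)
        ultimately have "(\<lambda>n. X (s n) \<omega>) \<longlonglongrightarrow> X t \<omega>"
          using s unfolding continuous_within_sequentially comp_def by blast
        then have "(\<lambda>n. g (X (s n) \<omega>)) \<longlonglongrightarrow> g (X t \<omega>)"
          by (intro continuous_on_tendsto_compose[OF g(1)]) auto
        then show ?thesis by (intro tendsto_intros s)
      qed
      ultimately show ?thesis
        using real by (simp add: discounted_payoff_def tendsto_ennrealI)
    qed
  qed
qed

text \<open>Evaluation of \<open>X\<close> at a random time is measurable because the payoff is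
  almost surely a limit of grid payoffs, which involve countably many times.\<close>

lemma borel_measurable_discounted_payoff: "discounted_payoff r g X \<tau> \<in> borel_measurable P"
proof -
  have "AE \<omega> in P. discounted_payoff r g X \<tau> \<omega> = enn2real (liminf (\<lambda>n. grid_payoff n \<omega>))"
    using grid_payoff_tendsto
  proof eventually_elim
    case (elim \<omega>)
    have "liminf (\<lambda>n. grid_payoff n \<omega>) = ennreal (discounted_payoff r g X \<tau> \<omega>)"
      using elim by (intro lim_imp_Liminf) auto
    moreover have "0 \<le> discounted_payoff r g X \<tau> \<omega>" by (simp add: discounted_payoff_def g)
    ultimately show ?case by simp
  qed
  then show ?thesis
    by (rule borel_measurable_AE_eq[rotated]) auto
qed

lemma discounted_payoff_le:
  assumes step: "\<And>h y. 0 \<le> h \<Longrightarrow>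
      ennreal (exp (- r * h)) * (\<integral>\<^sup>+\<omega>. ennreal (g (y + (X h \<omega> - X 0 \<omega>))) \<partial>P) \<le> ennreal (g y)"
  shows "(\<integral>\<^sup>+\<omega>. ennreal (discounted_payoff r g X \<tau> \<omega>) \<partial>P) \<le> (\<integral>\<^sup>+\<omega>. ennreal (g (X 0 \<omega>)) \<partial>P)"
proof -
  have "(\<integral>\<^sup>+\<omega>. ennreal (discounted_payoff r g X \<tau> \<omega>) \<partial>P) = (\<integral>\<^sup>+\<omega>. liminf (\<lambda>n. grid_payoff n \<omega>) \<partial>P)"
  proof (rule nn_integral_cong_AE)
    show "AE \<omega> in P. ennreal (discounted_payoff r g X \<tau> \<omega>) = liminf (\<lambda>n. grid_payoff n \<omega>)"
      using grid_payoff_tendsto by eventually_elim (rule lim_imp_Liminf[OF sequentially_bot, symmetric])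
  qed
  also have "\<dots> \<le> liminf (\<lambda>n. \<integral>\<^sup>+\<omega>. grid_payoff n \<omega> \<partial>P)"
    by (rule nn_integral_liminf) measurable
  also have "\<dots> \<le> (\<integral>\<^sup>+\<omega>. ennreal (g (X 0 \<omega>)) \<partial>P)"
  proof -
    have "(\<integral>\<^sup>+\<omega>. grid_payoff n \<omega> \<partial>P) \<le> (\<integral>\<^sup>+\<omega>. ennreal (g (X 0 \<omega>)) \<partial>P)" for n
      unfolding grid_payoff_def
      by (rule grid_supermartingale_suminf[OF X _ r _ stopped_by_F step]) auto
    then have "limsup (\<lambda>n. \<integral>\<^sup>+\<omega>. grid_payoff n \<omega> \<partial>P) \<le> (\<integral>\<^sup>+\<omega>. ennreal (g (X 0 \<omega>)) \<partial>P)"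
      by (intro Limsup_bounded always_eventually) auto
    then show ?thesis using Liminf_le_Limsup[OF sequentially_bot] by (rule order_trans[rotated])
  qed
  finally show ?thesis .
qed

end

text \<open>The loss factors multiply to a limit of one, and \<open>dom\<close> gives a majorant,
  only over bounded time; hence the horizon \<open>T\<close>. Paths still running there contribute
  at most \<open>exp (- r * T) * C\<close>, which vanishes as \<open>T\<close> grows.\<close>

lemma exit_payoff_ge:
  assumes X: "levy_process X" and g: "continuous_on UNIV g" "\<And>y. 0 \<le> g y"
    and r: "0 < r" and A[measurable]: "A \<in> sets borel"
    and const: "AE \<omega> in P. \<forall>t\<ge>0. \<exists>e>0. \<forall>s\<in>{t..<t + e}. X s \<omega> = X t \<omega>"
    and c: "0 \<le> c"
    and step: "\<And>h y. 0 < h \<Longrightarrow> y \<in> A \<Longrightarrow> ennreal (exp (- c * h) * (1 + c * h)) * ennreal (g y) \<le>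
      ennreal (exp (- r * h)) * (\<integral>\<^sup>+\<omega>. ennreal (g (y + (X h \<omega> - X 0 \<omega>))) \<partial>P)"
    and bound: "\<And>y. y \<in> A \<Longrightarrow> g y \<le> C"
    and dom: "\<And>T :: nat. \<exists>w\<in>borel_measurable P. (\<integral>\<^sup>+\<omega>. w \<omega> \<partial>P) < \<infinity> \<and>
      (AE \<omega> in P. \<forall>s. 0 \<le> s \<longrightarrow> s \<le> real T \<longrightarrow> ennreal (g (X s \<omega>)) \<le> w \<omega>)"
  shows "(\<integral>\<^sup>+\<omega>. ennreal (g (X 0 \<omega>)) \<partial>P) \<le>
    (\<integral>\<^sup>+\<omega>. ennreal (discounted_payoff r g X (exit_time X A) \<omega>) \<partial>P)" (is "?v \<le> ?I")
proof -
  have \<tau>: "stopping_time F (exit_time X A)"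
    by (rule stopping_time_exit_time[OF X A const])
  have r0: "0 \<le> r" using r by simp
  have [measurable]: "g \<in> borel_measurable borel"
    by (rule borel_measurable_continuous_onI[OF g(1)])
  have payoff[measurable]: "discounted_payoff r g X (exit_time X A) \<in> borel_measurable P"
    by (rule borel_measurable_discounted_payoff[OF X g r0 \<tau>])
  have horizon: "?v \<le> ?I + ennreal (exp (- r * real T) * C)" for T :: nat
  proof -
    obtain w where w[measurable]: "w \<in> borel_measurable P" and w_int: "(\<integral>\<^sup>+\<omega>. w \<omega> \<partial>P) < \<infinity>"
      and w_dom: "AE \<omega> in P. \<forall>s. 0 \<le> s \<longrightarrow> s \<le> real T \<longrightarrow> ennreal (g (X s \<omega>)) \<le> w \<omega>"
      using dom[of T] by auto
    define h where "h n = 1 / real (Suc n)" for n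
    \<comment> \<open>With mesh \<open>1 / Suc n\<close> the integer \<open>T\<close> is itself a
      grid point, of index \<open>N n\<close>, so an exit exactly at time \<open>T\<close> is still
      counted.\<close>
    define N where "N n = T * Suc n" for n
    have h: "0 < h n" "real (N n) * h n = real T" for n
      by (simp_all add: h_def N_def del: of_nat_Suc mult_Suc_right)
    \<comment> \<open>Stopping is at the first grid point outside \<open>A\<close>, not at the exit
      time rounded up: a path found in \<open>A\<close> at a grid point satisfies
      \<open>step\<close>, whatever it did in between.\<close>
    define B where "B n k = X (real k * h n) -` (- A) \<inter> space P" for n k
    have B: "B n k \<in> sets (F (ennreal (real k * h n)))" for n k
    proof -
      have "X (real k * h n) -` (- A) \<inter> space (F (ennreal (real k * h n))) \<in> sets (F (ennreal (real k * h n)))"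
        using h(1)[of n] by (intro measurable_sets[OF levy_adapted[OF X]]) auto
      then show ?thesis by (simp add: B_def space_F)
    qed
    define gv where "gv n k \<omega> = grid_value X (\<lambda>y. ennreal (g y)) r (h n) k \<omega>" for n k \<omega>
    have gv_eq: "gv n k \<omega> = ennreal (exp (- r * (real k * h n)) * g (X (real k * h n) \<omega>))" for n k \<omega>
      by (simp add: gv_def grid_value_def ennreal_mult g)
    note ctx = X _ r0 less_imp_le[OF h(1)] B
    have [measurable]: "gv n k \<in> borel_measurable P" "disjointed (B n) k \<in> sets P"
      "running (B n) k \<in> sets P" for n k
      unfolding gv_def[abs_def]
      by (rule borel_measurable_grid_value[OF ctx] disjointed_sets[OF ctx, of "\<lambda>y. ennreal (g y)"]
        running_sets[OF ctx, of "\<lambda>y. ennreal (g y)"]; measurable)+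
    define U where "U n \<omega> = (\<Sum>j\<le>N n. gv n j \<omega> * indicator (disjointed (B n) j) \<omega>)" for n \<omega>
    have [measurable]: "U n \<in> borel_measurable P" for n
      unfolding U_def[abs_def] by measurable
    define q where "q n = exp (- c * h n) * (1 + c * h n)" for n
    have q: "0 \<le> q n" "q n \<le> 1" for n
    proof -
      show "0 \<le> q n" using c h(1)[of n] by (simp add: q_def)
      have "q n \<le> exp (- c * h n) * exp (c * h n)"
        unfolding q_def by (intro mult_left_mono exp_ge_add_one_self) auto
      then show "q n \<le> 1" by (simp add: exp_add[symmetric])
    qed
    have lower: "ennreal (q n ^ (N n)) * ?v \<le> (\<integral>\<^sup>+\<omega>. U n \<omega> \<partial>P) + ennreal (exp (- r * real T) * C)" for n
    proof -
      have "ennreal (q n ^ (N n)) * ?v \<le>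
          (\<Sum>j\<le>N n. \<integral>\<^sup>+\<omega>. gv n j \<omega> * indicator (disjointed (B n) j) \<omega> \<partial>P) +
          (\<integral>\<^sup>+\<omega>. gv n (N n) \<omega> * indicator (running (B n) (Suc (N n))) \<omega> \<partial>P)"
        unfolding gv_def
      proof (rule grid_submartingale[OF ctx q])
        fix k \<omega> assume "\<omega> \<in> space P - B n k"
        then have "X (real k * h n) \<omega> \<in> A" by (auto simp: B_def)
        from step[OF h(1) this] show "ennreal (q n) * ennreal (g (X (real k * h n) \<omega>)) \<le>
            ennreal (exp (- r * h n)) * (\<integral>\<^sup>+\<omega>'. ennreal (g (X (real k * h n) \<omega> + (X (h n) \<omega>' - X 0 \<omega>'))) \<partial>P)"
          by (simp only: q_def)
      qed measurable
      also have "(\<Sum>j\<le>N n. \<integral>\<^sup>+\<omega>. gv n j \<omega> * indicator (disjointed (B n) j) \<omega> \<partial>P) = (\<integral>\<^sup>+\<omega>. U n \<omega> \<partial>P)"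
        unfolding U_def by (intro nn_integral_sum[symmetric]) measurable
      also have "(\<integral>\<^sup>+\<omega>. gv n (N n) \<omega> * indicator (running (B n) (Suc (N n))) \<omega> \<partial>P) \<le>
          (\<integral>\<^sup>+\<omega>. ennreal (exp (- r * real T) * C) \<partial>P)"
      proof (rule nn_integral_mono)
        fix \<omega>
        show "gv n (N n) \<omega> * indicator (running (B n) (Suc (N n))) \<omega> \<le> ennreal (exp (- r * real T) * C)"
        proof (cases "\<omega> \<in> running (B n) (Suc (N n))")
          case True
          then have "\<omega> \<in> space P - B n (N n)" by (auto simp: running_def)
          then have "X (real (N n) * h n) \<omega> \<in> A" by (auto simp: B_def)
          then have "g (X (real (N n) * h n) \<omega>) \<le> C" by (rule bound)
          then show ?thesis using True unfolding gv_eq h(2)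
            by (auto intro!: ennreal_leI)
        qed simp
      qed
      also have "\<dots> = ennreal (exp (- r * real T) * C)" by (simp add: emeasure_space_1)
      finally show ?thesis by (simp add: add_left_mono)
    qed
    define \<tau>' where "\<tau>' = exit_time X A"
    define u where "u \<omega> = ennreal (discounted_payoff r g X \<tau>' \<omega>) * indicator {\<omega> \<in> space P. \<tau>' \<omega> \<le> ennreal (real T)} \<omega>" for \<omega>
    have [measurable]: "{\<omega> \<in> space P. \<tau>' \<omega> \<le> ennreal (real T)} \<in> sets P"
      using stopping_timeD[OF \<tau>, of "ennreal (real T)"]
      by (intro F_sets[of _ "ennreal (real T)"]) (simp add: \<tau>'_def Measurable.pred_def space_F)
    have [measurable]: "discounted_payoff r g X \<tau>' \<in> borel_measurable P"
      using payoff unfolding \<tau>'_def .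
    have [measurable]: "u \<in> borel_measurable P"
      unfolding u_def[abs_def] by measurable
    have h_lim: "h \<longlonglongrightarrow> 0"
      unfolding h_def[abs_def] by (intro LIMSEQ_Suc lim_const_over_n)
    have lim_U: "(\<lambda>n. \<integral>\<^sup>+\<omega>. U n \<omega> \<partial>P) \<longlonglongrightarrow> (\<integral>\<^sup>+\<omega>. u \<omega> \<partial>P)"
    proof (rule nn_integral_dominated_convergence[OF _ _ w _ w_int])
      fix n
      show "AE \<omega> in P. U n \<omega> \<le> w \<omega>"
        using w_dom
      proof eventually_elim
        case (elim \<omega>)
        show ?case
        proof (cases "\<exists>k\<le>N n. \<omega> \<in> disjointed (B n) k")
          case True
          then obtain k where k: "k \<le> N n" "\<omega> \<in> disjointed (B n) k" by blast
          have "real k * h n \<le> real (N n) * h n"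
            using k h(1)[of n] by (intro mult_right_mono) (auto)
          then have kT: "0 \<le> real k * h n" "real k * h n \<le> real T"
            using h[of n] by simp_all
          have "U n \<omega> = gv n k \<omega>"
            unfolding U_def by (rule sum_disjointed[OF k(2,1)])
          also have "\<dots> \<le> ennreal (g (X (real k * h n) \<omega>))"
            unfolding gv_eq using r kT g(2) by (intro ennreal_leI mult_left_le_one_le) auto
          also have "\<dots> \<le> w \<omega>" using elim kT by simp
          finally show ?thesis .
        next
          case False
          then show ?thesis by (auto simp: U_def)
        qed
      qed
    next
      show "AE \<omega> in P. (\<lambda>n. U n \<omega>) \<longlonglongrightarrow> u \<omega>"
        using const AE_space
      proof eventually_elim
        case (elim \<omega>)
        show ?case
        proof (cases "\<forall>s\<ge>0. X s \<omega> \<in> A")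
          case True
          then have "\<omega> \<notin> B n k" for n k using h(1)[of n] by (auto simp: B_def)
          then have "\<omega> \<notin> disjointed (B n) k" for n k
            using disjointed_subset[of "B n" k] by blast
          then have "U n \<omega> = 0" for n by (simp add: U_def)
          moreover have "\<tau>' \<omega> = \<infinity>" unfolding \<tau>'_def using True by (intro exit_time_eq_top) auto
          then have "u \<omega> = 0" by (simp add: u_def discounted_payoff_def)
          ultimately show ?thesis by simp
        next
          case False
          then obtain s where "0 \<le> s" "X s \<omega> \<notin> A" by blast
          then obtain t where t: "0 \<le> t" "X t \<omega> \<notin> A" "\<And>s. 0 \<le> s \<Longrightarrow> s < t \<Longrightarrow> X s \<omega> \<in> A"
            "\<tau>' \<omega> = ennreal t"
            using exit_time_attained[of X \<omega> s A] elim(1) unfolding \<tau>'_def by blast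
          have notB: "\<omega> \<notin> B n j" if "real j * h n < t" for n j
            using t(3)[OF _ that] h(1)[of n] by (auto simp: B_def)
          show ?thesis
          proof (cases "t \<le> real T")
            case False
            have "\<omega> \<notin> B n j" if "j \<le> N n" for n j
            proof (rule notB)
              have "real j * h n \<le> real (N n) * h n"
                using that h(1)[of n] by (intro mult_right_mono) (auto)
              then show "real j * h n < t" using False h(2)[of n] by simp
            qed
            then have "\<omega> \<notin> disjointed (B n) j" if "j \<le> N n" for n j
              using that disjointed_subset[of "B n" j] by blast
            then have "U n \<omega> = 0" for n by (simp add: U_def)
            moreover have "u \<omega> = 0" using False t by (simp add: u_def)
            ultimately show ?thesis by simp
          next
            case tT: True
            have "\<exists>k. t \<le> real k * h n \<and> real k * h n \<le> t + h n \<and> (\<forall>j<k. real j * h n < t)" for n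
              using t h(1) by (intro first_grid_index) auto
            then obtain k where k: "\<And>n. t \<le> real (k n) * h n"
              "\<And>n. real (k n) * h n \<le> t + h n" "\<And>n j. j < k n \<Longrightarrow> real j * h n < t"
              by metis
            have kT: "k n \<le> N n" for n
              using k(3)[of "N n" n] h(2)[of n] tT by (cases "N n < k n") simp_all
            obtain e where e: "0 < e" "\<forall>s\<in>{t..<t + e}. X s \<omega> = X t \<omega>"
              using elim t by blast
            have "eventually (\<lambda>n. h n < e) sequentially"
              using h_lim e by (simp add: order_tendstoD)
            \<comment> \<open>The path rests at its exit position during \<open>[t, t + e)\<close>.
              Once the mesh is below \<open>e\<close> the next grid point falls there, so no return
              to \<open>A\<close> hides the exit.\<close>
            then have ev: "eventually (\<lambda>n. ennreal (exp (- r * (real (k n) * h n)) * g (X t \<omega>)) = U n \<omega>) sequentially"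
            proof eventually_elim
              case (elim n)
              have "real (k n) * h n \<in> {t..<t + e}"
                using k(1,2)[of n] elim by simp
              then have Xt: "X (real (k n) * h n) \<omega> = X t \<omega>" by (rule bspec[OF e(2)])
              have "\<omega> \<in> disjointed (B n) (k n)"
                using t(2) Xt notB k(3) \<open>\<omega> \<in> space P\<close>
                by (auto simp: disjointed_def) (auto simp: B_def)
              then have "U n \<omega> = gv n (k n) \<omega>"
                unfolding U_def using kT by (intro sum_disjointed)
              then show ?case by (simp only: gv_eq Xt)
            qed
            have "(\<lambda>n. t + h n) \<longlonglongrightarrow> t + 0" by (intro tendsto_intros h_lim)
            then have "(\<lambda>n. real (k n) * h n) \<longlonglongrightarrow> t"
              by (intro tendsto_sandwich[OF always_eventually[OF allI[OF k(1)]] always_eventually[OF allI[OF k(2)]]])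
                 simp_all
            then have "(\<lambda>n. ennreal (exp (- r * (real (k n) * h n)) * g (X t \<omega>))) \<longlonglongrightarrow>
                ennreal (exp (- r * t) * g (X t \<omega>))"
              by (intro tendsto_ennrealI tendsto_intros)
            then have "(\<lambda>n. U n \<omega>) \<longlonglongrightarrow> ennreal (exp (- r * t) * g (X t \<omega>))"
              using ev by (rule Lim_transform_eventually)
            moreover have "u \<omega> = ennreal (exp (- r * t) * g (X t \<omega>))"
              using t tT elim(2) by (simp add: u_def discounted_payoff_def ennreal_leI)
            ultimately show ?thesis by simp
          qed
        qed
      qed
    qed measurable
    \<comment> \<open>The product is \<open>exp (- c) ^ T\<close> times the \<open>T\<close>-th
      power of \<open>(1 + c / Suc n) ^ Suc n\<close>, which tends to \<open>exp c\<close>.\<close>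
    have "(\<lambda>n. q n ^ (N n)) \<longlonglongrightarrow> 1"
    proof -
      have "q n ^ (N n) = exp (- c) ^ T * ((1 + c / real (Suc n)) ^ Suc n) ^ T" for n
      proof -
        have "exp (- c * h n) ^ Suc n = exp (real (Suc n) * (- c * h n))"
          by (rule exp_of_nat_mult[symmetric])
        also have "real (Suc n) * (- c * h n) = - c" by (simp add: h_def del: of_nat_Suc)
        finally have "(exp (- c * h n) ^ Suc n) ^ T = exp (- c) ^ T" by simp
        then show ?thesis
          unfolding q_def N_def mult.commute[of T] power_mult power_mult_distrib by (simp add: h_def)
      qed
      moreover have "(\<lambda>n. exp (- c) ^ T * ((1 + c / real (Suc n)) ^ Suc n) ^ T) \<longlonglongrightarrow> exp (- c) ^ T * exp c ^ T"
        by (intro tendsto_intros LIMSEQ_Suc[OF tendsto_exp_limit_sequentially])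
      moreover have "exp (- c) ^ T * exp c ^ T = 1"
        by (simp add: power_mult_distrib[symmetric] exp_add[symmetric])
      ultimately show ?thesis by simp
    qed
    then have "(\<lambda>n. ennreal (q n ^ (N n)) * ?v) \<longlonglongrightarrow> ennreal 1 * ?v"
      by (intro tendsto_mult_ennreal tendsto_ennrealI tendsto_const) auto
    moreover have "(\<lambda>n. (\<integral>\<^sup>+\<omega>. U n \<omega> \<partial>P) + ennreal (exp (- r * real T) * C)) \<longlonglongrightarrow>
        (\<integral>\<^sup>+\<omega>. u \<omega> \<partial>P) + ennreal (exp (- r * real T) * C)"
      by (intro tendsto_add lim_U tendsto_const)
    ultimately have "ennreal 1 * ?v \<le> (\<integral>\<^sup>+\<omega>. u \<omega> \<partial>P) + ennreal (exp (- r * real T) * C)"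
      by (rule LIMSEQ_le) (use lower in auto)
    also have "(\<integral>\<^sup>+\<omega>. u \<omega> \<partial>P) \<le> ?I"
      unfolding u_def \<tau>'_def by (intro nn_integral_mono) (auto simp: indicator_def)
    finally show ?thesis by (simp add: add_right_mono)
  qed
  have "(\<lambda>T. exp (- r) ^ T) \<longlonglongrightarrow> 0" using r by (intro LIMSEQ_realpow_zero) auto
  then have "(\<lambda>T. exp (- r * real T)) \<longlonglongrightarrow> 0"
    by (simp add: exp_of_nat_mult[symmetric] mult.commute)
  then have "(\<lambda>T. ennreal (exp (- r * real T) * C)) \<longlonglongrightarrow> ennreal (0 * C)"
    by (intro tendsto_ennrealI tendsto_intros)
  then have "(\<lambda>T. ?I + ennreal (exp (- r * real T) * C)) \<longlonglongrightarrow> ?I + ennreal (0 * C)"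
    by (intro tendsto_add tendsto_const)
  then have "?v \<le> ?I + ennreal (0 * C)"
    by (rule LIMSEQ_le_const) (use horizon in auto)
  then show ?thesis by simp
qed

end

section \<open>The value function\<close>

lemma DERIV_If_le:
  fixes f g :: "real \<Rightarrow> real"
  assumes f: "DERIV f a :> D" and g: "DERIV g a :> D" and eq: "f a = g a"
  shows "DERIV (\<lambda>s. if s \<le> a then f s else g s) a :> D"
  unfolding has_field_derivative_iff
proof (rule filterlim_split_at)
  let ?h = "\<lambda>s. if s \<le> a then f s else g s"
  show "((\<lambda>y. (?h y - ?h a) / (y - a)) \<longlongrightarrow> D) (at_left a)"
  proof (rule Lim_transform_eventually)
    show "((\<lambda>y. (f y - f a) / (y - a)) \<longlongrightarrow> D) (at_left a)"
      using f unfolding has_field_derivative_iff by (rule tendsto_within_subset) auto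
    show "\<forall>\<^sub>F y in at_left a. (f y - f a) / (y - a) = (?h y - ?h a) / (y - a)"
      unfolding eventually_at_filter by (rule always_eventually) auto
  qed
  show "((\<lambda>y. (?h y - ?h a) / (y - a)) \<longlongrightarrow> D) (at_right a)"
  proof (rule Lim_transform_eventually)
    show "((\<lambda>y. (g y - g a) / (y - a)) \<longlongrightarrow> D) (at_right a)"
      using g unfolding has_field_derivative_iff by (rule tendsto_within_subset) auto
    show "\<forall>\<^sub>F y in at_right a. (g y - g a) / (y - a) = (?h y - ?h a) / (y - a)"
      unfolding eventually_at_filter using eq by (intro always_eventually) auto
  qed
qed

text \<open>By \<open>mean\<close> the antiderivatives on the two sides of \<open>a\<close> which vanish at infinity fit together, so
  the part beyond \<open>a\<close> contributes as much as the exponential sum continued to all \<open>s \<ge> 0\<close>.\<close>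

lemma nn_integral_exponential_overshoot:
  fixes g :: "real \<Rightarrow> real"
  assumes \<alpha>: "0 < \<alpha>" "p < \<alpha>" "0 < q" and a: "0 \<le> a"
    and g[measurable]: "g \<in> borel_measurable borel" and nonneg: "\<And>s. 0 \<le> g s"
    and g_eq: "\<And>s. 0 \<le> s \<Longrightarrow> g s = (if s \<le> a then A * exp (p * s) + B * exp (- q * s) else z + (s - a))"
    and val: "A * exp (p * a) + B * exp (- q * a) = z"
    and mean: "z + 1 / \<alpha> = A * exp (p * a) * (\<alpha> / (\<alpha> - p)) + B * exp (- q * a) * (\<alpha> / (\<alpha> + q))"
  shows "(\<integral>\<^sup>+s. ennreal (g s) \<partial>density lborel (exponential_density \<alpha>)) =
    ennreal (A * (\<alpha> / (\<alpha> - p)) + B * (\<alpha> / (\<alpha> + q)))"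
proof -
  define H1 where "H1 s = - (A * (\<alpha> / (\<alpha> - p)) * exp (- (\<alpha> - p) * s) +
      B * (\<alpha> / (\<alpha> + q)) * exp (- (\<alpha> + q) * s))" for s
  define H2 where "H2 s = - (z + (s - a) + 1 / \<alpha>) * exp (- \<alpha> * s)" for s
  define H where "H s = (if s \<le> a then H1 s else H2 s)" for s
  define g1 where "g1 s = A * exp (p * s) + B * exp (- q * s)" for s
  define g2 where "g2 s = z + (s - a)" for s
  have ne: "\<alpha> - p \<noteq> 0" "\<alpha> + q \<noteq> 0" using \<alpha> by auto
  have H1: "DERIV H1 s :> g1 s * (\<alpha> * exp (- \<alpha> * s))" for s
  proof -
    have "DERIV (\<lambda>s. - (c * exp (- k * s) + d * exp (- l * s))) s :>
        - (c * (exp (- k * s) * (- k)) + d * (exp (- l * s) * (- l)))" for c d k l :: real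
      by (auto intro!: derivative_eq_intros)
    then have "DERIV H1 s :> - (A * (\<alpha> / (\<alpha> - p)) * (exp (- (\<alpha> - p) * s) * (- (\<alpha> - p))) +
        B * (\<alpha> / (\<alpha> + q)) * (exp (- (\<alpha> + q) * s) * (- (\<alpha> + q))))"
      unfolding H1_def .
    moreover have "- (A * (\<alpha> / (\<alpha> - p)) * (exp (- (\<alpha> - p) * s) * (- (\<alpha> - p))) +
        B * (\<alpha> / (\<alpha> + q)) * (exp (- (\<alpha> + q) * s) * (- (\<alpha> + q)))) =
        g1 s * (\<alpha> * exp (- \<alpha> * s))" (is "?d = _")
    proof -
      have "- (A * b * (c * (- k)) + B * d * (e * (- l))) = A * c * (b * k) + B * e * (d * l)"
        for b c d e k l :: real
        by (simp add: algebra_simps)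
      then have "?d = A * exp (- (\<alpha> - p) * s) * (\<alpha> / (\<alpha> - p) * (\<alpha> - p)) +
          B * exp (- (\<alpha> + q) * s) * (\<alpha> / (\<alpha> + q) * (\<alpha> + q))"
        .
      also have "\<dots> = A * exp (- (\<alpha> - p) * s) * \<alpha> + B * exp (- (\<alpha> + q) * s) * \<alpha>"
        using ne by simp
      also have "\<dots> = A * (exp (p * s) * exp (- \<alpha> * s)) * \<alpha> + B * (exp (- q * s) * exp (- \<alpha> * s)) * \<alpha>"
        by (simp only: exp_add[symmetric]) (simp add: algebra_simps)
      also have "\<dots> = g1 s * (\<alpha> * exp (- \<alpha> * s))"
        by (simp add: g1_def algebra_simps)
      finally show ?thesis .
    qed
    ultimately show ?thesis by simp
  qed
  have H2: "DERIV H2 s :> g2 s * (\<alpha> * exp (- \<alpha> * s))" for s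
    unfolding H2_def g2_def using \<alpha>
    by (auto intro!: derivative_eq_intros simp: field_simps)
  have "H1 a = H2 a"
  proof -
    have "exp (- (\<alpha> - p) * a) = exp (p * a) * exp (- \<alpha> * a)"
      "exp (- (\<alpha> + q) * a) = exp (- q * a) * exp (- \<alpha> * a)"
      by (simp_all add: exp_add[symmetric] algebra_simps)
    then have "H1 a = - (A * exp (p * a) * (\<alpha> / (\<alpha> - p)) + B * exp (- q * a) * (\<alpha> / (\<alpha> + q))) * exp (- \<alpha> * a)"
      unfolding H1_def by (simp only: distrib_left mult_minus_right mult_ac)
    then show ?thesis
      unfolding mean[symmetric] by (simp add: H2_def)
  qed
  moreover have g12: "g1 a = g2 a"
    using val by (simp add: g1_def g2_def)
  \<comment> \<open>Equal values of \<open>g1\<close> and \<open>g2\<close> at \<open>a\<close> make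
    the one-sided derivatives agree, so \<open>H\<close> is differentiable at the break too and the
    fundamental theorem applies on the whole half-line.\<close>
  ultimately have "DERIV H a :> g1 a * (\<alpha> * exp (- \<alpha> * a))"
    unfolding H_def[abs_def] using H1[of a] H2[of a] by (intro DERIV_If_le) auto
  moreover have "DERIV H s :> g1 s * (\<alpha> * exp (- \<alpha> * s))" if "s < a" for s
    using H1[of s] that
    by (rule_tac has_field_derivative_transform_within_open[OF _ open_lessThan[of a]]) (auto simp: H_def)
  moreover have "DERIV H s :> g2 s * (\<alpha> * exp (- \<alpha> * s))" if "a < s" for s
    using H2[of s] that
    by (rule_tac has_field_derivative_transform_within_open[OF _ open_greaterThan[of a]]) (auto simp: H_def)
  ultimately have H: "DERIV H s :> g s * (\<alpha> * exp (- \<alpha> * s))" if "0 \<le> s" for s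
    using that by (cases s a rule: linorder_cases) (auto simp: g_eq g1_def g2_def)
  have "(H2 \<longlongrightarrow> 0) at_top"
    unfolding H2_def using \<alpha>(1) by real_asymp
  then have lim: "(H \<longlongrightarrow> 0) at_top"
    by (rule Lim_transform_eventually)
       (use eventually_gt_at_top[of a] in \<open>eventually_elim; simp add: H_def\<close>)
  have "(\<integral>\<^sup>+s. ennreal (g s) \<partial>density lborel (exponential_density \<alpha>)) =
      (\<integral>\<^sup>+s. ennreal (exponential_density \<alpha> s) * ennreal (g s) \<partial>lborel)"
    by (subst nn_integral_density) auto
  also have "\<dots> = (\<integral>\<^sup>+s. ennreal (g s * (\<alpha> * exp (- \<alpha> * s))) * indicator {0..} s \<partial>lborel)"
    using \<alpha> nonneg
    by (intro nn_integral_cong)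
       (auto simp: exponential_density_def indicator_def ennreal_mult[symmetric] mult_ac)
  also have "\<dots> = ennreal (0 - H 0)"
    by (rule nn_integral_FTC_atLeast[OF _ H _ lim]) (use nonneg \<alpha> in auto)
  also have "0 - H 0 = A * (\<alpha> / (\<alpha> - p)) + B * (\<alpha> / (\<alpha> + q))"
    using a by (simp add: H_def H1_def)
  finally show ?thesis .
qed

definition candidate_value :: "real \<Rightarrow> real \<Rightarrow> real \<Rightarrow> real \<Rightarrow> real \<Rightarrow> real \<Rightarrow> real \<Rightarrow> real" where
  "candidate_value r1 r2 x1 x2 D1 D2 y = (if y < - x1 then - y
     else if y \<le> x2 then D1 * exp (- r1 * (y + x1)) + D2 * exp (r2 * (y - x2)) else y)"

text \<open>\<open>psi1\<close> and \<open>psi2\<close> restate that \<open>- r1\<close> and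
  \<open>r2\<close> solve the characteristic equation: \<open>exp (- r1 * y)\<close> and
  \<open>exp (r2 * y)\<close> are eigenfunctions of the total jump operator with eigenvalue
  \<open>lam1 + lam2 + r\<close>. \<open>val1\<close> and \<open>val2\<close> are continuity at the
  thresholds, \<open>mean1\<close> and \<open>mean2\<close> the matching of mean overshoots.\<close>

context
  fixes lam1 lam2 \<alpha>1 \<alpha>2 r r1 r2 x1 x2 D1 D2 :: real and V :: "real \<Rightarrow> real"
  assumes params: "0 < lam1" "0 < lam2" "0 < \<alpha>1" "0 < \<alpha>2" "0 < r"
    and r12: "0 < r1" "r1 < \<alpha>1" "0 < r2" "r2 < \<alpha>2"
    and psi1: "lam1 * (\<alpha>1 / (\<alpha>1 - r1)) + lam2 * (\<alpha>2 / (\<alpha>2 + r1)) = lam1 + lam2 + r"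
    and psi2: "lam1 * (\<alpha>1 / (\<alpha>1 + r2)) + lam2 * (\<alpha>2 / (\<alpha>2 - r2)) = lam1 + lam2 + r"
    and x12: "0 < x1" "0 < x2"
    and val1: "D1 + D2 * exp (- r2 * (x1 + x2)) = x1"
    and val2: "D2 + D1 * exp (- r1 * (x1 + x2)) = x2"
    and mean1: "x1 + 1 / \<alpha>1 = D1 * (\<alpha>1 / (\<alpha>1 - r1)) + D2 * exp (- r2 * (x1 + x2)) * (\<alpha>1 / (\<alpha>1 + r2))"
    and mean2: "x2 + 1 / \<alpha>2 = D2 * (\<alpha>2 / (\<alpha>2 - r2)) + D1 * exp (- r1 * (x1 + x2)) * (\<alpha>2 / (\<alpha>2 + r1))"
    and V: "V = candidate_value r1 r2 x1 x2 D1 D2"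
begin

text \<open>Split \<open>\<alpha>1 / (\<alpha>1 - r1)\<close> as
  \<open>1 + r1 / (\<alpha>1 - r1)\<close> and likewise the other quotient: the leading parts of
  \<open>mean1\<close> add up to \<open>x1\<close> by \<open>val1\<close> and cancel. What remains
  relates the derivatives of the two exponentials at the left threshold.\<close>

lemma flux1: "r1 * D1 / (\<alpha>1 - r1) = 1 / \<alpha>1 + r2 * D2 * exp (- r2 * (x1 + x2)) / (\<alpha>1 + r2)"
proof -
  have "\<alpha>1 / (\<alpha>1 - r1) = 1 + r1 / (\<alpha>1 - r1)" "\<alpha>1 / (\<alpha>1 + r2) = 1 - r2 / (\<alpha>1 + r2)"
    using r12 by (simp_all add: field_simps)
  with mean1 have "x1 + 1 / \<alpha>1 = D1 * (1 + r1 / (\<alpha>1 - r1)) +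
      D2 * exp (- r2 * (x1 + x2)) * (1 - r2 / (\<alpha>1 + r2))"
    by (simp only:)
  also have "\<dots> = D1 + D2 * exp (- r2 * (x1 + x2)) + r1 * D1 / (\<alpha>1 - r1) -
      r2 * D2 * exp (- r2 * (x1 + x2)) / (\<alpha>1 + r2)"
    by (simp add: algebra_simps)
  finally show ?thesis unfolding val1 by linarith
qed

lemma flux2: "r2 * D2 / (\<alpha>2 - r2) = 1 / \<alpha>2 + r1 * D1 * exp (- r1 * (x1 + x2)) / (\<alpha>2 + r1)"
proof -
  have "\<alpha>2 / (\<alpha>2 - r2) = 1 + r2 / (\<alpha>2 - r2)" "\<alpha>2 / (\<alpha>2 + r1) = 1 - r1 / (\<alpha>2 + r1)"
    using r12 by (simp_all add: field_simps)
  with mean2 have "x2 + 1 / \<alpha>2 = D2 * (1 + r2 / (\<alpha>2 - r2)) +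
      D1 * exp (- r1 * (x1 + x2)) * (1 - r1 / (\<alpha>2 + r1))"
    by (simp only:)
  also have "\<dots> = D2 + D1 * exp (- r1 * (x1 + x2)) + r2 * D2 / (\<alpha>2 - r2) -
      r1 * D1 * exp (- r1 * (x1 + x2)) / (\<alpha>2 + r1)"
    by (simp add: algebra_simps)
  finally show ?thesis unfolding val2 by linarith
qed

text \<open>In the unknowns \<open>r1 * D1\<close> and \<open>r2 * D2\<close> the flux equations
  form a linear system with positive constants \<open>b1\<close>, \<open>b2\<close> and couplings
  \<open>t1\<close>, \<open>t2\<close> between 0 and 1; elimination keeps everything
  positive.\<close>

lemma D_pos: "0 < D1" "0 < D2"
proof -
  define t1 where "t1 = (\<alpha>1 - r1) * exp (- r2 * (x1 + x2)) / (\<alpha>1 + r2)"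
  define t2 where "t2 = (\<alpha>2 - r2) * exp (- r1 * (x1 + x2)) / (\<alpha>2 + r1)"
  define b1 where "b1 = (\<alpha>1 - r1) / \<alpha>1"
  define b2 where "b2 = (\<alpha>2 - r2) / \<alpha>2"
  have b: "0 < b1" "0 < b2" using params r12 by (simp_all add: b1_def b2_def)
  have exps: "exp (- r2 * (x1 + x2)) < 1" "exp (- r1 * (x1 + x2)) < 1"
    using r12 x12 by simp_all
  have "(\<alpha>1 - r1) * exp (- r2 * (x1 + x2)) < (\<alpha>1 + r2) * 1"
    using r12 exps by (intro mult_strict_mono) auto
  moreover have "(\<alpha>2 - r2) * exp (- r1 * (x1 + x2)) < (\<alpha>2 + r1) * 1"
    using r12 exps by (intro mult_strict_mono) auto
  ultimately have t: "0 < t1" "t1 < 1" "0 < t2" "t2 < 1"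
    using r12 by (simp_all add: t1_def t2_def)
  have "r1 * D1 = (\<alpha>1 - r1) * (r1 * D1 / (\<alpha>1 - r1))" using r12 by simp
  then have P1: "r1 * D1 = b1 + t1 * (r2 * D2)"
    unfolding flux1 by (simp add: b1_def t1_def algebra_simps)
  have "r2 * D2 = (\<alpha>2 - r2) * (r2 * D2 / (\<alpha>2 - r2))" using r12 by simp
  then have P2: "r2 * D2 = b2 + t2 * (r1 * D1)"
    unfolding flux2 by (simp add: b2_def t2_def algebra_simps)
  have t12: "t1 * t2 < 1" using mult_strict_mono[of t1 1 t2 1] t by simp
  have "r1 * D1 * (1 - t1 * t2) = b1 + t1 * b2"
    using P1 P2 by algebra
  then have "0 < r1 * D1 * (1 - t1 * t2)" using b t by (simp add: add_pos_pos)
  then have "0 < r1 * D1" using t12 by (simp add: zero_less_mult_iff)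
  moreover from this have "0 < r2 * D2" using P2 t b by (simp add: add_pos_pos)
  ultimately show "0 < D1" "0 < D2" using r12 by (simp_all add: zero_less_mult_iff)
qed

text \<open>The left side is the slope of the middle branch at \<open>x2\<close>. Replacing both
  denominators of \<open>flux2\<close> by \<open>\<alpha>2\<close> errs in the direction wanted. The
  fit is continuous but need not be smooth.\<close>

lemma slope2: "r2 * D2 - r1 * D1 * exp (- r1 * (x1 + x2)) \<le> 1"
proof -
  have "r2 * D2 / \<alpha>2 \<le> r2 * D2 / (\<alpha>2 - r2)"
    using r12 D_pos by (intro divide_left_mono) auto
  moreover have "r1 * D1 * exp (- r1 * (x1 + x2)) / (\<alpha>2 + r1) \<le> r1 * D1 * exp (- r1 * (x1 + x2)) / \<alpha>2"
    using r12 params D_pos by (intro divide_left_mono) auto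
  ultimately have "(r2 * D2 - r1 * D1 * exp (- r1 * (x1 + x2))) / \<alpha>2 \<le> 1 / \<alpha>2"
    using flux2 by (simp add: diff_divide_distrib)
  then show ?thesis using params by (simp add: divide_le_cancel)
qed

lemma slope1: "r1 * D1 - r2 * D2 * exp (- r2 * (x1 + x2)) \<le> 1"
proof -
  have "r1 * D1 / \<alpha>1 \<le> r1 * D1 / (\<alpha>1 - r1)"
    using r12 D_pos by (intro divide_left_mono) auto
  moreover have "r2 * D2 * exp (- r2 * (x1 + x2)) / (\<alpha>1 + r2) \<le> r2 * D2 * exp (- r2 * (x1 + x2)) / \<alpha>1"
    using r12 params D_pos by (intro divide_left_mono) auto
  ultimately have "(r1 * D1 - r2 * D2 * exp (- r2 * (x1 + x2))) / \<alpha>1 \<le> 1 / \<alpha>1"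
    using flux1 by (simp add: diff_divide_distrib)
  then show ?thesis using params by (simp add: divide_le_cancel)
qed

lemma V_left: "y \<le> - x1 \<Longrightarrow> V y = - y"
  using val1 x12 by (auto simp: V candidate_value_def algebra_simps)

lemma V_mid: "- x1 \<le> y \<Longrightarrow> y \<le> x2 \<Longrightarrow> V y = D1 * exp (- r1 * (y + x1)) + D2 * exp (r2 * (y - x2))"
  by (auto simp: V candidate_value_def)

lemma V_right: "x2 \<le> y \<Longrightarrow> V y = y"
  using val2 x12 by (auto simp: V candidate_value_def algebra_simps)

lemma V_mid_slope:
  assumes "- x1 \<le> y" "y \<le> z" "z \<le> x2"
  shows "V z - z \<le> V y - y" "V y + y \<le> V z + z"
proof -
  define w where "w y = D1 * exp (- r1 * (y + x1)) + D2 * exp (r2 * (y - x2))" for y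
  define w' where "w' y = r2 * D2 * exp (r2 * (y - x2)) - r1 * D1 * exp (- r1 * (y + x1))" for y
  have w: "DERIV w y :> w' y" for y
    unfolding w_def w'_def by (auto intro!: derivative_eq_intros)
  \<comment> \<open>Both terms of \<open>w'\<close> increase, so \<open>w'\<close> lies between its
    values at the thresholds, which \<open>slope1\<close> and \<open>slope2\<close> bound.\<close>
  have w': "\<bar>w' t\<bar> \<le> 1" if "- x1 \<le> t" "t \<le> x2" for t
  proof -
    have "r2 * D2 * exp (r2 * (t - x2)) \<le> r2 * D2 * 1"
      using that r12 D_pos by (intro mult_left_mono) (auto simp: mult_nonneg_nonpos)
    moreover have "r1 * D1 * exp (- r1 * (x1 + x2)) \<le> r1 * D1 * exp (- r1 * (t + x1))"
      using that r12 D_pos by (intro mult_left_mono) auto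
    moreover have "r2 * D2 * exp (- r2 * (x1 + x2)) \<le> r2 * D2 * exp (r2 * (t - x2))"
    proof -
      have "- r2 * (x1 + x2) \<le> r2 * (t - x2)"
        using mult_left_mono[of "- (x1 + x2)" "t - x2" r2] that r12
        by (simp add: algebra_simps)
      then show ?thesis using r12 D_pos by (intro mult_left_mono iffD2[OF exp_le_cancel_iff]) auto
    qed
    moreover have "r1 * D1 * exp (- r1 * (t + x1)) \<le> r1 * D1 * 1"
      using that r12 D_pos by (intro mult_left_mono) auto
    ultimately show ?thesis using slope1 slope2 unfolding w'_def by linarith
  qed
  have "w z - z \<le> w y - y"
  proof (rule DERIV_nonpos_imp_nonincreasing[OF assms(2)])
    fix t assume "y \<le> t" "t \<le> z"
    then show "\<exists>D. DERIV (\<lambda>y. w y - y) t :> D \<and> D \<le> 0"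
      using w'[of t] assms by (intro exI[of _ "w' t - 1"]) (auto intro!: derivative_eq_intros w)
  qed
  moreover have "w y + y \<le> w z + z"
  proof (rule DERIV_nonneg_imp_nondecreasing[OF assms(2)])
    fix t assume "y \<le> t" "t \<le> z"
    then show "\<exists>D. DERIV (\<lambda>y. w y + y) t :> D \<and> 0 \<le> D"
      using w'[of t] assms by (intro exI[of _ "w' t + 1"]) (auto intro!: derivative_eq_intros w)
  qed
  ultimately show "V z - z \<le> V y - y" "V y + y \<le> V z + z"
    using assms by (simp_all add: V_mid w_def)
qed

text \<open>This form of the slope bounds survives the kinks at the thresholds and can be integrated
  directly against a jump law.\<close>

lemma V_slope:
  assumes "y \<le> z"
  shows "V z - z \<le> V y - y" "V y + y \<le> V z + z"
proof -
  have m: "- x1 \<le> x2" using x12 by simp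
  consider "z \<le> - x1" | "y \<le> - x1" "- x1 \<le> z" "z \<le> x2" | "y \<le> - x1" "x2 \<le> z" |
    "- x1 \<le> y" "z \<le> x2" | "- x1 \<le> y" "y \<le> x2" "x2 \<le> z" | "x2 \<le> y"
    by linarith
  then have "V z - z \<le> V y - y \<and> V y + y \<le> V z + z"
  proof cases
    case 1 then show ?thesis using assms by (simp add: V_left)
  next
    case 2 then show ?thesis
      using V_mid_slope[of "- x1" z] by (simp add: V_left)
  next
    case 3 then show ?thesis using x12 by (simp add: V_left V_right)
  next
    case 4 then show ?thesis using V_mid_slope assms by blast
  next
    case 5 then show ?thesis
      using V_mid_slope[of y x2] by (simp add: V_right)
  next
    case 6 then show ?thesis using assms by (simp add: V_right)
  qed
  then show "V z - z \<le> V y - y" "V y + y \<le> V z + z" by auto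
qed

text \<open>\<open>V y - y\<close> is nonincreasing and zero from \<open>x2\<close> on, while
  \<open>V y + y\<close> is nondecreasing and zero up to \<open>- x1\<close>.\<close>

lemma V_ge_abs: "\<bar>y\<bar> \<le> V y"
proof -
  have "V (max x2 y) - max x2 y \<le> V y - y" "V (min (- x1) y) + min (- x1) y \<le> V y + y"
    by (intro V_slope; simp)+
  then show ?thesis by (simp add: V_left V_right)
qed

lemma V_nonneg: "0 \<le> V y"
  using V_ge_abs[of y] by linarith

lemma V_stop: "y \<notin> {- x1<..<x2} \<Longrightarrow> V y = \<bar>y\<bar>"
  using x12 by (auto simp: V_left V_right not_less)

lemma V_le_abs: "V y \<le> \<bar>y\<bar> + V 0"
  using V_slope[of 0 y] V_slope[of y 0] by (cases "0 \<le> y") auto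

lemma continuous_on_V: "continuous_on UNIV V"
  unfolding continuous_on_iff
proof (intro ballI allI impI)
  fix y e :: real assume "0 < e"
  moreover have "dist (V z) (V y) \<le> dist z y" for z
    using V_slope[of y z] V_slope[of z y] by (cases "y \<le> z") (auto simp: dist_real_def)
  ultimately show "\<exists>d>0. \<forall>z\<in>UNIV. dist z y < d \<longrightarrow> dist (V z) (V y) < e"
    by (meson order.strict_trans1)
qed

lemma borel_measurable_V[measurable]: "V \<in> borel_measurable borel"
  by (rule borel_measurable_continuous_onI[OF continuous_on_V])

lemma jump_V_shift:
  assumes J: "prob_space J" "sets J = sets borel" and d: "0 \<le> d"
  shows "jump J (\<lambda>y. ennreal (V y)) (y + d) \<le> jump J (\<lambda>y. ennreal (V y)) y + ennreal d"
    "jump J (\<lambda>y. ennreal (V y)) (y - d) \<le> jump J (\<lambda>y. ennreal (V y)) y + ennreal d"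
proof -
  interpret prob_space J by (rule J)
  note [measurable_cong] = J(2)
  have "jump J (\<lambda>y. ennreal (V y)) y + ennreal d = (\<integral>\<^sup>+z. ennreal (V (y + z)) + ennreal d \<partial>J)"
    unfolding jump_def by (subst nn_integral_add) (auto simp: emeasure_space_1)
  also have "\<dots> = (\<integral>\<^sup>+z. ennreal (V (y + z) + d) \<partial>J)"
    using V_nonneg d by (simp add: ennreal_plus)
  finally have eq: "jump J (\<lambda>y. ennreal (V y)) y + ennreal d = (\<integral>\<^sup>+z. ennreal (V (y + z) + d) \<partial>J)" .
  have "V (y + d + z) \<le> V (y + z) + d" "V (y - d + z) \<le> V (y + z) + d" for z
    using V_slope[of "y + z" "y + d + z"] V_slope[of "y - d + z" "y + z"] d by auto
  then show "jump J (\<lambda>y. ennreal (V y)) (y + d) \<le> jump J (\<lambda>y. ennreal (V y)) y + ennreal d"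
    "jump J (\<lambda>y. ennreal (V y)) (y - d) \<le> jump J (\<lambda>y. ennreal (V y)) y + ennreal d"
    unfolding eq unfolding jump_def by (auto intro!: nn_integral_mono ennreal_leI)
qed

lemma jump_V_eq:
  assumes y: "- x1 \<le> y" "y \<le> x2"
  shows "ennreal lam1 * jump (exp_jump \<alpha>1 (- 1)) (\<lambda>y. ennreal (V y)) y +
      ennreal lam2 * jump (exp_jump \<alpha>2 1) (\<lambda>y. ennreal (V y)) y =
    ennreal (lam1 + lam2 + r) * ennreal (V y)"
proof -
  \<comment> \<open>\<open>A\<close> and \<open>B\<close> are the two exponentials at
    \<open>y\<close>, so \<open>V (y - s)\<close> and \<open>V (y + s)\<close> become exponential
    sums in \<open>s\<close> until a threshold is passed.\<close>
  define A where "A = D1 * exp (- r1 * (y + x1))"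
  define B where "B = D2 * exp (r2 * (y - x2))"
  have AB: "0 \<le> A" "0 \<le> B" using D_pos by (simp_all add: A_def B_def)
  have A': "A * exp (r1 * (y + x1)) = D1" "A * exp (- r1 * (x2 - y)) = D1 * exp (- r1 * (x1 + x2))"
    by (simp_all add: A_def exp_add[symmetric] mult.assoc algebra_simps)
  have B': "B * exp (r2 * (x2 - y)) = D2" "B * exp (- r2 * (y + x1)) = D2 * exp (- r2 * (x1 + x2))"
    by (simp_all add: B_def exp_add[symmetric] mult.assoc algebra_simps)
  have "(\<integral>\<^sup>+s. ennreal (V (y - s)) \<partial>density lborel (exponential_density \<alpha>1)) =
      ennreal (A * (\<alpha>1 / (\<alpha>1 - r1)) + B * (\<alpha>1 / (\<alpha>1 + r2)))"
  proof (rule nn_integral_exponential_overshoot[where a="y + x1" and z=x1])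
    fix s :: real assume s: "0 \<le> s"
    show "V (y - s) = (if s \<le> y + x1 then A * exp (r1 * s) + B * exp (- r2 * s) else x1 + (s - (y + x1)))"
    proof (cases "s \<le> y + x1")
      case True
      then have "V (y - s) = D1 * exp (- r1 * (y - s + x1)) + D2 * exp (r2 * (y - s - x2))"
        using s y by (intro V_mid) auto
      also have "D1 * exp (- r1 * (y - s + x1)) = A * exp (r1 * s)"
        by (simp add: A_def mult.assoc exp_add[symmetric] algebra_simps)
      also have "D2 * exp (r2 * (y - s - x2)) = B * exp (- r2 * s)"
        by (simp add: B_def mult.assoc exp_add[symmetric] algebra_simps)
      finally show ?thesis using True by simp
    qed (simp add: V_left)
  qed (use params r12 y V_nonneg A' B' val1 mean1 in simp_all)
  then have J1: "jump (exp_jump \<alpha>1 (- 1)) (\<lambda>y. ennreal (V y)) y =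
      ennreal (A * (\<alpha>1 / (\<alpha>1 - r1)) + B * (\<alpha>1 / (\<alpha>1 + r2)))"
    by (subst jump_exp_jump) auto
  have "(\<integral>\<^sup>+s. ennreal (V (y + s)) \<partial>density lborel (exponential_density \<alpha>2)) =
      ennreal (B * (\<alpha>2 / (\<alpha>2 - r2)) + A * (\<alpha>2 / (\<alpha>2 + r1)))"
  proof (rule nn_integral_exponential_overshoot[where a="x2 - y" and z=x2])
    fix s :: real assume s: "0 \<le> s"
    show "V (y + s) = (if s \<le> x2 - y then B * exp (r2 * s) + A * exp (- r1 * s) else x2 + (s - (x2 - y)))"
    proof (cases "s \<le> x2 - y")
      case True
      then have "V (y + s) = D1 * exp (- r1 * (y + s + x1)) + D2 * exp (r2 * (y + s - x2))"
        using s y by (intro V_mid) auto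
      also have "D1 * exp (- r1 * (y + s + x1)) = A * exp (- r1 * s)"
        by (simp add: A_def mult.assoc exp_add[symmetric] algebra_simps)
      also have "D2 * exp (r2 * (y + s - x2)) = B * exp (r2 * s)"
        by (simp add: B_def mult.assoc exp_add[symmetric] algebra_simps)
      finally show ?thesis using True by simp
    qed (simp add: V_right)
  qed (use params r12 y V_nonneg A' B' val2 mean2 in simp_all)
  then have J2: "jump (exp_jump \<alpha>2 1) (\<lambda>y. ennreal (V y)) y =
      ennreal (B * (\<alpha>2 / (\<alpha>2 - r2)) + A * (\<alpha>2 / (\<alpha>2 + r1)))"
    by (subst jump_exp_jump) auto
  have nn: "0 \<le> A * (\<alpha>1 / (\<alpha>1 - r1)) + B * (\<alpha>1 / (\<alpha>1 + r2))"
    "0 \<le> B * (\<alpha>2 / (\<alpha>2 - r2)) + A * (\<alpha>2 / (\<alpha>2 + r1))"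
    using AB params r12 by auto
  \<comment> \<open>Regrouping by exponential instead of by jump direction brings in the eigenvalue
    equations.\<close>
  have "lam1 * (A * (\<alpha>1 / (\<alpha>1 - r1)) + B * (\<alpha>1 / (\<alpha>1 + r2))) +
      lam2 * (B * (\<alpha>2 / (\<alpha>2 - r2)) + A * (\<alpha>2 / (\<alpha>2 + r1))) =
      A * (lam1 * (\<alpha>1 / (\<alpha>1 - r1)) + lam2 * (\<alpha>2 / (\<alpha>2 + r1))) +
      B * (lam1 * (\<alpha>1 / (\<alpha>1 + r2)) + lam2 * (\<alpha>2 / (\<alpha>2 - r2)))"
    by (simp only: distrib_left mult_ac add_ac)
  also have "\<dots> = (lam1 + lam2 + r) * V y"
    unfolding psi1 psi2 V_mid[OF y] A_def B_def by (simp only: distrib_left mult_ac)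
  finally show ?thesis
    unfolding J1 J2 using nn params V_nonneg
    by (simp only: ennreal_mult[symmetric] ennreal_plus[symmetric] mult_nonneg_nonneg add_nonneg_nonneg less_imp_le)
qed

lemma jump_V_le:
  "ennreal lam1 * jump (exp_jump \<alpha>1 (- 1)) (\<lambda>y. ennreal (V y)) y +
      ennreal lam2 * jump (exp_jump \<alpha>2 1) (\<lambda>y. ennreal (V y)) y \<le>
    ennreal (lam1 + lam2 + r) * ennreal (V y)"
proof -
  note J = prob_space_exp_jump sets_exp_jump
  have *: ?thesis if b: "- x1 \<le> b" "b \<le> x2" and d: "0 \<le> d" and Vy: "V y = V b + d"
    and le: "\<And>J. prob_space J \<Longrightarrow> sets J = sets borel \<Longrightarrow>
      jump J (\<lambda>y. ennreal (V y)) y \<le> jump J (\<lambda>y. ennreal (V y)) b + ennreal d" for b d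
  proof -
    have "ennreal lam1 * jump (exp_jump \<alpha>1 (- 1)) (\<lambda>y. ennreal (V y)) y +
      ennreal lam2 * jump (exp_jump \<alpha>2 1) (\<lambda>y. ennreal (V y)) y \<le>
      ennreal lam1 * (jump (exp_jump \<alpha>1 (- 1)) (\<lambda>y. ennreal (V y)) b + ennreal d) +
      ennreal lam2 * (jump (exp_jump \<alpha>2 1) (\<lambda>y. ennreal (V y)) b + ennreal d)"
      using params by (intro add_mono mult_left_mono le J) auto
    also have "\<dots> = ennreal (lam1 + lam2 + r) * ennreal (V b) + ennreal ((lam1 + lam2) * d)"
      unfolding jump_V_eq[OF b, symmetric] using params d
      by (simp add: distrib_left distrib_right ennreal_mult add_ac)
    also have "\<dots> = ennreal ((lam1 + lam2 + r) * V b + (lam1 + lam2) * d)"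
      using params d V_nonneg[of b] by (simp add: ennreal_mult)
    \<comment> \<open>The slack is \<open>r * d\<close>, the discounting of the excess over the
      threshold value.\<close>
    also have "\<dots> \<le> ennreal ((lam1 + lam2 + r) * V y)"
      using params d unfolding Vy by (intro ennreal_leI) (simp add: algebra_simps)
    also have "\<dots> = ennreal (lam1 + lam2 + r) * ennreal (V y)"
      using params V_nonneg[of y] by (simp add: ennreal_mult)
    finally show ?thesis .
  qed
  consider "- x1 \<le> y" "y \<le> x2" | "x2 < y" | "y < - x1" by linarith
  then show ?thesis
  proof cases
    case 1
    then show ?thesis by (simp add: jump_V_eq)
  next
    case 2
    show ?thesis
    proof (rule *[of x2 "y - x2"])
      fix J :: "real measure" assume "prob_space J" "sets J = sets borel"
      from jump_V_shift(1)[OF this, of "y - x2" x2] 2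
      show "jump J (\<lambda>y. ennreal (V y)) y \<le> jump J (\<lambda>y. ennreal (V y)) x2 + ennreal (y - x2)"
        by simp
    qed (use 2 x12 in \<open>simp_all add: V_right\<close>)
  next
    case 3
    show ?thesis
    proof (rule *[of "- x1" "- x1 - y"])
      fix J :: "real measure" assume "prob_space J" "sets J = sets borel"
      from jump_V_shift(2)[OF this, of "- x1 - y" "- x1"] 3
      show "jump J (\<lambda>y. ennreal (V y)) y \<le> jump J (\<lambda>y. ennreal (V y)) (- x1) + ennreal (- x1 - y)"
        by simp
    qed (use 3 x12 in \<open>simp_all add: V_left\<close>)
  qed
qed

end

section \<open>The boundary equations\<close>

lemma char_exponent_root_bounds:
  assumes pos: "0 < lam1" "0 < lam2" "0 < \<alpha>1" "0 < \<alpha>2" "0 < r"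
    and roots: "0 < r1" "0 < r2" "{z. char_exponent lam1 lam2 \<alpha>1 \<alpha>2 z = r} = {- r1, r2}"
  shows "r1 < \<alpha>1" "r2 < \<alpha>2"
    "lam1 * (\<alpha>1 / (\<alpha>1 - r1)) + lam2 * (\<alpha>2 / (\<alpha>2 + r1)) = lam1 + lam2 + r"
    "lam1 * (\<alpha>1 / (\<alpha>1 + r2)) + lam2 * (\<alpha>2 / (\<alpha>2 - r2)) = lam1 + lam2 + r"
proof -
  obtain s1 s2 where s: "- \<alpha>1 < - s1" "- s1 < 0" "0 < s2" "s2 < \<alpha>2"
    "{z. char_exponent lam1 lam2 \<alpha>1 \<alpha>2 z = r} = {- s1, s2}"
    using char_exponent_roots[OF pos] by blast
  then have "{- r1, r2} = {- s1, s2}" using roots by simp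
  then have "r1 = s1" "r2 = s2"
    using s roots(1,2) by (auto simp: doubleton_eq_iff)
  then show b: "r1 < \<alpha>1" "r2 < \<alpha>2" using s by auto
  have z: "char_exponent lam1 lam2 \<alpha>1 \<alpha>2 (- r1) = r" "char_exponent lam1 lam2 \<alpha>1 \<alpha>2 r2 = r"
    using roots(3) by auto
  have "\<alpha>1 / (\<alpha>1 - r1) = 1 + r1 / (\<alpha>1 - r1)" "\<alpha>2 / (\<alpha>2 + r1) = 1 - r1 / (\<alpha>2 + r1)"
    using b pos roots by (simp_all add: field_simps)
  with z(1) show "lam1 * (\<alpha>1 / (\<alpha>1 - r1)) + lam2 * (\<alpha>2 / (\<alpha>2 + r1)) = lam1 + lam2 + r"
    unfolding char_exponent_def by (simp add: distrib_left right_diff_distrib)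
  have "\<alpha>1 / (\<alpha>1 + r2) = 1 - r2 / (\<alpha>1 + r2)" "\<alpha>2 / (\<alpha>2 - r2) = 1 + r2 / (\<alpha>2 - r2)"
    using b pos roots by (simp_all add: field_simps)
  with z(2) show "lam1 * (\<alpha>1 / (\<alpha>1 + r2)) + lam2 * (\<alpha>2 / (\<alpha>2 - r2)) = lam1 + lam2 + r"
    unfolding char_exponent_def by (simp add: distrib_left right_diff_distrib)
qed

text \<open>The exponential sum taking the values \<open>x\<close> and \<open>x'\<close> at the two ends of the interval, whose
  boundary exponentials are \<open>e = exp (- p u)\<close> and \<open>e' = exp (- q u)\<close>; the linear equation \<open>lin\<close>
  is the condition that its mean overshoot at the first end is right.\<close>

lemma overshoot_mean:
  fixes \<alpha> p q e e' x x' :: real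
  assumes pos: "0 < p" "p < \<alpha>" "0 < q" and ee: "e * e' \<noteq> 1"
    and E: "E = 1 / p - 1 / \<alpha>" and F: "F = (\<alpha> / p) * ((p + q) / (\<alpha> + q))" and G: "G = F - 1"
    and lin: "x * (1 + G * (e * e')) - F * e' * x' = E * (1 - e * e')"
    and D: "D = (x - x' * e') / (1 - e * e')" and D': "D' = (x' - x * e) / (1 - e * e')"
  shows "x + 1 / \<alpha> = D * (\<alpha> / (\<alpha> - p)) + D' * e' * (\<alpha> / (\<alpha> + q))"
proof -
  have ne: "p \<noteq> 0" "\<alpha> \<noteq> 0" "\<alpha> - p \<noteq> 0" "\<alpha> + q \<noteq> 0" "1 - e * e' \<noteq> 0" using pos ee by auto
  have E': "E * (p * \<alpha>) = \<alpha> - p" using ne by (simp add: E field_simps)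
  have F': "F * (p * (\<alpha> + q)) = \<alpha> * (p + q)" using ne by (simp add: F)
  have G': "G * (p * (\<alpha> + q)) = q * (\<alpha> - p)" using F' by (simp add: G algebra_simps)
  \<comment> \<open>This factor clears the denominators of \<open>E\<close>, \<open>F\<close> and
    \<open>G\<close> at once.\<close>
  have "p * \<alpha> * (\<alpha> + q) * (x * (1 + G * (e * e')) - F * e' * x') =
      p * \<alpha> * (\<alpha> + q) * (E * (1 - e * e'))"
    unfolding lin ..
  then have "\<alpha> * x * (p * (\<alpha> + q) + (G * (p * (\<alpha> + q))) * (e * e')) - \<alpha> * (F * (p * (\<alpha> + q))) * e' * x' =
      (E * (p * \<alpha>)) * (\<alpha> + q) * (1 - e * e')"
    by (simp add: algebra_simps)
  then have H: "\<alpha> * x * (p * (\<alpha> + q) + q * (\<alpha> - p) * (e * e')) - \<alpha> * (\<alpha> * (p + q)) * e' * x' =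
      (\<alpha> - p) * (\<alpha> + q) * (1 - e * e')"
    unfolding E' F' G' .
  have D1: "D * (1 - e * e') = x - x' * e'" and D2: "D' * (1 - e * e') = x' - x * e"
    using ne by (simp_all add: D D')
  define m where "m = \<alpha> * (1 - e * e') * (\<alpha> - p) * (\<alpha> + q)"
  have m: "m \<noteq> 0" using ne by (simp add: m_def)
  have "(x + 1 / \<alpha>) * m = (\<alpha> * x + 1) * ((1 - e * e') * (\<alpha> - p) * (\<alpha> + q))"
    using ne by (simp add: m_def field_simps)
  also have "\<dots> = \<alpha> * \<alpha> * ((x - x' * e') * (\<alpha> + q) + (x' - x * e) * e' * (\<alpha> - p))"
    using H by algebra
  also have "\<dots> = \<alpha> * \<alpha> * (D * (1 - e * e') * (\<alpha> + q) + D' * (1 - e * e') * e' * (\<alpha> - p))"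
    unfolding D1 D2 ..
  also have "\<dots> = (D * (\<alpha> / (\<alpha> - p)) + D' * e' * (\<alpha> / (\<alpha> + q))) * m"
  proof -
    have "\<alpha> / (\<alpha> - p) * m = \<alpha> * \<alpha> * (1 - e * e') * (\<alpha> + q)" "\<alpha> / (\<alpha> + q) * m = \<alpha> * \<alpha> * (1 - e * e') * (\<alpha> - p)"
      using ne by (simp_all add: m_def)
    moreover have "(D * (\<alpha> / (\<alpha> - p)) + D' * e' * (\<alpha> / (\<alpha> + q))) * m =
        D * (\<alpha> / (\<alpha> - p) * m) + D' * e' * (\<alpha> / (\<alpha> + q) * m)"
      by (simp only: distrib_right mult.assoc)
    ultimately show ?thesis by (simp only:) (simp add: algebra_simps)
  qed
  finally show ?thesis using m by simp
qed

context
  fixes \<alpha>1 \<alpha>2 r1 r2 E1 E2 F1 F2 G1 G2 :: real and R :: "real \<Rightarrow> real"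
  assumes r12: "0 < r1" "r1 < \<alpha>1" "0 < r2" "r2 < \<alpha>2"
    and E1: "E1 = 1 / r1 - 1 / \<alpha>1"
    and E2: "E2 = 1 / r2 - 1 / \<alpha>2"
    and F1: "F1 = (\<alpha>1 / r1) * ((r1 + r2) / (\<alpha>1 + r2))"
    and F2: "F2 = (\<alpha>2 / r2) * ((r1 + r2) / (r1 + \<alpha>2))"
    and G1: "G1 = F1 - 1"
    and G2: "G2 = F2 - 1"
    and R: "R = (\<lambda>v. (E1 + E2 + (E1 * G2 + E2 * G1) * exp (- (r1 + r2) * v)
                        + E1 * F2 * exp (- r1 * v) + E2 * F1 * exp (- r2 * v))
                     / (1 - G1 * G2 * exp (- (r1 + r2) * v)))"
begin

text \<open>The product form shows the sign, which \<open>F - 1\<close> hides, and lets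
  \<open>r2 / r1\<close> cancel against \<open>r1 / r2\<close> in \<open>G1 * G2\<close>.\<close>

lemma G_eq: "G1 = r2 * (\<alpha>1 - r1) / (r1 * (\<alpha>1 + r2))" "G2 = r1 * (\<alpha>2 - r2) / (r2 * (r1 + \<alpha>2))"
proof -
  have "r1 * (\<alpha>1 + r2) \<noteq> 0" "r2 * (r1 + \<alpha>2) \<noteq> 0" using r12 by auto
  then show "G1 = r2 * (\<alpha>1 - r1) / (r1 * (\<alpha>1 + r2))" "G2 = r1 * (\<alpha>2 - r2) / (r2 * (r1 + \<alpha>2))"
    using r12 by (simp_all add: G1 G2 F1 F2 divide_simps) (simp_all add: algebra_simps)
qed

lemma EFG_pos: "0 < E1" "0 < E2" "0 < F1" "0 < F2" "0 < G1" "0 < G2" "G1 * G2 < 1"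
proof -
  show "0 < E1" "0 < E2" using r12 by (auto simp: E1 E2 intro!: divide_strict_left_mono)
  show "0 < F1" "0 < F2" using r12 by (auto simp: F1 F2)
  show "0 < G1" "0 < G2" using r12 by (auto simp: G_eq)
  have "(\<alpha>1 - r1) / (\<alpha>1 + r2) < 1" "(\<alpha>2 - r2) / (r1 + \<alpha>2) < 1"
    "0 < (\<alpha>1 - r1) / (\<alpha>1 + r2)" "0 < (\<alpha>2 - r2) / (r1 + \<alpha>2)"
    using r12 by simp_all
  then have "(\<alpha>1 - r1) / (\<alpha>1 + r2) * ((\<alpha>2 - r2) / (r1 + \<alpha>2)) < 1 * 1"
    by (intro mult_strict_mono) auto
  moreover have "G1 * G2 = (\<alpha>1 - r1) / (\<alpha>1 + r2) * ((\<alpha>2 - r2) / (r1 + \<alpha>2))"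
    using r12 by (simp add: G_eq)
  ultimately show "G1 * G2 < 1" by simp
qed

lemma R_denominator: "0 \<le> v \<Longrightarrow> 0 < 1 - G1 * G2 * exp (- (r1 + r2) * v)"
proof -
  assume "0 \<le> v"
  then have "- (r1 + r2) * v \<le> 0"
    using r12 by (intro mult_nonpos_nonneg) auto
  then have "exp (- (r1 + r2) * v) \<le> 1" by (simp only: exp_le_one_iff)
  then have "G1 * G2 * exp (- (r1 + r2) * v) \<le> G1 * G2 * 1"
    using EFG_pos by (intro mult_left_mono) auto
  then show ?thesis using EFG_pos(7) by simp
qed

text \<open>The decaying exponentials have positive coefficients in the numerator and a negative one
  in the denominator, which stays positive.\<close>

lemma R_antimono: "0 \<le> v \<Longrightarrow> v \<le> w \<Longrightarrow> R w \<le> R v"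
proof -
  assume v: "0 \<le> v" and vw: "v \<le> w"
  have exps: "exp (- (r1 + r2) * w) \<le> exp (- (r1 + r2) * v)" "exp (- r1 * w) \<le> exp (- r1 * v)"
    "exp (- r2 * w) \<le> exp (- r2 * v)"
    using vw r12 by (simp_all add: mult_left_mono)
  show ?thesis
    unfolding R using exps EFG_pos R_denominator[OF v] R_denominator[of w] v vw
    by (intro frac_le add_mono diff_left_mono mult_left_mono add_nonneg_nonneg mult_nonneg_nonneg
      order.refl) (auto intro!: less_imp_le)
qed

text \<open>\<open>v - R v\<close> is negative at \<open>0\<close> and, since \<open>R\<close> is
  nonincreasing, nonnegative at \<open>R 0\<close>; the same monotonicity excludes a second
  root.\<close>

lemma R_root: "\<exists>!v. 0 < v \<and> v = R v"
proof -
  have R0: "0 < R 0"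
    unfolding R using EFG_pos by (auto intro!: divide_pos_pos add_pos_pos mult_pos_pos)
  have "isCont (\<lambda>v. v - R v) v" if "0 \<le> v" for v
    unfolding R using R_denominator[OF that] by (intro continuous_intros) auto
  moreover have "0 \<le> R 0 - R (R 0)" using R_antimono[of 0 "R 0"] R0 by simp
  ultimately obtain v where v: "0 \<le> v" "v \<le> R 0" "v - R v = 0"
    using IVT[of "\<lambda>v. v - R v" 0 0 "R 0"] R0 by auto
  show ?thesis
  proof (rule ex1I[of _ v])
    show "0 < v \<and> v = R v" using v R0 by (cases "v = 0") auto
  next
    fix w assume w: "0 < w \<and> w = R w"
    show "w = v"
      using R_antimono[of v w] R_antimono[of w v] v w by (cases "v \<le> w") auto
  qed
qed

text \<open>With the exponentials frozen at \<open>u\<close>, the overshoot conditions are linear in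
  the thresholds, and their solution has sum \<open>R u\<close>. The fixed-point equation is thus
  the requirement that the interval have length \<open>u\<close>.\<close>

lemma boundary_equations:
  assumes u: "0 < u" "u = R u"
    and x1: "x1 = (E1 * (1 - exp (- (r1 + r2) * u)) + F1 * u * exp (- r2 * u))
                  / (1 + G1 * exp (- (r1 + r2) * u) + F1 * exp (- r2 * u))"
    and x2: "x2 = (E2 * (1 - exp (- (r1 + r2) * u)) + F2 * u * exp (- r1 * u))
                  / (1 + G2 * exp (- (r1 + r2) * u) + F2 * exp (- r1 * u))"
    and D1: "D1 = (x1 - x2 * exp (- r2 * (x1 + x2))) / (1 - exp (- (r1 + r2) * (x1 + x2)))"
    and D2: "D2 = (x2 - x1 * exp (- r1 * (x1 + x2))) / (1 - exp (- (r1 + r2) * (x1 + x2)))"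
  shows "0 < x1" "0 < x2"
    "D1 + D2 * exp (- r2 * (x1 + x2)) = x1"
    "D2 + D1 * exp (- r1 * (x1 + x2)) = x2"
    "x1 + 1 / \<alpha>1 = D1 * (\<alpha>1 / (\<alpha>1 - r1)) + D2 * exp (- r2 * (x1 + x2)) * (\<alpha>1 / (\<alpha>1 + r2))"
    "x2 + 1 / \<alpha>2 = D2 * (\<alpha>2 / (\<alpha>2 - r2)) + D1 * exp (- r1 * (x1 + x2)) * (\<alpha>2 / (\<alpha>2 + r1))"
proof -
  define e1 where "e1 = exp (- r1 * u)"
  define e2 where "e2 = exp (- r2 * u)"
  have e12: "exp (- (r1 + r2) * u) = e1 * e2"
    by (simp add: e1_def e2_def exp_add[symmetric] algebra_simps)
  have "- (r1 + r2) * u < 0"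
    using u r12 by (intro mult_neg_pos) auto
  then have "exp (- (r1 + r2) * u) < 1" by (simp only: exp_less_one_iff)
  then have e: "0 < e1" "0 < e2" "e1 * e2 < 1"
    unfolding e12 by (simp_all add: e1_def e2_def)
  define d where "d = 1 - G1 * G2 * (e1 * e2)"
  have d: "0 < d" using R_denominator[of u, unfolded e12] u by (simp add: d_def)
  \<comment> \<open>Cramer's rule for the system \<open>lin1\<close>, \<open>lin2\<close> below: the
    determinant is \<open>(1 - e1 * e2) * d\<close>, and \<open>1 - e1 * e2\<close> cancels against
    the right-hand sides.\<close>
  define y1 where "y1 = (E1 * (1 + G2 * (e1 * e2)) + E2 * F1 * e2) / d"
  define y2 where "y2 = (E2 * (1 + G1 * (e1 * e2)) + E1 * F2 * e1) / d"
  have y: "0 < y1" "0 < y2"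
    unfolding y1_def y2_def using d e EFG_pos by (auto intro!: divide_pos_pos add_pos_pos mult_pos_pos)
  have "y1 + y2 = R u"
    unfolding R y1_def y2_def e12 e1_def[symmetric] e2_def[symmetric] d_def[symmetric]
      add_divide_distrib[symmetric]
    by (simp add: algebra_simps)
  then have y12: "y1 + y2 = u" using u by simp
  have yd: "y1 * d = E1 * (1 + G2 * (e1 * e2)) + E2 * F1 * e2" "y2 * d = E2 * (1 + G1 * (e1 * e2)) + E1 * F2 * e1"
    using d by (simp_all add: y1_def y2_def)
  have FG: "F1 = G1 + 1" "F2 = G2 + 1" by (simp_all add: G1 G2)
  have "(y1 * (1 + G1 * (e1 * e2)) - F1 * e2 * y2) * d = E1 * (1 - e1 * e2) * d"
    using yd unfolding d_def FG by algebra
  then have lin1: "y1 * (1 + G1 * (e1 * e2)) - F1 * e2 * y2 = E1 * (1 - e1 * e2)"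
    using d by simp
  have "(y2 * (1 + G2 * (e1 * e2)) - F2 * e1 * y1) * d = E2 * (1 - e1 * e2) * d"
    using yd unfolding d_def FG by algebra
  then have lin2: "y2 * (1 + G2 * (e1 * e2)) - F2 * e1 * y1 = E2 * (1 - e1 * e2)"
    using d by simp
  have den: "0 < 1 + G1 * (e1 * e2) + F1 * e2" "0 < 1 + G2 * (e1 * e2) + F2 * e1"
    using EFG_pos e by (auto intro!: add_pos_pos)
  \<comment> \<open>Putting \<open>u - y1\<close> for \<open>y2\<close> in \<open>lin1\<close>
    leaves one unknown and yields the formula for \<open>x1\<close>.\<close>
  have "y1 * (1 + G1 * (e1 * e2) + F1 * e2) = E1 * (1 - e1 * e2) + F1 * u * e2"
    using lin1 unfolding y12[symmetric] by (simp add: algebra_simps)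
  then have y1: "y1 = x1"
    unfolding x1 e12 e2_def[symmetric] using den by (simp add: field_simps)
  have "y2 * (1 + G2 * (e1 * e2) + F2 * e1) = E2 * (1 - e1 * e2) + F2 * u * e1"
    using lin2 unfolding y12[symmetric] by (simp add: algebra_simps)
  then have y2: "y2 = x2"
    unfolding x2 e12 e1_def[symmetric] using den by (simp add: field_simps)
  show "0 < x1" "0 < x2" using y y1 y2 by auto
  have x12: "x1 + x2 = u" using y12 y1 y2 by simp
  have D1': "D1 = (x1 - x2 * e2) / (1 - e1 * e2)" and D2': "D2 = (x2 - x1 * e1) / (1 - e1 * e2)"
    unfolding D1 D2 x12 e12 by (simp_all add: e1_def e2_def)
  \<comment> \<open>\<open>D1\<close> and \<open>D2\<close> are the Cramer solution of the two
    continuity equations, with determinant \<open>1 - e1 * e2\<close>.\<close>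
  have "D1 * (1 - e1 * e2) = x1 - x2 * e2" "D2 * (1 - e1 * e2) = x2 - x1 * e1"
    using e by (simp_all add: D1' D2')
  then have "(D1 + D2 * e2) * (1 - e1 * e2) = x1 * (1 - e1 * e2)"
    "(D2 + D1 * e1) * (1 - e1 * e2) = x2 * (1 - e1 * e2)" by algebra+
  then show "D1 + D2 * exp (- r2 * (x1 + x2)) = x1" "D2 + D1 * exp (- r1 * (x1 + x2)) = x2"
    using e unfolding x12 e1_def[symmetric] e2_def[symmetric] by auto
  show "x1 + 1 / \<alpha>1 = D1 * (\<alpha>1 / (\<alpha>1 - r1)) + D2 * exp (- r2 * (x1 + x2)) * (\<alpha>1 / (\<alpha>1 + r2))"
    unfolding x12 e2_def[symmetric]
    by (rule overshoot_mean[OF _ _ _ _ E1 F1 G1 _ D1' D2'])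
       (use r12 e lin1 y1 y2 in auto)
  have F2': "F2 = (\<alpha>2 / r2) * ((r2 + r1) / (\<alpha>2 + r1))" by (simp add: F2 add.commute)
  have D1'': "D1 = (x1 - x2 * e2) / (1 - e2 * e1)" and D2'': "D2 = (x2 - x1 * e1) / (1 - e2 * e1)"
    by (simp_all only: D1' D2' mult.commute[of e2 e1])
  show "x2 + 1 / \<alpha>2 = D2 * (\<alpha>2 / (\<alpha>2 - r2)) + D1 * exp (- r1 * (x1 + x2)) * (\<alpha>2 / (\<alpha>2 + r1))"
    unfolding x12 e1_def[symmetric]
    by (rule overshoot_mean[OF _ _ _ _ E2 F2' G2 _ D2'' D1''])
       (use r12 e lin2 y1 y2 in \<open>auto simp: mult.commute[of e2 e1]\<close>)
qed

end

section \<open>The optimal stopping problem\<close>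

text \<open>A jump adds at most \<open>1 / \<alpha>\<close> on average, and \<open>1 \<le> K\<close>
  lets this be absorbed as a multiple of \<open>K + \<bar>y\<bar>\<close>, the form that
  \<open>jump_semigroup_le\<close> asks for.\<close>

lemma jump_affine_le:
  fixes K :: real
  assumes \<alpha>: "0 < \<alpha>" and K: "1 \<le> K"
  shows "jump (exp_jump \<alpha> 1) (\<lambda>y. ennreal (K + \<bar>y\<bar>)) y \<le> ennreal (1 + 1 / \<alpha>) * ennreal (K + \<bar>y\<bar>)"
proof -
  interpret prob_space "density lborel (exponential_density \<alpha>)"
    by (rule prob_space_exponential_density) fact
  have "jump (exp_jump \<alpha> 1) (\<lambda>y. ennreal (K + \<bar>y\<bar>)) y =
      (\<integral>\<^sup>+s. ennreal (K + \<bar>y + s\<bar>) \<partial>density lborel (exponential_density \<alpha>))"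
    by (subst jump_exp_jump) auto
  also have "\<dots> \<le> (\<integral>\<^sup>+s. ennreal (K + \<bar>y\<bar>) + ennreal \<bar>s\<bar> \<partial>density lborel (exponential_density \<alpha>))"
    using K by (intro nn_integral_mono) (simp add: ennreal_plus[symmetric] del: ennreal_plus)
  also have "\<dots> = ennreal (K + \<bar>y\<bar>) + (\<integral>\<^sup>+s. ennreal \<bar>s\<bar> \<partial>density lborel (exponential_density \<alpha>))"
    using emeasure_space_1 by (subst nn_integral_add) auto
  also have "(\<integral>\<^sup>+s. ennreal \<bar>s\<bar> \<partial>density lborel (exponential_density \<alpha>)) =
      (\<integral>\<^sup>+s. ennreal (exponential_density \<alpha> s) * ennreal \<bar>s\<bar> \<partial>lborel)"
    by (subst nn_integral_density) auto
  also have "\<dots> = (\<integral>\<^sup>+s. ennreal (exponential_density \<alpha> s * s ^ 1) \<partial>lborel)"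
    using \<alpha> by (intro nn_integral_cong) (auto simp: exponential_density_def ennreal_mult[symmetric])
  also have "\<dots> = ennreal (1 / \<alpha>)"
    by (subst nn_integral_erlang_ith_moment[OF \<alpha>]) simp
  also have "ennreal (K + \<bar>y\<bar>) + ennreal (1 / \<alpha>) = ennreal (K + \<bar>y\<bar> + 1 / \<alpha> * 1)"
    using \<alpha> K by simp
  also have "\<dots> \<le> ennreal (K + \<bar>y\<bar> + 1 / \<alpha> * (K + \<bar>y\<bar>))"
    using \<alpha> K by (intro ennreal_leI add_left_mono mult_left_mono) auto
  also have "\<dots> = ennreal ((1 + 1 / \<alpha>) * (K + \<bar>y\<bar>))"
    by (simp add: algebra_simps)
  also have "\<dots> = ennreal (1 + 1 / \<alpha>) * ennreal (K + \<bar>y\<bar>)"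
    using \<alpha> K by (intro ennreal_mult) auto
  finally show ?thesis .
qed

text \<open>The target is discrete, so a limit from the right is attained on a whole
  interval.\<close>

lemma at_right_const_nat:
  fixes N :: "real \<Rightarrow> nat"
  assumes "continuous (at_right t) N"
  shows "\<exists>e>0. \<forall>s\<in>{t..<t + e}. N s = N t"
proof -
  have "eventually (\<lambda>s. N s = N t) (at_right t)"
    using assms by (simp add: continuous_within tendsto_discrete)
  then obtain b where "t < b" "\<forall>s>t. s < b \<longrightarrow> N s = N t"
    unfolding eventually_at_right_field by blast
  then show ?thesis
    by (intro exI[of _ "b - t"]) (auto simp: le_less)
qed

context prob_space
begin

lemma AE_iid_exponential_nonneg:
  assumes "iid_exponential \<alpha> Y"
  shows "AE \<omega> in M. \<forall>i\<ge>1. 0 \<le> Y i \<omega>"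
proof -
  have "AE \<omega> in M. 0 \<le> Y i \<omega>" if "1 \<le> i" for i
  proof -
    have "distributed M lborel (Y i) (exponential_density \<alpha>)"
      using assms that by (simp add: iid_exponential_def)
    then show ?thesis
      by (subst distributed_AE2[where N=lborel and f="exponential_density \<alpha>"])
         (auto simp: exponential_density_def)
  qed
  then have "AE \<omega> in M. 1 \<le> i \<longrightarrow> 0 \<le> Y i \<omega>" for i by (cases "1 \<le> i") auto
  then show ?thesis by (simp add: AE_all_countable)
qed

lemma compound_process_at_0:
  assumes "poisson_process lam1 N1" "poisson_process lam2 N2"
  shows "AE \<omega> in M. compound_process x N1 N2 Y1 Y2 0 \<omega> = x"
proof -
  have "AE \<omega> in M. N1 0 \<omega> = 0" "AE \<omega> in M. N2 0 \<omega> = 0"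
    using assms by (auto simp: poisson_process_def)
  then show ?thesis by eventually_elim (simp add: compound_process_def)
qed

lemma compound_process_right_constant:
  assumes "poisson_process lam1 N1" "poisson_process lam2 N2"
  shows "AE \<omega> in M. \<forall>t\<ge>0. \<exists>e>0. \<forall>s\<in>{t..<t + e}.
    compound_process x N1 N2 Y1 Y2 s \<omega> = compound_process x N1 N2 Y1 Y2 t \<omega>"
proof -
  have "AE \<omega> in M. \<forall>t\<ge>0. continuous (at_right t) (\<lambda>s. N1 s \<omega>)"
    "AE \<omega> in M. \<forall>t\<ge>0. continuous (at_right t) (\<lambda>s. N2 s \<omega>)"
    using assms by (auto simp: poisson_process_def)
  then show ?thesis
  proof eventually_elim
    case (elim \<omega>)
    show ?case
    proof (intro allI impI)
      fix t :: real assume t: "0 \<le> t"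
      obtain d where d: "0 < d" "\<forall>s\<in>{t..<t + d}. N1 s \<omega> = N1 t \<omega>"
        using at_right_const_nat elim(1) t by blast
      obtain e where e: "0 < e" "\<forall>s\<in>{t..<t + e}. N2 s \<omega> = N2 t \<omega>"
        using at_right_const_nat elim(2) t by blast
      have *: "compound_process x N1 N2 Y1 Y2 s \<omega> = compound_process x N1 N2 Y1 Y2 t \<omega>"
        if "s \<in> {t..<t + min d e}" for s
      proof -
        have "N1 s \<omega> = N1 t \<omega>" by (rule bspec[OF d(2)]) (use that in \<open>auto simp: min_def split: if_splits\<close>)
        moreover have "N2 s \<omega> = N2 t \<omega>" by (rule bspec[OF e(2)]) (use that in \<open>auto simp: min_def split: if_splits\<close>)
        ultimately show ?thesis by (simp add: compound_process_def)
      qed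
      show "\<exists>e>0. \<forall>s\<in>{t..<t + e}.
          compound_process x N1 N2 Y1 Y2 s \<omega> = compound_process x N1 N2 Y1 Y2 t \<omega>"
        using d(1) e(1) by (intro exI[of _ "min d e"] conjI ballI *) simp_all
    qed
  qed
qed

lemma compound_process_increment:
  assumes pos: "0 < lam1" "0 < lam2" "0 < \<alpha>1" "0 < \<alpha>2" "0 < h"
    and N1: "poisson_process lam1 N1" and N2: "poisson_process lam2 N2"
    and Y1: "iid_exponential \<alpha>1 Y1" and Y2: "iid_exponential \<alpha>2 Y2"
    and indep: "indep_drivers N1 N2 Y1 Y2"
    and f: "f \<in> borel_measurable borel"
    and X: "X = compound_process x N1 N2 Y1 Y2"
  shows "(\<integral>\<^sup>+\<omega>. f (y + (X h \<omega> - X 0 \<omega>)) \<partial>M) =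
    jump_semigroup lam1 (exp_jump \<alpha>1 (- 1)) lam2 (exp_jump \<alpha>2 1) h f y"
proof -
  have "AE \<omega> in M. X 0 \<omega> = x"
    unfolding X by (rule compound_process_at_0[OF N1 N2])
  then have "(\<integral>\<^sup>+\<omega>. f (y + (X h \<omega> - X 0 \<omega>)) \<partial>M) =
      (\<integral>\<^sup>+\<omega>. f (y + (- 1) * (\<Sum>i = 1..N1 h \<omega>. Y1 i \<omega>) + 1 * (\<Sum>i = 1..N2 h \<omega>. Y2 i \<omega>)) \<partial>M)"
  proof (intro nn_integral_cong_AE, eventually_elim)
    case (elim \<omega>)
    have "y + (X h \<omega> - X 0 \<omega>) = y + (- 1) * (\<Sum>i = 1..N1 h \<omega>. Y1 i \<omega>) + 1 * (\<Sum>i = 1..N2 h \<omega>. Y2 i \<omega>)"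
      unfolding elim unfolding X compound_process_def by simp
    then show ?case by (simp only:)
  qed
  also have "\<dots> = jump_semigroup lam1 (exp_jump \<alpha>1 (- 1)) lam2 (exp_jump \<alpha>2 1) h f y"
    by (rule nn_integral_compound[OF pos N1 N2 Y1 Y2 indep f])
  finally show ?thesis .
qed

text \<open>With all jumps counted positively the sums grow with time, so the total at
  \<open>T\<close> dominates every earlier position. Its mean is finite because the jump operators
  enlarge affine growth by at most a constant factor.\<close>

lemma compound_process_majorant:
  assumes pos: "0 < lam1" "0 < lam2" "0 < \<alpha>1" "0 < \<alpha>2" "0 < T"
    and N1: "poisson_process lam1 N1" and N2: "poisson_process lam2 N2"
    and Y1: "iid_exponential \<alpha>1 Y1" and Y2: "iid_exponential \<alpha>2 Y2"
    and indep: "indep_drivers N1 N2 Y1 Y2"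
    and K: "1 \<le> K"
  shows "\<exists>w\<in>borel_measurable M. (\<integral>\<^sup>+\<omega>. w \<omega> \<partial>M) < \<infinity> \<and> (AE \<omega> in M. \<forall>s. 0 \<le> s \<longrightarrow> s \<le> T \<longrightarrow>
    ennreal (K + \<bar>compound_process x N1 N2 Y1 Y2 s \<omega>\<bar>) \<le> w \<omega>)"
proof -
  define f where "f y = ennreal (K + \<bar>y\<bar>)" for y
  have f[measurable]: "f \<in> borel_measurable borel" unfolding f_def[abs_def] by measurable
  define m where "m \<omega> = \<bar>x\<bar> + 1 * (\<Sum>i = 1..N1 T \<omega>. Y1 i \<omega>) + 1 * (\<Sum>i = 1..N2 T \<omega>. Y2 i \<omega>)" for \<omega>
  have N[measurable]: "N1 T \<in> M \<rightarrow>\<^sub>M count_space UNIV" "N2 T \<in> M \<rightarrow>\<^sub>M count_space UNIV"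
    using N1 N2 pos by (auto simp: poisson_process_def)
  have [measurable]: "(\<lambda>\<omega>. \<Sum>i = 1..N1 T \<omega>. Y1 i \<omega>) \<in> borel_measurable M"
    "(\<lambda>\<omega>. \<Sum>i = 1..N2 T \<omega>. Y2 i \<omega>) \<in> borel_measurable M"
    using Y1 Y2 unfolding iid_exponential_def indep_vars_def
    by (intro borel_measurable_random_sum N; simp)+
  have [measurable]: "m \<in> borel_measurable M" unfolding m_def[abs_def] by measurable
  show ?thesis
  proof (intro bexI[of _ "\<lambda>\<omega>. f (m \<omega>)"] conjI)
    define c where "c = lam1 * (1 + 1 / \<alpha>1) + lam2 * (1 + 1 / \<alpha>2)"
    have c: "0 \<le> c" using pos by (simp add: c_def)
    have le: "ennreal lam1 * jump (exp_jump \<alpha>1 1) f y + ennreal lam2 * jump (exp_jump \<alpha>2 1) f y \<le> ennreal c * f y" for y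
    proof -
      have "ennreal lam1 * jump (exp_jump \<alpha>1 1) f y + ennreal lam2 * jump (exp_jump \<alpha>2 1) f y \<le>
          ennreal lam1 * (ennreal (1 + 1 / \<alpha>1) * f y) + ennreal lam2 * (ennreal (1 + 1 / \<alpha>2) * f y)"
        unfolding f_def using pos K by (intro add_mono mult_left_mono jump_affine_le) auto
      also have "\<dots> = (ennreal lam1 * ennreal (1 + 1 / \<alpha>1) + ennreal lam2 * ennreal (1 + 1 / \<alpha>2)) * f y"
        by (simp only: distrib_right mult.assoc)
      also have "ennreal lam1 * ennreal (1 + 1 / \<alpha>1) + ennreal lam2 * ennreal (1 + 1 / \<alpha>2) = ennreal c"
        unfolding c_def using pos
        by (simp add: ennreal_mult[symmetric] ennreal_plus[symmetric] del: ennreal_plus)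
      finally show ?thesis .
    qed
    have "(\<integral>\<^sup>+\<omega>. f (m \<omega>) \<partial>M) = jump_semigroup lam1 (exp_jump \<alpha>1 1) lam2 (exp_jump \<alpha>2 1) T f \<bar>x\<bar>"
      unfolding m_def by (rule nn_integral_compound[OF pos N1 N2 Y1 Y2 indep f])
    also have "\<dots> \<le> ennreal (exp ((c - lam1 - lam2) * T)) * f \<bar>x\<bar>"
      using pos by (intro jump_semigroup_le prob_space_exp_jump sets_exp_jump f c le) auto
    also have "\<dots> < \<infinity>"
      by (simp add: f_def ennreal_mult_less_top)
    finally show "(\<integral>\<^sup>+\<omega>. f (m \<omega>) \<partial>M) < \<infinity>" .
    have "AE \<omega> in M. mono_on {0..} (\<lambda>t. N1 t \<omega>)" "AE \<omega> in M. mono_on {0..} (\<lambda>t. N2 t \<omega>)"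
      using N1 N2 by (auto simp: poisson_process_def)
    then show "AE \<omega> in M. \<forall>s. 0 \<le> s \<longrightarrow> s \<le> T \<longrightarrow>
        ennreal (K + \<bar>compound_process x N1 N2 Y1 Y2 s \<omega>\<bar>) \<le> f (m \<omega>)"
      using AE_iid_exponential_nonneg[OF Y1] AE_iid_exponential_nonneg[OF Y2]
    proof eventually_elim
      case (elim \<omega>)
      show ?case
      proof (intro allI impI)
        fix s assume s: "0 \<le> s" "s \<le> T"
        have "N1 s \<omega> \<le> N1 T \<omega>" "N2 s \<omega> \<le> N2 T \<omega>"
          using elim(1,2) s by (auto simp: mono_on_def)
        then have "(\<Sum>i = 1..N1 s \<omega>. Y1 i \<omega>) \<le> (\<Sum>i = 1..N1 T \<omega>. Y1 i \<omega>)"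
          "(\<Sum>i = 1..N2 s \<omega>. Y2 i \<omega>) \<le> (\<Sum>i = 1..N2 T \<omega>. Y2 i \<omega>)"
          using elim(3,4) by (auto intro!: sum_mono2)
        moreover have "0 \<le> (\<Sum>i = 1..N1 s \<omega>. Y1 i \<omega>)" "0 \<le> (\<Sum>i = 1..N2 s \<omega>. Y2 i \<omega>)"
          using elim(3,4) by (auto intro!: sum_nonneg)
        ultimately have "\<bar>compound_process x N1 N2 Y1 Y2 s \<omega>\<bar> \<le> \<bar>m \<omega>\<bar>"
          unfolding m_def compound_process_def by linarith
        then show "ennreal (K + \<bar>compound_process x N1 N2 Y1 Y2 s \<omega>\<bar>) \<le> f (m \<omega>)"
          unfolding f_def by (intro ennreal_leI) simp
      qed
    qed
  qed measurable
qed

end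

text \<open>The conjuncts on the unique root, integrability and boundedness secure the meaning of
  the others: \<open>THE\<close>, the integral and the real supremum could otherwise return default
  values. The starting point \<open>x\<close> is arbitrary and built into \<open>X\<close>.\<close>

theorem theorem3:
  fixes P :: "'a measure" and F :: "ennreal \<Rightarrow> 'a measure"
    and N1 N2 :: "real \<Rightarrow> 'a \<Rightarrow> nat" and Y1 Y2 :: "nat \<Rightarrow> 'a \<Rightarrow> real"
    and X :: "real \<Rightarrow> 'a \<Rightarrow> real" and \<tau>s :: "'a \<Rightarrow> ennreal" and R V :: "real \<Rightarrow> real"
    and lam1 lam2 \<alpha>1 \<alpha>2 r r1 r2 E1 E2 F1 F2 G1 G2 u x1 x2 D1 D2 x :: real
  assumes params: "0 < lam1" "0 < lam2" "0 < \<alpha>1" "0 < \<alpha>2" "0 < r"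
    and basis: "stochastic_basis P F"
    and N1: "prob_space.poisson_process P lam1 N1"
    and N2: "prob_space.poisson_process P lam2 N2"
    and Y1: "prob_space.iid_exponential P \<alpha>1 Y1"
    and Y2: "prob_space.iid_exponential P \<alpha>2 Y2"
    and indep: "prob_space.indep_drivers P N1 N2 Y1 Y2"
    and X: "X = compound_process x N1 N2 Y1 Y2"
    and levy: "stochastic_basis.levy_process P F X"
    and roots: "0 < r1" "0 < r2"
      "{z. char_exponent lam1 lam2 \<alpha>1 \<alpha>2 z = r} = {- r1, r2}"
    and E1: "E1 = 1 / r1 - 1 / \<alpha>1"
    and E2: "E2 = 1 / r2 - 1 / \<alpha>2"
    and F1: "F1 = (\<alpha>1 / r1) * ((r1 + r2) / (\<alpha>1 + r2))"
    and F2: "F2 = (\<alpha>2 / r2) * ((r1 + r2) / (r1 + \<alpha>2))"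
    and G1: "G1 = F1 - 1"
    and G2: "G2 = F2 - 1"
    and R: "R = (\<lambda>v. (E1 + E2 + (E1 * G2 + E2 * G1) * exp (- (r1 + r2) * v)
                        + E1 * F2 * exp (- r1 * v) + E2 * F1 * exp (- r2 * v))
                     / (1 - G1 * G2 * exp (- (r1 + r2) * v)))"
    and u: "u = (THE v. 0 < v \<and> v = R v)"
    and x1: "x1 = (E1 * (1 - exp (- (r1 + r2) * u)) + F1 * u * exp (- r2 * u))
                  / (1 + G1 * exp (- (r1 + r2) * u) + F1 * exp (- r2 * u))"
    and x2: "x2 = (E2 * (1 - exp (- (r1 + r2) * u)) + F2 * u * exp (- r1 * u))
                  / (1 + G2 * exp (- (r1 + r2) * u) + F2 * exp (- r1 * u))"
    and D1: "D1 = (x1 - x2 * exp (- r2 * (x1 + x2))) / (1 - exp (- (r1 + r2) * (x1 + x2)))"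
    and D2: "D2 = (x2 - x1 * exp (- r1 * (x1 + x2))) / (1 - exp (- (r1 + r2) * (x1 + x2)))"
    and V: "V = (\<lambda>y. if y < - x1 then - y
                     else if y \<le> x2 then D1 * exp (- r1 * (y + x1)) + D2 * exp (r2 * (y - x2))
                     else y)"
    and \<tau>s: "\<tau>s = exit_time X {- x1<..<x2}"
  shows "(\<exists>!v. 0 < v \<and> v = R v) \<and>
    (\<forall>\<tau>. stopping_time F \<tau> \<longrightarrow> integrable P (discounted_payoff r abs X \<tau>)) \<and>
    bdd_above ((\<lambda>\<tau>. prob_space.expectation P (discounted_payoff r abs X \<tau>)) ` {\<tau>. stopping_time F \<tau>}) \<and>
    V x = (SUP \<tau>\<in>{\<tau>. stopping_time F \<tau>}. prob_space.expectation P (discounted_payoff r abs X \<tau>)) \<and>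
    stopping_time F \<tau>s \<and>
    V x = prob_space.expectation P (discounted_payoff r abs X \<tau>s)"
proof -
  interpret stochastic_basis P F by (rule basis)

  \<comment> \<open>The thresholds and the candidate value function\<close>
  have root: "\<exists>!v. 0 < v \<and> v = R v" and u_root: "0 < u" "u = R u"
  proof -
    note b = char_exponent_root_bounds(1,2)[OF params roots]
    show ex1: "\<exists>!v. 0 < v \<and> v = R v"
      by (rule R_root[OF roots(1) b(1) roots(2) b(2) E1 E2 F1 F2 G1 G2 R])
    show "0 < u" "u = R u"
      using theI'[OF ex1] unfolding u by auto
  qed
  note rb = char_exponent_root_bounds[OF params roots]
  note r12 = roots(1) rb(1) roots(2) rb(2)
  note bd = boundary_equations[OF r12 E1 E2 F1 F2 G1 G2 R u_root x1 x2 D1 D2]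
  have V': "V = candidate_value r1 r2 x1 x2 D1 D2"
    unfolding V candidate_value_def[abs_def] ..
  note ctx = params r12 rb(3,4) bd V'
  have A: "{- x1<..<x2} \<in> sets borel" by simp
  let ?v = "\<lambda>y. ennreal (V y)"
  let ?c = "lam1 + lam2 + r"
  note Vm = borel_measurable_V[OF ctx]
  have vm: "?v \<in> borel_measurable borel" using Vm by measurable
  have J1: "prob_space (exp_jump \<alpha>1 (- 1))" and J2: "prob_space (exp_jump \<alpha>2 1)"
    using params by (auto intro: prob_space_exp_jump)
  have V0: "0 \<le> V y" for y by (rule V_nonneg[OF ctx])
  have Vcont: "continuous_on UNIV V" by (rule continuous_on_V[OF ctx])
  note law = compound_process_increment[OF params(1-4) _ N1 N2 Y1 Y2 indep vm X]

  \<comment> \<open>One-step inequalities for the discounted value\<close>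
  have upper: "ennreal (exp (- r * h)) * (\<integral>\<^sup>+\<omega>. ?v (y + (X h \<omega> - X 0 \<omega>)) \<partial>P) \<le> ?v y"
    if "0 \<le> h" for h y
  proof (cases "h = 0")
    case True
    then show ?thesis by (simp add: emeasure_space_1)
  next
    case False
    then have h: "0 < h" using that by simp
    \<comment> \<open>With the rate \<open>?c\<close> the growth factor is
      \<open>exp (r * h)\<close>, which the discount cancels exactly.\<close>
    have "(\<integral>\<^sup>+\<omega>. ?v (y + (X h \<omega> - X 0 \<omega>)) \<partial>P) \<le> ennreal (exp ((?c - lam1 - lam2) * h)) * ?v y"
      unfolding law[OF h]
      by (rule jump_semigroup_le[OF J1 sets_exp_jump J2 sets_exp_jump vm _ _ _ _ jump_V_le[OF ctx]])
         (use params h in auto)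
    then have "ennreal (exp (- r * h)) * (\<integral>\<^sup>+\<omega>. ?v (y + (X h \<omega> - X 0 \<omega>)) \<partial>P) \<le>
        ennreal (exp (- r * h)) * (ennreal (exp (r * h)) * ?v y)"
      by (intro mult_left_mono) auto
    also have "\<dots> = ?v y"
      by (simp add: mult.assoc[symmetric] ennreal_mult[symmetric] exp_add[symmetric])
    finally show ?thesis .
  qed
  have lower: "ennreal (exp (- ?c * h) * (1 + ?c * h)) * ?v y \<le>
      ennreal (exp (- r * h)) * (\<integral>\<^sup>+\<omega>. ?v (y + (X h \<omega> - X 0 \<omega>)) \<partial>P)"
    if h: "0 < h" and y: "y \<in> {- x1<..<x2}" for h y
  proof -
    \<comment> \<open>\<open>?k\<close> is the factor of \<open>jump_semigroup_ge\<close>; together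
      with the discount it becomes the loss factor of \<open>exit_payoff_ge\<close> for
      \<open>c = ?c\<close>.\<close>
    let ?k = "exp (- (lam1 + lam2) * h) * (1 + ?c * h)"
    have "exp (- ?c * h) = exp (- r * h) * exp (- (lam1 + lam2) * h)"
      unfolding exp_add[symmetric] by (simp add: algebra_simps)
    then have "exp (- ?c * h) * (1 + ?c * h) = exp (- r * h) * ?k"
      by (simp only: mult.assoc)
    moreover have "0 \<le> ?k" using params h by (intro mult_nonneg_nonneg add_nonneg_nonneg) auto
    ultimately have "ennreal (exp (- ?c * h) * (1 + ?c * h)) = ennreal (exp (- r * h)) * ennreal ?k"
      by (simp only: ennreal_mult exp_ge_zero)
    then have "ennreal (exp (- ?c * h) * (1 + ?c * h)) * ?v y =
        ennreal (exp (- r * h)) * (ennreal ?k * ?v y)"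
      by (simp only: mult.assoc)
    also have "\<dots> \<le> ennreal (exp (- r * h)) * (\<integral>\<^sup>+\<omega>. ?v (y + (X h \<omega> - X 0 \<omega>)) \<partial>P)"
      unfolding law[OF h] using params h y
      by (intro mult_left_mono jump_semigroup_ge jump_V_eq[OF ctx]) auto
    finally show ?thesis .
  qed
  have const: "AE \<omega> in P. \<forall>t\<ge>0. \<exists>e>0. \<forall>s\<in>{t..<t + e}. X s \<omega> = X t \<omega>"
    unfolding X by (rule compound_process_right_constant[OF N1 N2])
  have X0: "AE \<omega> in P. X 0 \<omega> = x"
    unfolding X by (rule compound_process_at_0[OF N1 N2])
  have start: "(\<integral>\<^sup>+\<omega>. ?v (X 0 \<omega>) \<partial>P) = ?v x"
  proof -
    have "(\<integral>\<^sup>+\<omega>. ?v (X 0 \<omega>) \<partial>P) = (\<integral>\<^sup>+\<omega>. ?v x \<partial>P)"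
      by (intro nn_integral_cong_AE, use X0 in eventually_elim) simp
    then show ?thesis by (simp add: emeasure_space_1)
  qed

  \<comment> \<open>Upper bound for every stopping time\<close>
  have stop: "stopping_time F \<tau>s"
    unfolding \<tau>s by (rule stopping_time_exit_time[OF levy A const])
  have nonneg: "0 \<le> discounted_payoff r abs X \<tau> \<omega>" for \<tau> \<omega>
    by (simp add: discounted_payoff_def)
  have meas: "discounted_payoff r abs X \<tau> \<in> borel_measurable P" if "stopping_time F \<tau>" for \<tau>
    by (rule borel_measurable_discounted_payoff[OF levy _ _ _ that])
       (use params in \<open>auto intro!: continuous_intros\<close>)
  have le: "(\<integral>\<^sup>+\<omega>. ennreal (discounted_payoff r abs X \<tau> \<omega>) \<partial>P) \<le> ?v x" if "stopping_time F \<tau>" for \<tau>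
  proof -
    have "(\<integral>\<^sup>+\<omega>. ennreal (discounted_payoff r abs X \<tau> \<omega>) \<partial>P) \<le>
        (\<integral>\<^sup>+\<omega>. ennreal (discounted_payoff r V X \<tau> \<omega>) \<partial>P)"
      using V_ge_abs[OF ctx]
      by (intro nn_integral_mono ennreal_leI) (simp add: discounted_payoff_def)
    also have "\<dots> \<le> (\<integral>\<^sup>+\<omega>. ?v (X 0 \<omega>) \<partial>P)"
      by (rule discounted_payoff_le[OF levy Vcont V0 _ that upper]) (use params in auto)
    finally show ?thesis unfolding start .
  qed
  have int: "integrable P (discounted_payoff r abs X \<tau>)" if "stopping_time F \<tau>" for \<tau>
    using le[OF that] nonneg
    by (intro integrableI_nonneg meas that) (auto intro: le_less_trans)
  have eq: "ennreal (expectation (discounted_payoff r abs X \<tau>)) =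
      (\<integral>\<^sup>+\<omega>. ennreal (discounted_payoff r abs X \<tau> \<omega>) \<partial>P)" if "stopping_time F \<tau>" for \<tau>
    by (rule nn_integral_eq_integral[symmetric, OF int[OF that]]) (simp add: nonneg)
  have exp_le: "expectation (discounted_payoff r abs X \<tau>) \<le> V x" if "stopping_time F \<tau>" for \<tau>
    using le[OF that] V0 unfolding eq[OF that, symmetric] by (simp add: ennreal_le_iff)

  \<comment> \<open>Attainment at the exit time\<close>
  have "?v x \<le> (\<integral>\<^sup>+\<omega>. ennreal (discounted_payoff r V X (exit_time X {- x1<..<x2}) \<omega>) \<partial>P)"
    unfolding start[symmetric]
  proof (rule exit_payoff_ge[OF levy Vcont V0 params(5) A const _ lower])
    fix y assume "y \<in> {- x1<..<x2}"
    then show "V y \<le> x1 + x2 + V 0" using V_le_abs[OF ctx, of y] bd(1,2) by auto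
  next
    fix T :: nat
    \<comment> \<open>\<open>T\<close> may be \<open>0\<close>, while the majorant uses laws at a
      positive time; hence the extra unit. The constant \<open>1 + V 0\<close> meets both
      \<open>1 \<le> K\<close> and \<open>V_le_abs\<close>.\<close>
    have "0 < real T + 1" "1 \<le> 1 + V 0" using V0 by simp_all
    from compound_process_majorant[OF params(1-4) this(1) N1 N2 Y1 Y2 indep this(2), of x]
    obtain w where w: "w \<in> borel_measurable P" "(\<integral>\<^sup>+\<omega>. w \<omega> \<partial>P) < \<infinity>"
      "AE \<omega> in P. \<forall>s. 0 \<le> s \<longrightarrow> s \<le> real T + 1 \<longrightarrow> ennreal (1 + V 0 + \<bar>X s \<omega>\<bar>) \<le> w \<omega>"
      unfolding X by auto
    show "\<exists>w\<in>borel_measurable P. (\<integral>\<^sup>+\<omega>. w \<omega> \<partial>P) < \<infinity> \<and>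
        (AE \<omega> in P. \<forall>s. 0 \<le> s \<longrightarrow> s \<le> real T \<longrightarrow> ?v (X s \<omega>) \<le> w \<omega>)"
    proof (intro bexI[OF _ w(1)] conjI w(2))
      show "AE \<omega> in P. \<forall>s. 0 \<le> s \<longrightarrow> s \<le> real T \<longrightarrow> ?v (X s \<omega>) \<le> w \<omega>"
        using w(3)
      proof eventually_elim
        case (elim \<omega>)
        show ?case
        proof (intro allI impI)
          fix s assume "0 \<le> s" "s \<le> real T"
          then have "ennreal (1 + V 0 + \<bar>X s \<omega>\<bar>) \<le> w \<omega>" using elim by simp
          moreover have "?v (X s \<omega>) \<le> ennreal (1 + V 0 + \<bar>X s \<omega>\<bar>)"
            using V_le_abs[OF ctx, of "X s \<omega>"] by (intro ennreal_leI) simp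
          ultimately show "?v (X s \<omega>) \<le> w \<omega>" by simp
        qed
      qed
    qed
  qed (use params in auto)
  \<comment> \<open>The exit time is attained, so the process is then outside the open interval,
    where \<open>V\<close> equals the payoff.\<close>
  also have "\<dots> = (\<integral>\<^sup>+\<omega>. ennreal (discounted_payoff r abs X \<tau>s \<omega>) \<partial>P)"
  proof (intro nn_integral_cong_AE)
    show "AE \<omega> in P. ennreal (discounted_payoff r V X (exit_time X {- x1<..<x2}) \<omega>) =
        ennreal (discounted_payoff r abs X \<tau>s \<omega>)"
      using const
    proof eventually_elim
      case (elim \<omega>)
      show ?case
      proof (cases "\<forall>s\<ge>0. X s \<omega> \<in> {- x1<..<x2}")
        case True
        then have "exit_time X {- x1<..<x2} \<omega> = \<infinity>" by (intro exit_time_eq_top) auto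
        then show ?thesis by (simp add: discounted_payoff_def \<tau>s)
      next
        case False
        then obtain s where s: "0 \<le> s" "X s \<omega> \<notin> {- x1<..<x2}" by blast
        obtain t where "0 \<le> t" "X t \<omega> \<notin> {- x1<..<x2}" "exit_time X {- x1<..<x2} \<omega> = ennreal t"
          by (rule exit_time_attained[of X \<omega> s "{- x1<..<x2}", OF elim s])
        then show ?thesis
          using V_stop[OF ctx, of "X t \<omega>"] by (simp add: discounted_payoff_def \<tau>s)
      qed
    qed
  qed
  finally have "?v x \<le> ennreal (expectation (discounted_payoff r abs X \<tau>s))"
    unfolding eq[OF stop] .
  then have "V x \<le> expectation (discounted_payoff r abs X \<tau>s)"
    using nonneg by (simp add: ennreal_le_iff integral_nonneg_AE)
  then have opt: "V x = expectation (discounted_payoff r abs X \<tau>s)"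
    using exp_le[OF stop] by simp
  have bdd: "bdd_above ((\<lambda>\<tau>. expectation (discounted_payoff r abs X \<tau>)) ` {\<tau>. stopping_time F \<tau>})"
    using exp_le by (intro bdd_aboveI[of _ "V x"]) auto
  have "V x = (SUP \<tau>\<in>{\<tau>. stopping_time F \<tau>}. expectation (discounted_payoff r abs X \<tau>))"
  proof (rule antisym)
    show "V x \<le> (SUP \<tau>\<in>{\<tau>. stopping_time F \<tau>}. expectation (discounted_payoff r abs X \<tau>))"
      unfolding opt using stop by (intro cSUP_upper bdd) simp
    show "(SUP \<tau>\<in>{\<tau>. stopping_time F \<tau>}. expectation (discounted_payoff r abs X \<tau>)) \<le> V x"
      using stop exp_le by (intro cSUP_least) auto
  qed
  then show ?thesis
    using root int bdd stop opt by blast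
qed

end
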